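(* Let $(M,g)$ be a three-dimensional spacetime and let $\varphi:V\subset\mathbb{R}^3\to U\subset M$, $(x_1,x_2,x_3)\mapsto\varphi(x_1,x_2,x_3)$, be local coordinates in which $g$ is diagonal, $g=\mathrm{diag}(g_{11},g_{22},g_{33})$ with $g_{11},g_{22}>0$ and $g_{33}<0$ smooth functions on $V$. Let $u_i=\varphi_*e_i$ be the coordinate vector fields on $U$, and let $$\Psi:V\times(0,2\pi)\to\mathcal{P}C,\qquad \Psi(x_1,x_2,x_3,\theta)=\left\langle \frac{\cos\theta}{\sqrt{g_{11}}}u_1+\frac{\sin\theta}{\sqrt{g_{22}}}u_2+\frac{1}{\sqrt{-g_{33}}}u_3\right\rangle\subset T_{\varphi(x_1,x_2,x_3)}M$$ be the induced local coordinates on $\mathcal{P}C$, with coordinate vector fields $\partial_{x_1},\partial_{x_2},\partial_{x_3},\partial_\theta$. Then the kernel $\mathcal{W}$ of the Engel distribution on $\mathcal{P}C$ defined by the Lorentz prolongation is spanned, on $\Psi(V\times(0,2\pi))$, by the vector field $$Z:=\frac{\cos\theta}{\sqrt{g_{11}}}\partial_{x_1}+\frac{\sin\theta}{\sqrt{g_{22}}}\partial_{x_2}+\frac{1}{\sqrt{-g_{33}}}\partial_{x_3}+(F\cos\theta+G\sin\theta+H)\partial_\theta,$$ where $$F:=\frac{1}{2g_{11}}\left(\frac{1}{\sqrt{g_{22}}}\frac{\partial g_{11}}{\partial x_2}+\frac{\sin\theta}{\sqrt{-g_{33}}}\frac{\partial g_{11}}{\partial x_3}\right),$$ $$G:=-\frac{1}{2g_{22}}\left(\frac{1}{\sqrt{g_{11}}}\frac{\partial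 g_{22}}{\partial x_1}+\frac{\cos\theta}{\sqrt{-g_{33}}}\frac{\partial g_{22}}{\partial x_3}\right),$$ $$H:=\frac{1}{2g_{33}}\left(\frac{\sin\theta}{\sqrt{g_{11}}}\frac{\partial g_{33}}{\partial x_1}-\frac{\cos\theta}{\sqrt{g_{22}}}\frac{\partial g_{33}}{\partial x_2}\right).$$
   Context: A spacetime is a time-oriented connected Lorentzian manifold of dimension $\geq3$. Every point of a three-dimensional one lies in a chart in which the metric is diagonal. For distributions, $[\cdot,\cdot]$ means the bracket of sections. An Engel structure on a four-manifold $Q$ is a rank-two distribution $\mathcal{D}\subset TQ$ such that $\mathcal{E}:=[\mathcal{D},\mathcal{D}]$ is a rank-three distribution with $[\mathcal{E},\mathcal{E}]=TQ$. It determines a unique line field $\mathcal{W}\subset\mathcal{E}$ with $[\mathcal{W},\mathcal{E}]\subseteq\mathcal{E}$, called the kernel; moreover $\mathcal{W}\subset\mathcal{D}$. Lorentz prolongation: for a Lorentzian three-manifold $(M,g)$, $\pi_L:\mathcal{P}C\to M$ is the circle bundle whose fibre over $x$ is the set of null lines $l\subset T_xM$ (the projectivization of the null cone $C_x$). It carries the Engel structure $\mathcal{D}_{(x,l)}:=(T_{(x,l)}\pi_L)^{-1}(l)$. $\langle\cdot\rangle$ denotes linear span. *)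

theory Defs
  imports "HOL-Analysis.Analysis" "HOL-Library.Function_Algebras"
begin

(* Tangent vectors are represented by functionals on real functions, so they live in a function
   space; this makes span, dim, ... of the library available for them. *)

instantiation "fun" :: (type, real_vector) real_vector
begin
definition scaleR_fun :: "real \<Rightarrow> ('a \<Rightarrow> 'b) \<Rightarrow> 'a \<Rightarrow> 'b"
  where "scaleR_fun r f = (\<lambda>x. r *\<^sub>R f x)"
instance
  by standard (auto simp: scaleR_fun_def fun_eq_iff scaleR_add_right scaleR_add_left)
end


section \<open>Smooth functions between Euclidean spaces\<close>

(* Meant for open S. *)

primrec Ck_on ::
  "nat \<Rightarrow> 'e::euclidean_space set \<Rightarrow> ('e \<Rightarrow> 'b::real_normed_vector) \<Rightarrow> bool"
where
  "Ck_on 0 S f \<longleftrightarrow> continuous_on S f"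
| "Ck_on (Suc k) S f \<longleftrightarrow>
     (\<forall>x\<in>S. f differentiable at x) \<and>
     (\<forall>v. Ck_on k S (\<lambda>x. frechet_derivative f (at x) v))"

definition smooth_on ::
  "'e::euclidean_space set \<Rightarrow> ('e \<Rightarrow> 'b::real_normed_vector) \<Rightarrow> bool"
where
  "smooth_on S f \<longleftrightarrow> (\<forall>k. Ck_on k S f)"

definition partial_deriv :: "3 \<Rightarrow> (real^3 \<Rightarrow> real) \<Rightarrow> real^3 \<Rightarrow> real" where
  "partial_deriv i f x = frechet_derivative f (at x) (axis i 1)"


section \<open>Smooth manifolds\<close>

(* A manifold is given by an atlas of local parametrizations (V, \<phi>), where V is an open subset of
   the model space 'e and \<phi> maps V bijectively onto a coordinate patch.  The underlying set is the
   union of the patches, the dimension is DIM('e). *)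

type_synonym ('e, 'a) atlas = "('e set \<times> ('e \<Rightarrow> 'a)) set"

definition carrier :: "('e, 'a) atlas \<Rightarrow> 'a set" where
  "carrier M = (\<Union>(V, \<phi>)\<in>M. \<phi> ` V)"

definition manifold_topology :: "('e::euclidean_space, 'a) atlas \<Rightarrow> 'a topology" where
  "manifold_topology M =
     topology (\<lambda>U. U \<subseteq> carrier M \<and> (\<forall>(V, \<phi>)\<in>M. open (V \<inter> \<phi> -` U)))"

definition smooth_transition ::
  "'e::euclidean_space set \<times> ('e \<Rightarrow> 'a) \<Rightarrow> 'e set \<times> ('e \<Rightarrow> 'a) \<Rightarrow> bool"
where
  "smooth_transition c c' = (case (c, c') of ((V, \<phi>), (V', \<phi>')) \<Rightarrow>
     open (V \<inter> \<phi> -` (\<phi>' ` V')) \<and>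
     smooth_on (V \<inter> \<phi> -` (\<phi>' ` V')) (inv_into V' \<phi>' \<circ> \<phi>))"

definition smooth_manifold :: "('e::euclidean_space, 'a) atlas \<Rightarrow> bool" where
  "smooth_manifold M \<longleftrightarrow>
     (\<forall>(V, \<phi>)\<in>M. open V \<and> inj_on \<phi> V) \<and>
     (\<forall>c\<in>M. \<forall>c'\<in>M. smooth_transition c c') \<and>
     Hausdorff_space (manifold_topology M) \<and>
     second_countable (manifold_topology M)"

(* Local coordinates are the members of the maximal atlas. *)

definition local_coordinates ::
  "('e::euclidean_space, 'a) atlas \<Rightarrow> 'e set \<Rightarrow> ('e \<Rightarrow> 'a) \<Rightarrow> bool"
where
  "local_coordinates M V \<phi> \<longleftrightarrow>
     open V \<and> inj_on \<phi> V \<and> \<phi> ` V \<subseteq> carrier M \<and>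
     (\<forall>c\<in>M. smooth_transition c (V, \<phi>) \<and> smooth_transition (V, \<phi>) c)"

(* f is smooth on some neighbourhood of p *)

definition smooth_at ::
  "('e::euclidean_space, 'a) atlas \<Rightarrow> ('a \<Rightarrow> real) \<Rightarrow> 'a \<Rightarrow> bool"
where
  "smooth_at M f p \<longleftrightarrow>
     (\<forall>(V, \<phi>)\<in>M. \<forall>x\<in>V. \<phi> x = p \<longrightarrow>
        (\<exists>N. open N \<and> x \<in> N \<and> N \<subseteq> V \<and> smooth_on N (f \<circ> \<phi>)))"


section \<open>Tangent vectors, vector fields, Lie bracket\<close>

(* A tangent vector at p acts as a directional derivative on the functions that are smooth near p;
   its value on all other functions is fixed to 0, so that equal vectors are equal functionals. *)

type_synonym 'a tvec = "('a \<Rightarrow> real) \<Rightarrow> real"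

(* push M \<phi> x v = the tangent vector \<phi>\<^sub>* v at \<phi> x *)

definition push ::
  "('e::euclidean_space, 'a) atlas \<Rightarrow> ('e \<Rightarrow> 'a) \<Rightarrow> 'e \<Rightarrow> 'e \<Rightarrow> 'a tvec"
where
  "push M \<phi> x v =
     (\<lambda>f. if smooth_at M f (\<phi> x) then frechet_derivative (f \<circ> \<phi>) (at x) v else 0)"

definition tangent :: "('e::euclidean_space, 'a) atlas \<Rightarrow> 'a \<Rightarrow> 'a tvec set" where
  "tangent M p = {push M \<phi> x v |V \<phi> x v. (V, \<phi>) \<in> M \<and> x \<in> V \<and> \<phi> x = p}"

(* The differential of F : N -> M applied to a tangent vector X of N at q; M is the target. *)

definition differential ::
  "('e::euclidean_space, 'a) atlas \<Rightarrow> ('b \<Rightarrow> 'a) \<Rightarrow> 'b \<Rightarrow> 'b tvec \<Rightarrow> 'a tvec"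
where
  "differential M F q X = (\<lambda>f. if smooth_at M f (F q) then X (f \<circ> F) else 0)"

definition vector_field_on ::
  "('e::euclidean_space, 'a) atlas \<Rightarrow> 'a set \<Rightarrow> ('a \<Rightarrow> 'a tvec) \<Rightarrow> bool"
where
  "vector_field_on M U X \<longleftrightarrow>
     (\<forall>p\<in>U. X p \<in> tangent M p \<and>
        (\<forall>f. smooth_at M f p \<longrightarrow> smooth_at M (\<lambda>q. X q f) p))"

definition lie_bracket ::
  "('e::euclidean_space, 'a) atlas \<Rightarrow> ('a \<Rightarrow> 'a tvec) \<Rightarrow> ('a \<Rightarrow> 'a tvec) \<Rightarrow> 'a \<Rightarrow> 'a tvec"
where
  "lie_bracket M X Y p =
     (\<lambda>f. if smooth_at M f p then X p (\<lambda>q. Y q f) - Y p (\<lambda>q. X q f) else 0)"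


section \<open>Distributions and Engel structures\<close>

(* smooth distribution of rank k over the open set U *)

definition distribution_on ::
  "('e::euclidean_space, 'a) atlas \<Rightarrow> 'a set \<Rightarrow> nat \<Rightarrow> ('a \<Rightarrow> 'a tvec set) \<Rightarrow> bool"
where
  "distribution_on Q U k D \<longleftrightarrow>
     (\<forall>p\<in>U. \<exists>N X. openin (manifold_topology Q) N \<and> p \<in> N \<and> N \<subseteq> U \<and>
        (\<forall>i<k. vector_field_on Q N (X i)) \<and>
        (\<forall>q\<in>N. D q = span ((\<lambda>i. X i q) ` {..<k}) \<and> dim (D q) = k))"

definition section_on ::
  "('e::euclidean_space, 'a) atlas \<Rightarrow> 'a set \<Rightarrow> ('a \<Rightarrow> 'a tvec set) \<Rightarrow> ('a \<Rightarrow> 'a tvec) \<Rightarrow> bool"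
where
  "section_on Q U D X \<longleftrightarrow> vector_field_on Q U X \<and> (\<forall>q\<in>U. X q \<in> D q)"

(* [D, D'] at p: spanned by the brackets of local sections *)

definition bracket ::
  "('e::euclidean_space, 'a) atlas \<Rightarrow> ('a \<Rightarrow> 'a tvec set) \<Rightarrow> ('a \<Rightarrow> 'a tvec set) \<Rightarrow>
    'a \<Rightarrow> 'a tvec set"
where
  "bracket Q D D' p = span {lie_bracket Q X Y p |N X Y.
     openin (manifold_topology Q) N \<and> p \<in> N \<and> section_on Q N D X \<and> section_on Q N D' Y}"

(* Engel structure on the open subset U of the four-manifold Q *)

definition engel_structure_on ::
  "('e::euclidean_space, 'a) atlas \<Rightarrow> 'a set \<Rightarrow> ('a \<Rightarrow> 'a tvec set) \<Rightarrow> bool"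
where
  "engel_structure_on Q U D \<longleftrightarrow>
     DIM('e) = 4 \<and>
     distribution_on Q U 2 D \<and>
     distribution_on Q U 3 (bracket Q D D) \<and>
     (\<forall>p\<in>U. bracket Q (bracket Q D D) (bracket Q D D) p = tangent Q p)"

(* W is the kernel, over U, of the Engel structure D: the unique line field W in E = [D, D] with
   [W, E] contained in E. *)

definition engel_kernel_on ::
  "('e::euclidean_space, 'a) atlas \<Rightarrow> 'a set \<Rightarrow> ('a \<Rightarrow> 'a tvec set) \<Rightarrow>
    ('a \<Rightarrow> 'a tvec set) \<Rightarrow> bool"
where
  "engel_kernel_on Q U D W \<longleftrightarrow>
     engel_structure_on Q U D \<and>
     distribution_on Q U 1 W \<and>
     (\<forall>p\<in>U. W p \<subseteq> bracket Q D D p \<and>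
             bracket Q W (bracket Q D D) p \<subseteq> bracket Q D D p)"


section \<open>Spacetimes\<close>

(* smooth symmetric bilinear form on the tangent spaces, of signature (-,+,...,+) *)

definition lorentz_metric ::
  "('e::euclidean_space, 'a) atlas \<Rightarrow> ('a \<Rightarrow> 'a tvec \<Rightarrow> 'a tvec \<Rightarrow> real) \<Rightarrow> bool"
where
  "lorentz_metric M g \<longleftrightarrow>
     (\<forall>p\<in>carrier M.
        (\<forall>v\<in>tangent M p. \<forall>w\<in>tangent M p. g p v w = g p w v) \<and>
        (\<forall>v\<in>tangent M p. \<forall>v'\<in>tangent M p. \<forall>w\<in>tangent M p. \<forall>a b.
           g p (a *\<^sub>R v + b *\<^sub>R v') w = a * g p v w + b * g p v' w) \<and>
        (\<exists>e :: nat \<Rightarrow> 'a tvec.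
           tangent M p = span (e ` {..<DIM('e)}) \<and>
           (\<forall>i<DIM('e). \<forall>j<DIM('e).
              g p (e i) (e j) = (if i \<noteq> j then 0 else if i = 0 then -1 else 1)))) \<and>
     (\<forall>U X Y. openin (manifold_topology M) U \<longrightarrow>
        vector_field_on M U X \<longrightarrow> vector_field_on M U Y \<longrightarrow>
        (\<forall>p\<in>U. smooth_at M (\<lambda>q. g q (X q) (Y q)) p))"

(* \<tau> p is the future cone at p: one of the two components of the set of timelike vectors,
   selected near each point by a smooth timelike vector field. *)

definition time_orientation ::
  "('e::euclidean_space, 'a) atlas \<Rightarrow> ('a \<Rightarrow> 'a tvec \<Rightarrow> 'a tvec \<Rightarrow> real) \<Rightarrow>
    ('a \<Rightarrow> 'a tvec set) \<Rightarrow> bool"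
where
  "time_orientation M g \<tau> \<longleftrightarrow>
     (\<forall>p\<in>carrier M. \<exists>N X. openin (manifold_topology M) N \<and> p \<in> N \<and> vector_field_on M N X \<and>
        (\<forall>q\<in>N. g q (X q) (X q) < 0 \<and>
                \<tau> q = {v \<in> tangent M q. g q v v < 0 \<and> g q v (X q) < 0}))"

definition spacetime ::
  "('e::euclidean_space, 'a) atlas \<Rightarrow> ('a \<Rightarrow> 'a tvec \<Rightarrow> 'a tvec \<Rightarrow> real) \<Rightarrow>
    ('a \<Rightarrow> 'a tvec set) \<Rightarrow> bool"
where
  "spacetime M g \<tau> \<longleftrightarrow>
     DIM('e) \<ge> 3 \<and> smooth_manifold M \<and> connected_space (manifold_topology M) \<and>
     lorentz_metric M g \<and> time_orientation M g \<tau>"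


section \<open>Lorentz prolongation of a Lorentzian three-manifold\<close>

definition null_lines ::
  "('e::euclidean_space, 'a) atlas \<Rightarrow> ('a \<Rightarrow> 'a tvec \<Rightarrow> 'a tvec \<Rightarrow> real) \<Rightarrow> 'a \<Rightarrow> 'a tvec set set"
where
  "null_lines M g x = {span {v} |v. v \<in> tangent M x \<and> v \<noteq> 0 \<and> g x v v = 0}"

(* the total space; the bundle projection is fst *)

definition null_line_bundle ::
  "('e::euclidean_space, 'a) atlas \<Rightarrow> ('a \<Rightarrow> 'a tvec \<Rightarrow> 'a tvec \<Rightarrow> real) \<Rightarrow>
    ('a \<times> 'a tvec set) set"
where
  "null_line_bundle M g = (SIGMA x:carrier M. null_lines M g x)"

definition orthonormal_frame_on ::
  "('e::euclidean_space, 'a) atlas \<Rightarrow> ('a \<Rightarrow> 'a tvec \<Rightarrow> 'a tvec \<Rightarrow> real) \<Rightarrow> 'a set \<Rightarrow>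
    (3 \<Rightarrow> 'a \<Rightarrow> 'a tvec) \<Rightarrow> bool"
where
  "orthonormal_frame_on M g U e \<longleftrightarrow>
     (\<forall>i. vector_field_on M U (e i)) \<and>
     (\<forall>p\<in>U. \<forall>i j. g p (e i p) (e j p) = (if i \<noteq> j then 0 else if i = 3 then -1 else 1))"

(* The smooth structure of the circle bundle.  With respect to a smooth orthonormal frame e1, e2, e3
   (e3 timelike) over a coordinate patch, each null line is <cos t e1 + sin t e2 + e3> for exactly
   one t modulo 2 pi; the coordinates of the base together with this angle are the coordinates of
   the bundle.  All such frames are admitted. *)

definition lorentz_prolongation ::
  "(real^3, 'a) atlas \<Rightarrow> ('a \<Rightarrow> 'a tvec \<Rightarrow> 'a tvec \<Rightarrow> real) \<Rightarrow>
    ((real^3) \<times> real, 'a \<times> 'a tvec set) atlas"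
where
  "lorentz_prolongation M g =
     {(V \<times> {a<..<a + 2 * pi},
       \<lambda>(x, t). (\<phi> x, span {cos t *\<^sub>R e 1 (\<phi> x) + sin t *\<^sub>R e 2 (\<phi> x) + e 3 (\<phi> x)})) |V \<phi> a e.
      local_coordinates M V \<phi> \<and> orthonormal_frame_on M g (\<phi> ` V) e}"

definition prolongation_distribution ::
  "(real^3, 'a) atlas \<Rightarrow> ('a \<Rightarrow> 'a tvec \<Rightarrow> 'a tvec \<Rightarrow> real) \<Rightarrow>
    'a \<times> 'a tvec set \<Rightarrow> ('a \<times> 'a tvec set) tvec set"
where
  "prolongation_distribution M g q =
     {X \<in> tangent (lorentz_prolongation M g) q. differential M fst q X \<in> snd q}"

end

theory Submission
  imports Defs
begin

text \<open>In the coordinates given by the chart and the angle, the Engel plane is spanned by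
  \<open>\<partial>\<^sub>\<theta>\<close> and the null field \<open>A\<close>. Its derived distribution \<open>E\<close> is spanned by \<open>\<partial>\<^sub>\<theta>\<close>, \<open>A\<close> and
  \<open>B = [\<partial>\<^sub>\<theta>, A]\<close>, so it is the kernel of the one-form \<open>\<Lambda>\<close> that is metrically dual to the null
  direction. For sections \<open>X\<close>, \<open>Y\<close> of \<open>E\<close> one has \<open>\<Lambda>([X, Y]) = -d\<Lambda>(X, Y)\<close>, which is tensorial;
  hence a section of \<open>E\<close> spans the kernel of the Engel structure exactly if it spans the
  radical of \<open>d\<Lambda>\<close> on \<open>E\<close>. On the frame \<open>\<partial>\<^sub>\<theta>\<close>, \<open>A\<close>, \<open>B\<close> the only non-zero entries of this form are
  those pairing \<open>B\<close> with the other two, so the radical is spanned by \<open>A + c \<partial>\<^sub>\<theta>\<close> with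
  \<open>c = \<Lambda>([A, B])\<close>, and differentiating the square roots of the metric coefficients turns \<open>c\<close>
  into \<open>F cos \<theta> + G sin \<theta> + H\<close>.\<close>

section \<open>Calculus of smooth functions\<close>

text \<open>Tangent vectors are functionals on functions of a manifold, so they cannot be
  differentiated directly. \<open>push\<close> identifies them, linearly and injectively, with
  vectors of the coordinate space, and \<open>bracket\<close> becomes a span of commutators of local
  coordinate sections; the Engel computation then lives on an open subset of R^3 x R. This
  dictionary is needed for \<open>M\<close> and for the circle bundle. For the bundle it presupposes
  that charts built from arbitrary orthonormal frames are compatible, which is where the angle has
  to be a smooth function of the null line. A kernel over the whole bundle is known only through its
  defining conditions, so an arbitrary local generator is tested against the two sections
  \<open>\<Theta>\<close> and \<open>B\<close>: the first removes its \<open>B\<close>-component,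
  the second fixes the ratio of the other two. The factors 1/(2 g_ii) in F, G, H are logarithmic
  derivatives: for p_i = sqrt |g_ii| one has dp_i / p_i = dg_ii / (2 g_ii), also for i = 3, where
  two minus signs cancel.\<close>

lemma frechet_derivative_cong:
  assumes "open S" "x \<in> S" "\<And>y. y \<in> S \<Longrightarrow> f y = g y"
  shows "frechet_derivative f (at x) = frechet_derivative g (at x)"
proof -
  have "(f has_derivative D) (at x) \<longleftrightarrow> (g has_derivative D) (at x)" for D
    using has_derivative_transform_within_open[of f D x UNIV S g]
      has_derivative_transform_within_open[of g D x UNIV S f] assms by auto
  then show ?thesis
    by (simp add: frechet_derivative_def)
qed

lemma differentiable_cong:
  assumes "open S" "x \<in> S" "\<And>y. y \<in> S \<Longrightarrow> f y = g y" "f differentiable at x"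
  shows "g differentiable at x"
  using assms has_derivative_transform_within_open[of f _ x UNIV S g]
  unfolding differentiable_def by blast

lemma frechet_derivative_eqI:
  "(f has_derivative D) (at x) \<Longrightarrow> frechet_derivative f (at x) v = D v"
  by (metis frechet_derivative_at)

lemma has_derivative_frechet:
  "f differentiable at x \<Longrightarrow> (f has_derivative frechet_derivative f (at x)) (at x)"
  by (simp add: frechet_derivative_works)

section \<open>Calculus of C^k functions on open sets\<close>

lemma Ck_on_cong:
  assumes "open S" "\<And>x. x \<in> S \<Longrightarrow> f x = g x" "Ck_on k S f"
  shows "Ck_on k S g"
  using assms
proof (induction k arbitrary: f g)
  case 0
  then show ?case by (simp cong: continuous_on_cong)
next
  case (Suc k)
  have "Ck_on k S (\<lambda>x. frechet_derivative g (at x) v)" for v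
  proof (rule Suc.IH[OF Suc.prems(1)])
    show "Ck_on k S (\<lambda>x. frechet_derivative f (at x) v)" using Suc.prems by simp
    show "frechet_derivative f (at x) v = frechet_derivative g (at x) v" if "x \<in> S" for x
      using frechet_derivative_cong[OF Suc.prems(1) that, of f g] Suc.prems by simp
  qed
  then show ?case
    using Suc.prems differentiable_cong[of S _ f g] by auto
qed

lemma Ck_on_subset: "Ck_on k S f \<Longrightarrow> T \<subseteq> S \<Longrightarrow> Ck_on k T f"
  by (induction k arbitrary: f) (auto intro: continuous_on_subset)

lemma Ck_on_local:
  assumes "\<And>x. x \<in> S \<Longrightarrow> \<exists>N. open N \<and> x \<in> N \<and> Ck_on k N f"
  shows "Ck_on k S f"
  using assms
proof (induction k arbitrary: f)
  case 0
  have "isCont f x" if "x \<in> S" for x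
    using 0[OF that] by (auto simp: continuous_on_eq_continuous_at)
  then show ?case by (simp add: continuous_at_imp_continuous_on)
next
  case (Suc k)
  then show ?case
    by (fastforce intro!: Suc.IH)
qed

lemma Ck_on_Suc: "Ck_on (Suc k) S f \<Longrightarrow> Ck_on k S f"
proof (induction k arbitrary: f)
  case 0
  then show ?case
    by (auto intro!: continuous_at_imp_continuous_on differentiable_imp_continuous_within)
next
  case (Suc k)
  then show ?case by (auto simp del: Ck_on.simps(1))
qed

lemma Ck_on_const: "Ck_on k S (\<lambda>x. c)"
  by (induction k arbitrary: c) auto

lemma Ck_on_bounded_linear:
  assumes L: "bounded_linear L" and "open S" "Ck_on k S f"
  shows "Ck_on k S (\<lambda>x. L (f x))"
  using assms(2,3)
proof (induction k arbitrary: f)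
  case 0
  then show ?case
    by (auto intro!: bounded_linear.continuous_on[OF L])
next
  case (Suc k)
  have D: "((\<lambda>x. L (f x)) has_derivative (\<lambda>v. L (frechet_derivative f (at x) v))) (at x)"
    if "x \<in> S" for x
    using Suc.prems that by (auto intro!: bounded_linear.has_derivative[OF L] has_derivative_frechet)
  have "Ck_on k S (\<lambda>x. frechet_derivative (\<lambda>x. L (f x)) (at x) v)" for v
    by (rule Ck_on_cong[OF Suc.prems(1) _ Suc.IH[OF Suc.prems(1)]])
      (use Suc.prems frechet_derivative_eqI[OF D] in auto)
  then show ?case
    using D by (auto simp: differentiable_def)
qed

lemma Ck_on_add:
  assumes "open S" "Ck_on k S f" "Ck_on k S g"
  shows "Ck_on k S (\<lambda>x. f x + g x)"
  using assms
proof (induction k arbitrary: f g)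
  case 0
  then show ?case by (simp add: continuous_on_add)
next
  case (Suc k)
  have D: "((\<lambda>x. f x + g x) has_derivative
      (\<lambda>v. frechet_derivative f (at x) v + frechet_derivative g (at x) v)) (at x)"
    if "x \<in> S" for x
    using Suc.prems that by (auto intro!: has_derivative_add has_derivative_frechet)
  have "Ck_on k S (\<lambda>x. frechet_derivative (\<lambda>x. f x + g x) (at x) v)" for v
    by (rule Ck_on_cong[OF Suc.prems(1) _ Suc.IH[OF Suc.prems(1)]])
      (use Suc.prems frechet_derivative_eqI[OF D] in auto)
  then show ?case
    using D by (auto simp: differentiable_def)
qed

lemma Ck_on_sum:
  assumes "open S" "\<And>i. i \<in> I \<Longrightarrow> Ck_on k S (f i)"
  shows "Ck_on k S (\<lambda>x. \<Sum>i\<in>I. f i x)"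
  using assms
  by (induction I rule: infinite_finite_induct) (auto intro: Ck_on_add Ck_on_const)

text \<open>One product rule for scalar multiples, inner products and real products. Each summand of
  the derivative keeps an undifferentiated factor, which has to be lowered from C^(k+1) to C^k
  before the induction hypothesis applies.\<close>

lemma Ck_on_bilinear:
  fixes f :: "'e::euclidean_space \<Rightarrow> 'a::real_normed_vector"
  assumes B: "bounded_bilinear pr"
    and "open S" "Ck_on k S f" "Ck_on k S g"
  shows "Ck_on k S (\<lambda>x. pr (f x) (g x))"
  using assms(2-)
proof (induction k arbitrary: f g)
  case 0
  then show ?case by (auto intro!: bounded_bilinear.continuous_on[OF B])
next
  case (Suc k)
  have D: "((\<lambda>x. pr (f x) (g x)) has_derivative
      (\<lambda>v. pr (f x) (frechet_derivative g (at x) v) + pr (frechet_derivative f (at x) v) (g x)))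
      (at x)"
    if "x \<in> S" for x
    using Suc.prems that
    by (auto intro!: bounded_bilinear.FDERIV[OF B] has_derivative_frechet)
  have "Ck_on k S (\<lambda>x. frechet_derivative (\<lambda>x. pr (f x) (g x)) (at x) v)" for v
  proof (rule Ck_on_cong[OF Suc.prems(1)])
    show "Ck_on k S (\<lambda>x. pr (f x) (frechet_derivative g (at x) v)
        + pr (frechet_derivative f (at x) v) (g x))"
      using Suc.prems Ck_on_Suc[OF Suc.prems(2)] Ck_on_Suc[OF Suc.prems(3)]
      by (auto intro!: Ck_on_add Suc.IH)
  qed (use frechet_derivative_eqI[OF D] in auto)
  then show ?case
    using D by (auto simp: differentiable_def)
qed

text \<open>By the chain rule the derivative of \<open>h\<close> is taken in a direction that moves
  with \<open>x\<close>, whereas \<open>Ck_on\<close> speaks of fixed directions. Expanding that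
  direction in \<open>Basis\<close> leaves products of C^k functions with derivatives in fixed
  directions.\<close>

lemma Ck_on_compose:
  fixes f :: "'e::euclidean_space \<Rightarrow> 'f::euclidean_space"
    and h :: "'f \<Rightarrow> 'b::real_normed_vector"
  assumes "open S" "open T" "f ` S \<subseteq> T" "Ck_on k S f" "Ck_on k T h"
  shows "Ck_on k S (\<lambda>x. h (f x))"
  using assms
proof (induction k arbitrary: h)
  case 0
  then show ?case by (auto intro: continuous_on_compose2)
next
  case (Suc k)
  have D: "((\<lambda>x. h (f x)) has_derivative
      (\<lambda>v. frechet_derivative h (at (f x)) (frechet_derivative f (at x) v))) (at x)"
    if "x \<in> S" for x
    using Suc.prems that
    by (auto intro!: has_derivative_compose[of f] has_derivative_frechet)
  have E: "frechet_derivative h (at (f x)) w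
      = (\<Sum>b\<in>Basis. (w \<bullet> b) *\<^sub>R frechet_derivative h (at (f x)) b)" if "x \<in> S" for x w
  proof -
    have "linear (frechet_derivative h (at (f x)))"
      using Suc.prems that by (auto intro!: linear_frechet_derivative)
    then have "frechet_derivative h (at (f x)) (\<Sum>b\<in>Basis. (w \<bullet> b) *\<^sub>R b)
        = (\<Sum>b\<in>Basis. (w \<bullet> b) *\<^sub>R frechet_derivative h (at (f x)) b)"
      by (simp add: linear_sum linear_scale)
    then show ?thesis by (simp add: euclidean_representation)
  qed
  have "Ck_on k S (\<lambda>x. frechet_derivative (\<lambda>x. h (f x)) (at x) v)" for v
  proof (rule Ck_on_cong[OF Suc.prems(1)])
    show "Ck_on k S (\<lambda>x. \<Sum>b\<in>Basis. (frechet_derivative f (at x) v \<bullet> b) *\<^sub>R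
        frechet_derivative h (at (f x)) b)"
      using Suc.prems Ck_on_Suc[OF Suc.prems(4)]
      by (auto intro!: Ck_on_sum Ck_on_bilinear[OF bounded_bilinear_scaleR] Suc.IH
          Ck_on_bounded_linear[OF bounded_linear_inner_left])
  qed (use frechet_derivative_eqI[OF D] E in auto)
  then show ?case
    using D by (auto simp: differentiable_def)
qed

section \<open>Smooth functions and their closure properties\<close>

lemma smooth_on_cong:
  "open S \<Longrightarrow> (\<And>x. x \<in> S \<Longrightarrow> f x = g x) \<Longrightarrow> smooth_on S f \<Longrightarrow> smooth_on S g"
  unfolding smooth_on_def using Ck_on_cong by blast

lemma smooth_on_subset: "smooth_on S f \<Longrightarrow> T \<subseteq> S \<Longrightarrow> smooth_on T f"
  unfolding smooth_on_def using Ck_on_subset by blast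

lemma smooth_on_local:
  assumes "\<And>x. x \<in> S \<Longrightarrow> \<exists>N. open N \<and> x \<in> N \<and> smooth_on N f"
  shows "smooth_on S f"
  unfolding smooth_on_def
proof
  show "Ck_on k S f" for k
    by (rule Ck_on_local) (use assms in \<open>auto simp: smooth_on_def\<close>)
qed

lemma smooth_on_const: "smooth_on S (\<lambda>x. c)"
  by (simp add: smooth_on_def Ck_on_const)

lemma smooth_on_differentiable: "smooth_on S f \<Longrightarrow> x \<in> S \<Longrightarrow> f differentiable at x"
  unfolding smooth_on_def using Ck_on.simps(2) by blast

lemma smooth_on_has_derivative:
  "smooth_on S f \<Longrightarrow> x \<in> S \<Longrightarrow> (f has_derivative frechet_derivative f (at x)) (at x)"
  by (simp add: has_derivative_frechet smooth_on_differentiable)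

lemma smooth_on_derivative: "smooth_on S f \<Longrightarrow> smooth_on S (\<lambda>x. frechet_derivative f (at x) v)"
  unfolding smooth_on_def using Ck_on.simps(2) by blast

lemma smooth_on_continuous_on: "smooth_on S f \<Longrightarrow> continuous_on S f"
  unfolding smooth_on_def using Ck_on.simps(1) by blast

lemma open_smooth_vimage:
  assumes "open S" "smooth_on S f" "open B"
  shows "open (S \<inter> f -` B)"
proof -
  have "\<forall>B. open B \<longrightarrow> open (f -` B \<inter> S)"
    using smooth_on_continuous_on[OF assms(2)] by (simp only: continuous_on_open_vimage[OF assms(1)])
  then show ?thesis using assms(3) by (simp add: Int_commute)
qed

lemma smooth_on_I:
  assumes "\<And>x. x \<in> S \<Longrightarrow> f differentiable at x"
    and "\<And>v. smooth_on S (\<lambda>x. frechet_derivative f (at x) v)"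
  shows "smooth_on S f"
proof -
  have "Ck_on (Suc k) S f" for k
    using assms by (auto simp: smooth_on_def)
  then show ?thesis
    unfolding smooth_on_def using Ck_on_Suc by blast
qed

lemma smooth_on_bounded_linear:
  "bounded_linear L \<Longrightarrow> open S \<Longrightarrow> smooth_on S f \<Longrightarrow> smooth_on S (\<lambda>x. L (f x))"
  by (simp add: smooth_on_def Ck_on_bounded_linear)

lemma smooth_on_id: "open S \<Longrightarrow> smooth_on S (\<lambda>x. x)"
  by (rule smooth_on_I) (auto simp: smooth_on_const)

lemma smooth_on_add:
  "open S \<Longrightarrow> smooth_on S f \<Longrightarrow> smooth_on S g \<Longrightarrow> smooth_on S (\<lambda>x. f x + g x)"
  by (simp add: smooth_on_def Ck_on_add)

lemma smooth_on_sum: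
  "open S \<Longrightarrow> (\<And>i. i \<in> I \<Longrightarrow> smooth_on S (f i)) \<Longrightarrow> smooth_on S (\<lambda>x. \<Sum>i\<in>I. f i x)"
  by (simp add: smooth_on_def Ck_on_sum)

lemma smooth_on_bilinear:
  "bounded_bilinear pr \<Longrightarrow> open S \<Longrightarrow> smooth_on S f \<Longrightarrow> smooth_on S g \<Longrightarrow>
    smooth_on S (\<lambda>x. pr (f x) (g x))"
  by (simp add: smooth_on_def Ck_on_bilinear)

lemmas smooth_on_scaleR = smooth_on_bilinear[OF bounded_bilinear_scaleR]
lemmas smooth_on_inner = smooth_on_bilinear[OF bounded_bilinear_inner]
lemmas smooth_on_mult = smooth_on_bilinear[OF bounded_bilinear_mult]

lemma smooth_on_minus: "open S \<Longrightarrow> smooth_on S f \<Longrightarrow> smooth_on S (\<lambda>x. - f x)"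
  by (rule smooth_on_bounded_linear[OF bounded_linear_minus[OF bounded_linear_ident]])

lemma smooth_on_diff:
  "open S \<Longrightarrow> smooth_on S f \<Longrightarrow> smooth_on S g \<Longrightarrow> smooth_on S (\<lambda>x. f x - g x)"
  using smooth_on_add[of S f "\<lambda>x. - g x"] by (simp add: smooth_on_minus)

lemma smooth_on_compose:
  fixes f :: "'e::euclidean_space \<Rightarrow> 'f::euclidean_space"
  shows "open S \<Longrightarrow> open T \<Longrightarrow> f ` S \<subseteq> T \<Longrightarrow> smooth_on S f \<Longrightarrow> smooth_on T h \<Longrightarrow>
    smooth_on S (\<lambda>x. h (f x))"
  by (simp add: smooth_on_def Ck_on_compose)

lemma smooth_on_Pair:
  assumes "open S" "smooth_on S f" "smooth_on S g"
  shows "smooth_on S (\<lambda>x. (f x, g x))"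
proof -
  have 1: "bounded_linear (\<lambda>a. (a, 0))" "bounded_linear (\<lambda>b. (0, b))"
    by (auto intro: bounded_linear_Pair bounded_linear_zero bounded_linear_ident)
  have "smooth_on S (\<lambda>x. (f x, 0) + (0, g x))"
    by (intro smooth_on_add assms smooth_on_bounded_linear[OF 1(1)] smooth_on_bounded_linear[OF 1(2)])
  then show ?thesis by simp
qed

text \<open>A bootstrap: if \<open>h'\<close> is as regular as \<open>h\<close>, each order of
  differentiability yields the next. It serves \<open>inverse\<close> and \<open>sqrt\<close>, whose
  derivatives are expressed through the functions themselves, and \<open>arctan\<close>, whose
  derivative is rational.\<close>

lemma smooth_on_real:
  fixes h :: "real \<Rightarrow> real"
  assumes S: "open S" and h: "\<And>x. x \<in> S \<Longrightarrow> (h has_real_derivative h' x) (at x)"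
    and h': "\<And>k. Ck_on k S h \<Longrightarrow> Ck_on k S h'"
  shows "smooth_on S h"
proof -
  have "Ck_on k S h" for k
  proof (induction k)
    case 0
    then show ?case
      using h by (auto intro!: continuous_at_imp_continuous_on DERIV_isCont)
  next
    case (Suc k)
    have D: "(h has_derivative (\<lambda>v. h' x * v)) (at x)" if "x \<in> S" for x
      using h[OF that] by (simp add: has_field_derivative_def)
    have "Ck_on k S (\<lambda>x. frechet_derivative h (at x) v)" for v
      by (rule Ck_on_cong[OF S, where f="\<lambda>x. h' x * v"])
        (use frechet_derivative_eqI[OF D] Ck_on_bounded_linear[OF bounded_linear_mult_left S]
          h'[OF Suc] in auto)
    then show ?case using D by (auto simp: differentiable_def)
  qed
  then show ?thesis by (simp add: smooth_on_def)
qed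

text \<open>The span of sine and cosine is closed under differentiation, so an induction over all
  coefficients at once replaces a mutual induction.\<close>

lemma smooth_on_sin_cos: "smooth_on UNIV (\<lambda>t::real. a * sin t + b * cos t)"
proof -
  have "Ck_on k UNIV (\<lambda>t::real. a * sin t + b * cos t)" for k
  proof (induction k arbitrary: a b)
    case (Suc k)
    have D: "((\<lambda>t. a * sin t + b * cos t) has_derivative
        (\<lambda>v. ((- b * v) * sin x + (a * v) * cos x))) (at x)" for x
      by (auto intro!: derivative_eq_intros simp: algebra_simps)
    have "Ck_on k UNIV (\<lambda>x. frechet_derivative (\<lambda>t. a * sin t + b * cos t) (at x) v)" for v
      unfolding frechet_derivative_eqI[OF D] by (rule Suc)
    then show ?case using D by (auto simp: differentiable_def)
  qed (auto intro!: continuous_intros)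
  then show ?thesis by (simp add: smooth_on_def)
qed

lemma smooth_on_inverse_real: "smooth_on (- {0}) (inverse :: real \<Rightarrow> real)"
  by (rule smooth_on_real[where h'="\<lambda>x. - (inverse x * inverse x)"])
    (auto intro!: DERIV_inverse' derivative_eq_intros Ck_on_bilinear[OF bounded_bilinear_mult]
      Ck_on_bounded_linear[OF bounded_linear_minus[OF bounded_linear_ident]])

lemma smooth_on_inverse:
  fixes f :: "'e::euclidean_space \<Rightarrow> real"
  assumes "open S" "smooth_on S f" "\<And>x. x \<in> S \<Longrightarrow> f x \<noteq> 0"
  shows "smooth_on S (\<lambda>x. inverse (f x))"
proof (rule smooth_on_compose[OF assms(1) _ _ assms(2) smooth_on_inverse_real])
  show "f ` S \<subseteq> - {0}" using assms(3) by (auto simp: image_subset_iff)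
qed (simp add: open_Compl)

lemma smooth_on_divide:
  fixes f :: "'e::euclidean_space \<Rightarrow> real"
  assumes "open S" "smooth_on S f" "smooth_on S g" "\<And>x. x \<in> S \<Longrightarrow> g x \<noteq> 0"
  shows "smooth_on S (\<lambda>x. f x / g x)"
  using smooth_on_mult[OF assms(1,2) smooth_on_inverse[OF assms(1,3,4)]]
  by (simp add: divide_inverse)

lemma smooth_on_sqrt_real: "smooth_on {0<..} sqrt"
proof (rule smooth_on_real[where h'="\<lambda>x. inverse (sqrt x) * (1/2)"])
  fix k assume *: "Ck_on k {0<..} sqrt"
  have "Ck_on k {0<..} (\<lambda>x. inverse (sqrt x))"
    by (rule Ck_on_compose[OF _ _ _ *, of "- {0}"])
      (use smooth_on_inverse_real in \<open>auto simp: smooth_on_def\<close>)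
  then show "Ck_on k {0<..} (\<lambda>x. inverse (sqrt x) * (1/2))"
    by (intro Ck_on_bounded_linear[OF bounded_linear_mult_left]) auto
qed (auto intro!: derivative_eq_intros)

lemma smooth_on_sqrt:
  fixes f :: "'e::euclidean_space \<Rightarrow> real"
  assumes "open S" "smooth_on S f" "\<And>x. x \<in> S \<Longrightarrow> f x > 0"
  shows "smooth_on S (\<lambda>x. sqrt (f x))"
  using smooth_on_compose[OF assms(1) _ _ assms(2) smooth_on_sqrt_real] assms(3) by auto

lemma smooth_on_cos:
  assumes "open S" "smooth_on S f"
  shows "smooth_on S (\<lambda>x. cos (f x :: real))"
  using smooth_on_compose[OF assms(1) open_UNIV _ assms(2) smooth_on_sin_cos[of 0 1]] by simp

lemma smooth_on_sin:
  assumes "open S" "smooth_on S f"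
  shows "smooth_on S (\<lambda>x. sin (f x :: real))"
  using smooth_on_compose[OF assms(1) open_UNIV _ assms(2) smooth_on_sin_cos[of 1 0]] by simp

lemma smooth_on_arctan_real: "smooth_on UNIV arctan"
proof (rule smooth_on_real[where h'="\<lambda>x. inverse (1 + x * x)"])
  have "smooth_on UNIV (\<lambda>x::real. inverse (1 + x * x))"
    by (intro smooth_on_inverse smooth_on_add smooth_on_const smooth_on_mult smooth_on_id)
      (auto simp: add_nonneg_eq_0_iff)
  then show "Ck_on k UNIV (\<lambda>x::real. inverse (1 + x * x))" for k
    by (simp add: smooth_on_def)
qed (auto intro!: derivative_eq_intros simp: power2_eq_square)

lemma smooth_on_arctan:
  assumes "open S" "smooth_on S f"
  shows "smooth_on S (\<lambda>x. arctan (f x))"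
  using smooth_on_compose[OF assms(1) open_UNIV _ assms(2) smooth_on_arctan_real] by simp

text \<open>Base point and direction both vary; in a basis this is a sum of products of smooth
  functions.\<close>

lemma smooth_on_derivative_along:
  fixes f :: "'e::euclidean_space \<Rightarrow> 'b::real_normed_vector"
  assumes "open S" "smooth_on S f" "smooth_on S \<xi>"
  shows "smooth_on S (\<lambda>x. frechet_derivative f (at x) (\<xi> x))"
proof (rule smooth_on_cong[OF assms(1)])
  show "smooth_on S (\<lambda>x. \<Sum>b\<in>Basis. (\<xi> x \<bullet> b) *\<^sub>R frechet_derivative f (at x) b)"
    by (intro smooth_on_sum smooth_on_scaleR smooth_on_inner smooth_on_const smooth_on_derivative
        assms)
  show "(\<Sum>b\<in>Basis. (\<xi> x \<bullet> b) *\<^sub>R frechet_derivative f (at x) b)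
      = frechet_derivative f (at x) (\<xi> x)" if "x \<in> S" for x
  proof -
    have "linear (frechet_derivative f (at x))"
      using smooth_on_differentiable[OF assms(2) that] by (rule linear_frechet_derivative)
    then have "frechet_derivative f (at x) (\<Sum>b\<in>Basis. (\<xi> x \<bullet> b) *\<^sub>R b)
        = (\<Sum>b\<in>Basis. (\<xi> x \<bullet> b) *\<^sub>R frechet_derivative f (at x) b)"
      by (simp add: linear_sum linear_scale)
    then show ?thesis by (simp add: euclidean_representation)
  qed
qed

text \<open>Schwarz's theorem: by the mean value theorem applied twice, the second difference of
  \<^term>\<open>f\<close> in the directions \<^term>\<open>v\<close> and \<^term>\<open>w\<close> is a value of either mixed derivative at a
  nearby point.\<close>

lemma second_difference:
  fixes f :: "'e::euclidean_space \<Rightarrow> real"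
  assumes S: "open S" and f: "smooth_on S f" and t: "t > 0"
    and box: "\<And>a b. 0 \<le> a \<Longrightarrow> a \<le> t \<Longrightarrow> 0 \<le> b \<Longrightarrow> b \<le> t \<Longrightarrow> x + a *\<^sub>R v + b *\<^sub>R w \<in> S"
  obtains a b where "0 \<le> a" "a \<le> t" "0 \<le> b" "b \<le> t"
    "f (x + t *\<^sub>R v + t *\<^sub>R w) - f (x + t *\<^sub>R v) - f (x + t *\<^sub>R w) + f x
      = t * t * frechet_derivative (\<lambda>y. frechet_derivative f (at y) v) (at (x + a *\<^sub>R v + b *\<^sub>R w)) w"
proof -
  let ?D = "\<lambda>y. frechet_derivative f (at y) v"
  have 1: "((\<lambda>s. f (x + s *\<^sub>R v + b *\<^sub>R w)) has_real_derivative ?D (x + s *\<^sub>R v + b *\<^sub>R w)) (at s)"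
    if "0 \<le> s" "s \<le> t" "0 \<le> b" "b \<le> t" for s b
  proof -
    have "((\<lambda>s. f (x + s *\<^sub>R v + b *\<^sub>R w)) has_derivative
        (\<lambda>h. frechet_derivative f (at (x + s *\<^sub>R v + b *\<^sub>R w)) (h *\<^sub>R v))) (at s)"
      by (rule has_derivative_compose[of "\<lambda>s. x + s *\<^sub>R v + b *\<^sub>R w"])
        (use smooth_on_has_derivative[OF f box[OF that]] in
          \<open>auto intro!: derivative_eq_intros\<close>)
    moreover have "linear (frechet_derivative f (at (x + s *\<^sub>R v + b *\<^sub>R w)))"
      using smooth_on_differentiable[OF f box[OF that]] by (rule linear_frechet_derivative)
    ultimately show ?thesis
      by (simp add: has_field_derivative_def linear_scale mult.commute[of _ "?D _"])
  qed
  have 2: "((\<lambda>s. ?D (x + a *\<^sub>R v + s *\<^sub>R w)) has_real_derivative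
      frechet_derivative ?D (at (x + a *\<^sub>R v + s *\<^sub>R w)) w) (at s)"
    if "0 \<le> a" "a \<le> t" "0 \<le> s" "s \<le> t" for s a
  proof -
    note D = smooth_on_derivative[OF f, of v]
    have "((\<lambda>s. ?D (x + a *\<^sub>R v + s *\<^sub>R w)) has_derivative
        (\<lambda>h. frechet_derivative ?D (at (x + a *\<^sub>R v + s *\<^sub>R w)) (h *\<^sub>R w))) (at s)"
      by (rule has_derivative_compose[of "\<lambda>s. x + a *\<^sub>R v + s *\<^sub>R w"])
        (use smooth_on_has_derivative[OF D box[OF that]] in
          \<open>auto intro!: derivative_eq_intros\<close>)
    moreover have "linear (frechet_derivative ?D (at (x + a *\<^sub>R v + s *\<^sub>R w)))"
      using smooth_on_differentiable[OF D box[OF that]] by (rule linear_frechet_derivative)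
    ultimately show ?thesis
      by (simp add: has_field_derivative_def linear_scale mult_commute_abs)
  qed
  obtain a where a: "0 < a" "a < t" and
    A: "(f (x + t *\<^sub>R v + t *\<^sub>R w) - f (x + t *\<^sub>R v + 0 *\<^sub>R w))
        - (f (x + 0 *\<^sub>R v + t *\<^sub>R w) - f (x + 0 *\<^sub>R v + 0 *\<^sub>R w))
      = (t - 0) * (?D (x + a *\<^sub>R v + t *\<^sub>R w) - ?D (x + a *\<^sub>R v + 0 *\<^sub>R w))"
    using MVT2[OF t, of "\<lambda>s. f (x + s *\<^sub>R v + t *\<^sub>R w) - f (x + s *\<^sub>R v + 0 *\<^sub>R w)"
        "\<lambda>s. ?D (x + s *\<^sub>R v + t *\<^sub>R w) - ?D (x + s *\<^sub>R v + 0 *\<^sub>R w)"]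
      DERIV_diff[OF 1[of _ t] 1[of _ 0]] t by auto
  obtain b where b: "0 < b" "b < t" and
    B: "?D (x + a *\<^sub>R v + t *\<^sub>R w) - ?D (x + a *\<^sub>R v + 0 *\<^sub>R w)
      = (t - 0) * frechet_derivative ?D (at (x + a *\<^sub>R v + b *\<^sub>R w)) w"
    using MVT2[OF t, of "\<lambda>s. ?D (x + a *\<^sub>R v + s *\<^sub>R w)"] 2[of a] a by force
  show ?thesis
    using A B a b by (intro that[of a b]) (auto simp: algebra_simps)
qed

lemma second_derivative_symmetric:
  fixes f :: "'e::euclidean_space \<Rightarrow> real"
  assumes S: "open S" and f: "smooth_on S f" and x: "x \<in> S"
  shows "frechet_derivative (\<lambda>y. frechet_derivative f (at y) v) (at x) w
    = frechet_derivative (\<lambda>y. frechet_derivative f (at y) w) (at x) v" (is "?P x = ?Q x")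
proof (rule ccontr)
  assume ne: "?P x \<noteq> ?Q x"
  \<comment> \<open>Half the gap: two values closer than this to \<open>?P x\<close> and
    \<open>?Q x\<close> respectively cannot coincide.\<close>
  define e where "e = \<bar>?P x - ?Q x\<bar> / 2"
  have e: "e > 0" using ne by (simp add: e_def)
  have cont: "isCont ?P x" "isCont ?Q x"
    using smooth_on_continuous_on[OF smooth_on_derivative[OF smooth_on_derivative[OF f]]] S x
    by (simp_all add: continuous_on_eq_continuous_at)
  obtain d where d: "d > 0" "ball x d \<subseteq> S"
    "\<And>y. y \<in> ball x d \<Longrightarrow> \<bar>?P y - ?P x\<bar> < e \<and> \<bar>?Q y - ?Q x\<bar> < e"
  proof -
    obtain d1 where "d1 > 0" "\<And>y. dist y x < d1 \<Longrightarrow> \<bar>?P y - ?P x\<bar> < e"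
      using cont(1) e unfolding continuous_at_eps_delta by (metis dist_real_def)
    moreover obtain d2 where "d2 > 0" "\<And>y. dist y x < d2 \<Longrightarrow> \<bar>?Q y - ?Q x\<bar> < e"
      using cont(2) e unfolding continuous_at_eps_delta by (metis dist_real_def)
    moreover obtain d3 where "d3 > 0" "ball x d3 \<subseteq> S"
      using S x open_contains_ball by blast
    ultimately show ?thesis
      by (intro that[of "min d1 (min d2 d3)"]) (auto simp: dist_commute)
  qed
  \<comment> \<open>Scaled so that the parallelogram at \<open>x\<close> spanned by
    \<open>t *\<^sub>R v\<close> and \<open>t *\<^sub>R w\<close> stays within d / 2 of
    \<open>x\<close>; the summand 1 keeps the denominator positive when both directions
    vanish.\<close>
  define t where "t = d / (2 * (norm v + norm w + 1))"
  have t: "t > 0" using d by (simp add: t_def add_nonneg_pos)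
  have box: "x + a *\<^sub>R v + b *\<^sub>R w \<in> ball x d" if "0 \<le> a" "a \<le> t" "0 \<le> b" "b \<le> t" for a b
  proof -
    have "norm (a *\<^sub>R v + b *\<^sub>R w) \<le> a * norm v + b * norm w"
      using norm_triangle_ineq[of "a *\<^sub>R v" "b *\<^sub>R w"] that by simp
    also have "\<dots> \<le> t * norm v + t * norm w"
      using that by (intro add_mono mult_right_mono) auto
    also have "\<dots> \<le> t * (norm v + norm w + 1)"
      using t by (simp add: algebra_simps)
    also have "\<dots> = d / 2"
    proof -
      have "norm v + norm w + 1 \<noteq> 0" using add_nonneg_pos[of "norm v + norm w" 1] by simp
      then show ?thesis unfolding t_def by (simp add: divide_simps)
    qed
    also have "\<dots> < d" using d by simp
    finally show ?thesis by (metis add.assoc add_diff_cancel_left' dist_commute dist_norm mem_ball)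
  qed
  have box': "x + a *\<^sub>R w + b *\<^sub>R v \<in> ball x d" if "0 \<le> a" "a \<le> t" "0 \<le> b" "b \<le> t" for a b
    using box[OF that(3,4,1,2)] by (simp add: add_ac)
  obtain a b where ab: "0 \<le> a" "a \<le> t" "0 \<le> b" "b \<le> t"
    "f (x + t *\<^sub>R v + t *\<^sub>R w) - f (x + t *\<^sub>R v) - f (x + t *\<^sub>R w) + f x
      = t * t * ?P (x + a *\<^sub>R v + b *\<^sub>R w)"
    using second_difference[OF S f t, of x v w] box d(2) by blast
  obtain a' b' where ab': "0 \<le> a'" "a' \<le> t" "0 \<le> b'" "b' \<le> t"
    "f (x + t *\<^sub>R w + t *\<^sub>R v) - f (x + t *\<^sub>R w) - f (x + t *\<^sub>R v) + f x
      = t * t * ?Q (x + a' *\<^sub>R w + b' *\<^sub>R v)"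
    using second_difference[OF S f t, of x w v] box' d(2) by blast
  \<comment> \<open>The second difference is symmetric in the two directions, so both mean value
    formulas evaluate the same number.\<close>
  have "t * t * ?P (x + a *\<^sub>R v + b *\<^sub>R w) = t * t * ?Q (x + a' *\<^sub>R w + b' *\<^sub>R v)"
  proof -
    have *: "x + t *\<^sub>R w + t *\<^sub>R v = x + t *\<^sub>R v + t *\<^sub>R w" by simp
    show ?thesis using ab(5) ab'(5)[unfolded *] by linarith
  qed
  then have "?P (x + a *\<^sub>R v + b *\<^sub>R w) = ?Q (x + a' *\<^sub>R w + b' *\<^sub>R v)"
    using t by simp
  then show False
    using d(3)[OF box[OF ab(1-4)]] d(3)[OF box'[OF ab'(1-4)]] unfolding e_def
    by (smt (verit) field_sum_of_halves)
qed

section \<open>Vector fields in local coordinates\<close>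

text \<open>\<open>topology\<close> inverts \<open>openin\<close> only on families that satisfy
  \<open>istopology\<close>, so closure under binary intersections and arbitrary unions has to come
  first.\<close>

lemma openin_manifold_topology:
  fixes M :: "('e::euclidean_space, 'a) atlas"
  shows "openin (manifold_topology M) U \<longleftrightarrow>
    U \<subseteq> carrier M \<and> (\<forall>(V, \<phi>)\<in>M. open (V \<inter> \<phi> -` U))" (is "_ \<longleftrightarrow> ?P U")
proof -
  have op: "open (V \<inter> \<phi> -` U)" if "?P U" "(V, \<phi>) \<in> M" for V \<phi> U
    using bspec[OF conjunct2[OF that(1)] that(2)] by simp
  have "istopology ?P"
    unfolding istopology_def
  proof (rule conjI; intro allI impI)
    fix S T assume ST: "?P S" "?P T"
    have "open (V \<inter> \<phi> -` (S \<inter> T))" if "(V, \<phi>) \<in> M" for V \<phi>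
    proof -
      have "open ((V \<inter> \<phi> -` S) \<inter> (V \<inter> \<phi> -` T))"
        by (intro open_Int op ST that)
      also have "(V \<inter> \<phi> -` S) \<inter> (V \<inter> \<phi> -` T) = V \<inter> \<phi> -` (S \<inter> T)" by blast
      finally show ?thesis .
    qed
    then show "?P (S \<inter> T)" using ST by blast
  next
    fix K assume K: "\<forall>U\<in>K. ?P U"
    have "open (V \<inter> \<phi> -` \<Union>K)" if "(V, \<phi>) \<in> M" for V \<phi>
    proof -
      have "open (\<Union>U\<in>K. V \<inter> \<phi> -` U)"
        using K that by (intro open_UN ballI op) blast+
      also have "(\<Union>U\<in>K. V \<inter> \<phi> -` U) = V \<inter> \<phi> -` \<Union>K" by blast
      finally show ?thesis .
    qed
    then show "?P (\<Union>K)" using K by blast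
  qed
  then show ?thesis
    by (simp add: manifold_topology_def topology_inverse')
qed

definition commutator ::
  "('e::euclidean_space \<Rightarrow> 'e) \<Rightarrow> ('e \<Rightarrow> 'e) \<Rightarrow> 'e \<Rightarrow> 'e" where
  "commutator \<xi> \<eta> z = frechet_derivative \<eta> (at z) (\<xi> z) - frechet_derivative \<xi> (at z) (\<eta> z)"

definition local_sections ::
  "'e::euclidean_space set \<Rightarrow> ('e \<Rightarrow> 'e set) \<Rightarrow> ('e \<Rightarrow> 'e) set" where
  "local_sections S \<Delta> = {\<xi>. smooth_on S \<xi> \<and> (\<forall>y\<in>S. \<xi> y \<in> \<Delta> y)}"

text \<open>Coordinate counterpart of \<open>bracket\<close>. Sections live on arbitrarily small
  neighbourhoods, as in the original; the bound \<open>S\<close> keeps them where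
  \<open>\<Delta>\<close> and \<open>\<Delta>'\<close> describe the given distributions.\<close>

definition commutator_span ::
  "'e::euclidean_space set \<Rightarrow> ('e \<Rightarrow> 'e set) \<Rightarrow> ('e \<Rightarrow> 'e set) \<Rightarrow> 'e \<Rightarrow> 'e set" where
  "commutator_span S \<Delta> \<Delta>' z = span {commutator \<xi> \<eta> z |N \<xi> \<eta>.
     open N \<and> z \<in> N \<and> N \<subseteq> S \<and> \<xi> \<in> local_sections N \<Delta> \<and> \<eta> \<in> local_sections N \<Delta>'}"

text \<open>Ranks on a manifold are dimensions inside a space of functionals; an injective linear
  map carries a basis to a basis and so lets them be computed in coordinates.\<close>

lemma dim_linear_image_inj:
  assumes "linear f" "inj f"
  shows "dim (f ` S) = dim S"
proof -
  obtain B where B: "B \<subseteq> S" "independent B" "S \<subseteq> span B" "card B = dim S"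
    by (rule basis_exists)
  have "card (f ` B) = dim (f ` S)"
  proof (rule basis_card_eq_dim)
    show "f ` S \<subseteq> span (f ` B)"
      using B(3) by (auto simp: linear_span_image[OF assms(1)])
    show "independent (f ` B)"
      using linear_independent_injective_image[OF assms(1) B(2)] assms(2)
      by (auto intro: inj_on_subset)
  qed (use B in auto)
  then show ?thesis
    using B(4) card_image[OF inj_on_subset[OF assms(2) subset_UNIV], of B] by simp
qed

section \<open>Coordinate changes, smoothness and tangent vectors in an arbitrary coordinate
  patch\<close>

lemma smooth_transitionE:
  assumes "smooth_transition (V, \<phi>) (V', \<phi>')" "inj_on \<phi>' V'"
    and "x \<in> V" "x' \<in> V'" "\<phi> x = \<phi>' x'"
  obtains S T where "open S" "x \<in> S" "S \<subseteq> V" "smooth_on S T" "T x = x'"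
    "\<And>y. y \<in> S \<Longrightarrow> T y \<in> V'" "\<And>y. y \<in> S \<Longrightarrow> \<phi>' (T y) = \<phi> y"
proof (rule that[of "V \<inter> \<phi> -` (\<phi>' ` V')" "inv_into V' \<phi>' \<circ> \<phi>"])
  show "(inv_into V' \<phi>' \<circ> \<phi>) x = x'"
    using assms by (simp add: inv_into_f_f)
qed (use assms in \<open>auto simp: smooth_transition_def inv_into_into f_inv_into_f\<close>)

text \<open>The chain rule for a function read through \<open>T\<close>. Differentiability of
  \<open>f \<circ> \<psi>\<close> is a premise because its source depends on which of the two maps
  is the atlas chart.\<close>

lemma push_transition:
  assumes "open S" "x \<in> S" "smooth_on S T" "\<And>y. y \<in> S \<Longrightarrow> \<psi> (T y) = \<phi> y"
    and "\<And>f. smooth_at M f (\<phi> x) \<Longrightarrow> (f \<circ> \<psi>) differentiable at (T x)"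
  shows "push M \<phi> x v = push M \<psi> (T x) (frechet_derivative T (at x) v)"
proof
  fix f
  show "push M \<phi> x v f = push M \<psi> (T x) (frechet_derivative T (at x) v) f"
  proof (cases "smooth_at M f (\<phi> x)")
    case True
    have "frechet_derivative (f \<circ> \<phi>) (at x) = frechet_derivative ((f \<circ> \<psi>) \<circ> T) (at x)"
      using assms(1,2,4) by (intro frechet_derivative_cong) auto
    also have "\<dots> = frechet_derivative (f \<circ> \<psi>) (at (T x)) \<circ> frechet_derivative T (at x)"
      by (intro frechet_derivative_compose smooth_on_differentiable[OF assms(3,2)] assms(5) True)
    finally show ?thesis
      using assms(2,4) True by (simp add: push_def)
  next
    case False
    then show ?thesis
      using assms(2,4) by (simp add: push_def)
  qed
qed

text \<open>Serves both \<open>M\<close> and the atlas of its circle bundle: injective atlas charts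
  together with one member of the maximal atlas are what the dictionary between functionals and
  coordinate vectors rests on.\<close>

locale coordinate_patch =
  fixes M :: "('e::euclidean_space, 'a) atlas" and V :: "'e set" and \<phi> :: "'e \<Rightarrow> 'a"
  assumes inj_on_chart: "(W, \<psi>) \<in> M \<Longrightarrow> inj_on \<psi> W"
    and coordinates: "local_coordinates M V \<phi>"
begin

lemma open_domain: "open V" and inj_on_domain: "inj_on \<phi> V"
  and image_subset_carrier: "\<phi> ` V \<subseteq> carrier M"
  using coordinates by (auto simp: local_coordinates_def)

lemma chart_at:
  assumes "x \<in> V"
  obtains W \<psi> y where "(W, \<psi>) \<in> M" "y \<in> W" "\<psi> y = \<phi> x"
proof -
  have "\<phi> x \<in> carrier M" using image_subset_carrier assms by blast
  then obtain c where "c \<in> M" "\<phi> x \<in> (case c of (W, \<psi>) \<Rightarrow> \<psi> ` W)"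
    unfolding carrier_def by blast
  then show ?thesis by (cases c) (auto intro: that)
qed

lemma to_chart:
  assumes "(W, \<psi>) \<in> M" "x \<in> V" "y \<in> W" "\<psi> y = \<phi> x"
  obtains S T where "open S" "x \<in> S" "S \<subseteq> V" "smooth_on S T" "T x = y"
    "\<And>y. y \<in> S \<Longrightarrow> T y \<in> W" "\<And>y. y \<in> S \<Longrightarrow> \<psi> (T y) = \<phi> y"
proof -
  have tr: "smooth_transition (V, \<phi>) (W, \<psi>)"
    using coordinates assms(1) by (auto simp: local_coordinates_def)
  have inj: "inj_on \<psi> W" by (rule inj_on_chart[OF assms(1)])
  show ?thesis
    by (rule smooth_transitionE[OF tr inj assms(2,3) assms(4)[symmetric]]) (rule that)
qed

lemma from_chart:
  assumes "(W, \<psi>) \<in> M" "x \<in> V" "y \<in> W" "\<psi> y = \<phi> x"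
  obtains S T where "open S" "y \<in> S" "S \<subseteq> W" "smooth_on S T" "T y = x"
    "\<And>y. y \<in> S \<Longrightarrow> T y \<in> V" "\<And>y. y \<in> S \<Longrightarrow> \<phi> (T y) = \<psi> y"
proof -
  have tr: "smooth_transition (W, \<psi>) (V, \<phi>)"
    using coordinates assms(1) by (auto simp: local_coordinates_def)
  show ?thesis
    by (rule smooth_transitionE[OF tr inj_on_domain assms(3,2,4)]) (rule that)
qed

text \<open>\<open>smooth_at\<close> is phrased with atlas charts. Composing with the smooth
  coordinate changes, in both directions, carries the property to every member of the maximal
  atlas.\<close>

lemma smooth_at_iff:
  assumes x: "x \<in> V"
  shows "smooth_at M f (\<phi> x) \<longleftrightarrow> (\<exists>N. open N \<and> x \<in> N \<and> N \<subseteq> V \<and> smooth_on N (f \<circ> \<phi>))"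
    (is "_ \<longleftrightarrow> ?R")
proof
  assume f: "smooth_at M f (\<phi> x)"
  obtain W \<psi> y where c: "(W, \<psi>) \<in> M" "y \<in> W" "\<psi> y = \<phi> x" using chart_at[OF x] .
  then obtain N where N: "open N" "y \<in> N" "N \<subseteq> W" "smooth_on N (f \<circ> \<psi>)"
    using f unfolding smooth_at_def by fast
  obtain S T where T: "open S" "x \<in> S" "S \<subseteq> V" "smooth_on S T" "T x = y"
    "\<And>y. y \<in> S \<Longrightarrow> T y \<in> W" "\<And>y. y \<in> S \<Longrightarrow> \<psi> (T y) = \<phi> y"
    using to_chart[OF c(1) x c(2,3)] by blast
  have op: "open (S \<inter> T -` N)"
    by (rule open_smooth_vimage[OF T(1,4) N(1)])
  have "smooth_on (S \<inter> T -` N) (\<lambda>z. (f \<circ> \<psi>) (T z))"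
    by (rule smooth_on_compose[OF op N(1) _ smooth_on_subset[OF T(4)] N(4)]) auto
  then have "smooth_on (S \<inter> T -` N) (f \<circ> \<phi>)"
    by (rule smooth_on_cong[OF op, rotated]) (simp add: T)
  then show ?R
    using op T N by blast
next
  assume ?R
  then obtain N where N: "open N" "x \<in> N" "N \<subseteq> V" "smooth_on N (f \<circ> \<phi>)" by blast
  show "smooth_at M f (\<phi> x)"
    unfolding smooth_at_def
  proof (clarify)
    fix W \<psi> y assume c: "(W, \<psi>) \<in> M" "y \<in> W" "\<psi> y = \<phi> x"
    obtain S T where T: "open S" "y \<in> S" "S \<subseteq> W" "smooth_on S T" "T y = x"
      "\<And>y. y \<in> S \<Longrightarrow> T y \<in> V" "\<And>y. y \<in> S \<Longrightarrow> \<phi> (T y) = \<psi> y"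
      using from_chart[OF c(1) x c(2,3)] by blast
    have op: "open (S \<inter> T -` N)"
      by (rule open_smooth_vimage[OF T(1,4) N(1)])
    have "smooth_on (S \<inter> T -` N) (\<lambda>z. (f \<circ> \<phi>) (T z))"
      by (rule smooth_on_compose[OF op N(1) _ smooth_on_subset[OF T(4)] N(4)]) auto
    then have "smooth_on (S \<inter> T -` N) (f \<circ> \<psi>)"
      by (rule smooth_on_cong[OF op, rotated]) (simp add: T)
    then show "\<exists>N. open N \<and> y \<in> N \<and> N \<subseteq> W \<and> smooth_on N (f \<circ> \<psi>)"
      using op T N by blast
  qed
qed

lemma smooth_at_nhds:
  assumes "x \<in> V" "smooth_at M f (\<phi> x)"
  obtains N where "open N" "x \<in> N" "N \<subseteq> V" "smooth_on N (f \<circ> \<phi>)"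
    "\<And>y. y \<in> N \<Longrightarrow> smooth_at M f (\<phi> y)"
  using assms smooth_at_iff by (metis subsetD)

lemma smooth_at_differentiable:
  assumes "x \<in> V" "smooth_at M f (\<phi> x)"
  shows "(f \<circ> \<phi>) differentiable at x"
  using smooth_at_nhds[OF assms] smooth_on_differentiable by metis

lemma linear_push:
  assumes "x \<in> V"
  shows "linear (push M \<phi> x)"
  using linear_frechet_derivative[OF smooth_at_differentiable[OF assms]]
  by (intro linearI)
    (auto simp: push_def fun_eq_iff scaleR_fun_def linear_add linear_scale)

text \<open>A vector seen in an atlas chart and one seen in the given coordinates are matched by the
  derivative of the coordinate change, in both directions.\<close>

lemma tangent_eq:
  assumes x: "x \<in> V"
  shows "tangent M (\<phi> x) = range (push M \<phi> x)"
proof (intro equalityI subsetI)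
  fix X assume "X \<in> tangent M (\<phi> x)"
  then obtain W \<psi> y v where c: "(W, \<psi>) \<in> M" "y \<in> W" "\<psi> y = \<phi> x" and X: "X = push M \<psi> y v"
    by (auto simp: tangent_def)
  obtain S T where T: "open S" "y \<in> S" "S \<subseteq> W" "smooth_on S T" "T y = x"
    "\<And>y. y \<in> S \<Longrightarrow> T y \<in> V" "\<And>y. y \<in> S \<Longrightarrow> \<phi> (T y) = \<psi> y"
    using from_chart[OF c(1) x c(2,3)] by blast
  have "push M \<psi> y v = push M \<phi> (T y) (frechet_derivative T (at y) v)"
    by (rule push_transition[where \<phi>=\<psi> and \<psi>=\<phi>, OF T(1,2,4,7)]) (use smooth_at_differentiable x c T in auto)
  then show "X \<in> range (push M \<phi> x)" using X T by simp
next
  fix X assume "X \<in> range (push M \<phi> x)"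
  then obtain v where X: "X = push M \<phi> x v" by blast
  obtain W \<psi> y where c: "(W, \<psi>) \<in> M" "y \<in> W" "\<psi> y = \<phi> x" using chart_at[OF x] .
  obtain S T where T: "open S" "x \<in> S" "S \<subseteq> V" "smooth_on S T" "T x = y"
    "\<And>y. y \<in> S \<Longrightarrow> T y \<in> W" "\<And>y. y \<in> S \<Longrightarrow> \<psi> (T y) = \<phi> y"
    using to_chart[OF c(1) x c(2,3)] by blast
  have "push M \<phi> x v = push M \<psi> (T x) (frechet_derivative T (at x) v)"
  proof (rule push_transition[where \<phi>=\<phi> and \<psi>=\<psi>, OF T(1,2,4,7)])
    fix f assume "smooth_at M f (\<phi> x)"
    then obtain N where "open N" "y \<in> N" "N \<subseteq> W" "smooth_on N (f \<circ> \<psi>)"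
      using c unfolding smooth_at_def by fast
    then show "(f \<circ> \<psi>) differentiable at (T x)"
      using T(5) smooth_on_differentiable by blast
  qed
  then show "X \<in> tangent M (\<phi> x)"
    using X c T(5) unfolding tangent_def by auto
qed

lemma subspace_tangent: "x \<in> V \<Longrightarrow> subspace (tangent M (\<phi> x))"
  by (simp add: tangent_eq linear_subspace_image linear_push)

lemma push_in_tangent: "x \<in> V \<Longrightarrow> push M \<phi> x v \<in> tangent M (\<phi> x)"
  by (simp add: tangent_eq)

text \<open>Test functions that recover the components of a tangent vector; they give injectivity of
  \<open>push\<close> and smooth components of vector fields. Off the patch the values come from
  \<open>inv_into\<close> and are arbitrary, but only germs at points of the patch matter.\<close>

definition coord :: "'e \<Rightarrow> 'a \<Rightarrow> real" where
  "coord b q = inv_into V \<phi> q \<bullet> b"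

lemma coord_comp: "x \<in> V \<Longrightarrow> (coord b \<circ> \<phi>) x = x \<bullet> b"
  by (simp add: coord_def inj_on_domain)

lemma smooth_on_coord: "smooth_on V (coord b \<circ> \<phi>)"
  by (rule smooth_on_cong[OF open_domain coord_comp[symmetric]])
    (auto intro!: smooth_on_inner open_domain smooth_on_id smooth_on_const)

lemma smooth_at_coord: "x \<in> V \<Longrightarrow> smooth_at M (coord b) (\<phi> x)"
  using smooth_on_coord open_domain by (auto simp: smooth_at_iff)

lemma push_coord:
  assumes "x \<in> V"
  shows "push M \<phi> x v (coord b) = v \<bullet> b"
proof -
  have "frechet_derivative (coord b \<circ> \<phi>) (at x) = frechet_derivative (\<lambda>y. y \<bullet> b) (at x)"
    by (rule frechet_derivative_cong[OF open_domain assms coord_comp])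
  also have "\<dots> = (\<lambda>v. v \<bullet> b)"
    by (rule frechet_derivative_at[symmetric]) (auto intro!: derivative_eq_intros)
  finally show ?thesis
    using smooth_at_coord[OF assms] by (simp add: push_def)
qed

lemma inj_push:
  assumes "x \<in> V"
  shows "inj (push M \<phi> x)"
proof (rule injI)
  fix v w assume eq: "push M \<phi> x v = push M \<phi> x w"
  show "v = w"
    by (rule euclidean_eqI) (simp add: eq push_coord[OF assms, symmetric])
qed

lemma openin_image:
  assumes "open N" "N \<subseteq> V"
  shows "openin (manifold_topology M) (\<phi> ` N)"
  unfolding openin_manifold_topology
proof (intro conjI ballI, goal_cases)
  case 1
  then show ?case using image_subset_carrier assms by blast
next
  case (2 c)
  have "open (W \<inter> \<psi> -` (\<phi> ` N))" if c: "(W, \<psi>) \<in> M" for W \<psi>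
    unfolding open_subopen[of "W \<inter> \<psi> -` (\<phi> ` N)"]
  proof
    fix y assume "y \<in> W \<inter> \<psi> -` (\<phi> ` N)"
    then obtain x where x: "y \<in> W" "x \<in> N" "\<psi> y = \<phi> x" "x \<in> V" using assms by auto
    obtain S T where T: "open S" "y \<in> S" "S \<subseteq> W" "smooth_on S T" "T y = x"
      "\<And>y. y \<in> S \<Longrightarrow> T y \<in> V" "\<And>y. y \<in> S \<Longrightarrow> \<phi> (T y) = \<psi> y"
      using from_chart[OF c x(4,1,3)] by blast
    have op: "open (S \<inter> T -` N)"
      by (rule open_smooth_vimage[OF T(1,4) assms(1)])
    have "\<psi> z \<in> \<phi> ` N" if "z \<in> S \<inter> T -` N" for z
      using that T(7)[of z, symmetric] by simp
    then show "\<exists>A. open A \<and> y \<in> A \<and> A \<subseteq> W \<inter> \<psi> -` (\<phi> ` N)"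
      by (intro exI[of _ "S \<inter> T -` N"]) (use op T(2,3,5) x(2) in auto)
  qed
  then show ?case using 2 by (cases c) auto
qed

lemma open_vimage:
  assumes "openin (manifold_topology M) N"
  shows "open (V \<inter> \<phi> -` N)"
  unfolding open_subopen[of "V \<inter> \<phi> -` N"]
proof
  fix x assume x: "x \<in> V \<inter> \<phi> -` N"
  obtain W \<psi> y where c: "(W, \<psi>) \<in> M" "y \<in> W" "\<psi> y = \<phi> x" using chart_at x by blast
  obtain S T where T: "open S" "x \<in> S" "S \<subseteq> V" "smooth_on S T" "T x = y"
    "\<And>y. y \<in> S \<Longrightarrow> T y \<in> W" "\<And>y. y \<in> S \<Longrightarrow> \<psi> (T y) = \<phi> y"
    using to_chart[OF c(1) _ c(2,3)] x by blast
  have "open (W \<inter> \<psi> -` N)" using assms c(1) by (auto simp: openin_manifold_topology)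
  then have op: "open (S \<inter> T -` (W \<inter> \<psi> -` N))"
    by (rule open_smooth_vimage[OF T(1,4)])
  show "\<exists>A. open A \<and> x \<in> A \<and> A \<subseteq> V \<inter> \<phi> -` N"
    by (rule exI[of _ "S \<inter> T -` (W \<inter> \<psi> -` N)"]) (use op T x c in auto)
qed

section \<open>Vector fields, Lie brackets and distributions in coordinates\<close>

lemma smooth_on_field:
  assumes "vector_field_on M U X" "S \<subseteq> V" "\<phi> ` S \<subseteq> U"
    and "\<And>x. x \<in> S \<Longrightarrow> smooth_at M f (\<phi> x)"
  shows "smooth_on S (\<lambda>x. X (\<phi> x) f)"
proof (rule smooth_on_local)
  fix x assume x: "x \<in> S"
  then have "smooth_at M (\<lambda>q. X q f) (\<phi> x)"
    using assms by (auto simp: vector_field_on_def)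
  then show "\<exists>N. open N \<and> x \<in> N \<and> smooth_on N (\<lambda>x. X (\<phi> x) f)"
    using smooth_at_iff[of x "\<lambda>q. X q f"] x assms(2) by (auto simp: comp_def)
qed

text \<open>The components are obtained by applying \<open>X\<close> to the coordinate functions;
  they are smooth because a vector field sends smooth functions to smooth functions.\<close>

lemma fieldE:
  assumes X: "vector_field_on M U X" and S: "S \<subseteq> V" "\<phi> ` S \<subseteq> U" "open S"
  obtains \<xi> where "smooth_on S \<xi>" "\<And>x. x \<in> S \<Longrightarrow> X (\<phi> x) = push M \<phi> x (\<xi> x)"
proof (rule that[of "\<lambda>x. \<Sum>b\<in>Basis. X (\<phi> x) (coord b) *\<^sub>R b"])
  show "smooth_on S (\<lambda>x. \<Sum>b\<in>Basis. X (\<phi> x) (coord b) *\<^sub>R b)"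
    using S smooth_at_coord
    by (intro smooth_on_sum smooth_on_scaleR smooth_on_const smooth_on_field[OF X]) auto
  fix x assume x: "x \<in> S"
  then have "X (\<phi> x) \<in> tangent M (\<phi> x)"
    using X S by (auto simp: vector_field_on_def)
  then obtain v where v: "X (\<phi> x) = push M \<phi> x v"
    using tangent_eq x S by blast
  have "(\<Sum>b\<in>Basis. X (\<phi> x) (coord b) *\<^sub>R b) = v"
    using x S by (simp add: v push_coord subset_iff euclidean_representation)
  then show "X (\<phi> x) = push M \<phi> x (\<Sum>b\<in>Basis. X (\<phi> x) (coord b) *\<^sub>R b)"
    using v by simp
qed

lemma field_action:
  assumes S: "S \<subseteq> V" "open S" and \<xi>: "smooth_on S \<xi>"
    and X: "\<And>x. x \<in> S \<Longrightarrow> X (\<phi> x) = push M \<phi> x (\<xi> x)"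
    and x: "x \<in> S" and f: "smooth_at M f (\<phi> x)"
  obtains N where "open N" "x \<in> N" "N \<subseteq> S" "smooth_on N (f \<circ> \<phi>)"
    "\<And>y. y \<in> N \<Longrightarrow> X (\<phi> y) f = frechet_derivative (f \<circ> \<phi>) (at y) (\<xi> y)"
    "smooth_on N (\<lambda>y. X (\<phi> y) f)" "smooth_at M (\<lambda>q. X q f) (\<phi> x)"
proof -
  have xV: "x \<in> V" using x S by blast
  obtain N0 where N: "open N0" "x \<in> N0" "N0 \<subseteq> V" "smooth_on N0 (f \<circ> \<phi>)"
    "\<And>y. y \<in> N0 \<Longrightarrow> smooth_at M f (\<phi> y)"
    using smooth_at_nhds[OF xV f] by blast
  let ?N = "N0 \<inter> S"
  have op: "open ?N" using N S by blast
  have eq: "X (\<phi> y) f = frechet_derivative (f \<circ> \<phi>) (at y) (\<xi> y)" if "y \<in> ?N" for y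
    using that N X by (simp add: push_def)
  have fN: "smooth_on ?N (f \<circ> \<phi>)" using N smooth_on_subset by blast
  have "smooth_on ?N (\<lambda>y. frechet_derivative (f \<circ> \<phi>) (at y) (\<xi> y))"
    using smooth_on_derivative_along[OF op fN] smooth_on_subset[OF \<xi>] by blast
  then have sm: "smooth_on ?N (\<lambda>y. X (\<phi> y) f)"
    by (rule smooth_on_cong[OF op, rotated]) (simp add: eq)
  then have "smooth_at M (\<lambda>q. X q f) (\<phi> x)"
    unfolding smooth_at_iff[OF xV] using op N x by (intro exI[of _ ?N]) (auto simp: comp_def)
  then show ?thesis
    using that[of ?N] op N x fN eq sm by blast
qed

lemma fieldI:
  assumes S: "S \<subseteq> V" "open S" and \<xi>: "smooth_on S \<xi>"
    and X: "\<And>x. x \<in> S \<Longrightarrow> X (\<phi> x) = push M \<phi> x (\<xi> x)"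
  shows "vector_field_on M (\<phi> ` S) X"
  unfolding vector_field_on_def
proof (intro ballI conjI allI impI)
  fix p assume "p \<in> \<phi> ` S"
  then obtain x where x: "x \<in> S" "p = \<phi> x" by blast
  show "X p \<in> tangent M p"
    using x S X push_in_tangent by auto
  show "smooth_at M (\<lambda>q. X q f) p" if "smooth_at M f p" for f
    using field_action[OF S \<xi> X x(1)] that x(2) by metis
qed

text \<open>Applying two fields in succession to a function yields a first-order term, along the
  derivative of the second field, and the Hessian evaluated on both fields. The Hessian terms cancel
  in the difference by Schwarz's theorem.\<close>

lemma lie_bracket_eq:
  assumes S: "S \<subseteq> V" "open S" and \<xi>: "smooth_on S \<xi>" and \<eta>: "smooth_on S \<eta>"
    and X: "\<And>x. x \<in> S \<Longrightarrow> X (\<phi> x) = push M \<phi> x (\<xi> x)"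
    and Y: "\<And>x. x \<in> S \<Longrightarrow> Y (\<phi> x) = push M \<phi> x (\<eta> x)"
    and x: "x \<in> S"
  shows "lie_bracket M X Y (\<phi> x) = push M \<phi> x (commutator \<xi> \<eta> x)"
proof
  fix f
  show "lie_bracket M X Y (\<phi> x) f = push M \<phi> x (commutator \<xi> \<eta> x) f"
  proof (cases "smooth_at M f (\<phi> x)")
    case f: True
    define h where "h = f \<circ> \<phi>"
    have act: "A (\<phi> x) (\<lambda>q. B q f) = frechet_derivative h (at x) (frechet_derivative \<beta> (at x) (\<alpha> x))
        + frechet_derivative (\<lambda>y. frechet_derivative h (at y) (\<beta> x)) (at x) (\<alpha> x)"
      if \<alpha>: "smooth_on S \<alpha>" "\<And>x. x \<in> S \<Longrightarrow> A (\<phi> x) = push M \<phi> x (\<alpha> x)"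
        and \<beta>: "smooth_on S \<beta>" "\<And>x. x \<in> S \<Longrightarrow> B (\<phi> x) = push M \<phi> x (\<beta> x)" for A B \<alpha> \<beta>
    proof -
      obtain N where N: "open N" "x \<in> N" "N \<subseteq> S" "smooth_on N h"
        "\<And>y. y \<in> N \<Longrightarrow> B (\<phi> y) f = frechet_derivative h (at y) (\<beta> y)"
        "smooth_at M (\<lambda>q. B q f) (\<phi> x)"
        using field_action[OF S \<beta> x f] unfolding h_def by metis
      have lin: "linear (frechet_derivative h (at y))" if "y \<in> N" for y
        using smooth_on_differentiable[OF N(4) that] by (rule linear_frechet_derivative)
      have \<beta>N: "smooth_on N \<beta>" using smooth_on_subset[OF \<beta>(1) N(3)] .
      \<comment> \<open>The derivative of \<open>h\<close> along \<open>\<beta>\<close> depends on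
        the point twice. In a basis it is a sum of products, and the product rule separates the two
        dependences.\<close>
      have rep: "frechet_derivative h (at y) w = (\<Sum>b\<in>Basis. (w \<bullet> b) * frechet_derivative h (at y) b)"
        if "y \<in> N" for y w
      proof -
        have "frechet_derivative h (at y) (\<Sum>b\<in>Basis. (w \<bullet> b) *\<^sub>R b)
            = (\<Sum>b\<in>Basis. (w \<bullet> b) * frechet_derivative h (at y) b)"
          by (simp add: linear_sum[OF lin[OF that]] linear_scale[OF lin[OF that]])
        then show ?thesis by (simp add: euclidean_representation)
      qed
      define D2 where "D2 b = frechet_derivative (\<lambda>y. frechet_derivative h (at y) b) (at x)" for b
      have D2: "((\<lambda>y. frechet_derivative h (at y) b) has_derivative D2 b) (at x)" for b
        unfolding D2_def
        by (rule smooth_on_has_derivative[OF smooth_on_derivative[OF N(4)] N(2)])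
      have \<beta>': "(\<beta> has_derivative frechet_derivative \<beta> (at x)) (at x)"
        by (rule smooth_on_has_derivative[OF \<beta>N N(2)])
      have c: "((\<lambda>y. \<Sum>b\<in>Basis. (w \<bullet> b) * frechet_derivative h (at y) b) has_derivative
          (\<lambda>v. \<Sum>b\<in>Basis. (w \<bullet> b) * D2 b v)) (at x)" for w
        by (auto intro!: derivative_eq_intros D2)
      have rep': "frechet_derivative (\<lambda>y. frechet_derivative h (at y) w) (at x)
          = frechet_derivative (\<lambda>y. \<Sum>b\<in>Basis. (w \<bullet> b) * frechet_derivative h (at y) b) (at x)" for w
        by (rule frechet_derivative_cong[OF N(1,2) rep])
      \<comment> \<open>The second derivative is linear in its frozen direction, so the sum over
        \<open>b\<close> collapses to \<open>D2 (\<beta> x)\<close>.\<close>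
      have c': "D2 w v = (\<Sum>b\<in>Basis. (w \<bullet> b) * D2 b v)" for w v
        using rep'[of w] frechet_derivative_eqI[OF c, of w v] by (simp add: D2_def)
      have d: "((\<lambda>y. \<Sum>b\<in>Basis. (\<beta> y \<bullet> b) * frechet_derivative h (at y) b) has_derivative
          (\<lambda>v. \<Sum>b\<in>Basis. (\<beta> x \<bullet> b) * D2 b v
             + (frechet_derivative \<beta> (at x) v \<bullet> b) * frechet_derivative h (at x) b)) (at x)"
        by (auto intro!: derivative_eq_intros D2 \<beta>')
      have "A (\<phi> x) (\<lambda>q. B q f) = frechet_derivative (\<lambda>y. B (\<phi> y) f) (at x) (\<alpha> x)"
        using \<alpha>(2)[OF x] N(6) by (simp add: push_def comp_def)
      also have "\<dots> = frechet_derivative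
          (\<lambda>y. \<Sum>b\<in>Basis. (\<beta> y \<bullet> b) * frechet_derivative h (at y) b) (at x) (\<alpha> x)"
      proof -
        have "frechet_derivative (\<lambda>y. B (\<phi> y) f) (at x) = frechet_derivative
            (\<lambda>y. \<Sum>b\<in>Basis. (\<beta> y \<bullet> b) * frechet_derivative h (at y) b) (at x)"
        proof (rule frechet_derivative_cong[OF N(1,2)])
          show "B (\<phi> y) f = (\<Sum>b\<in>Basis. (\<beta> y \<bullet> b) * frechet_derivative h (at y) b)"
            if "y \<in> N" for y
            by (simp only: N(5)[OF that]) (rule rep[OF that])
        qed
        then show ?thesis by simp
      qed
      also have "\<dots> = (\<Sum>b\<in>Basis. (\<beta> x \<bullet> b) * D2 b (\<alpha> x)
             + (frechet_derivative \<beta> (at x) (\<alpha> x) \<bullet> b) * frechet_derivative h (at x) b)"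
        by (rule frechet_derivative_eqI[OF d])
      also have "\<dots> = D2 (\<beta> x) (\<alpha> x)
          + frechet_derivative h (at x) (frechet_derivative \<beta> (at x) (\<alpha> x))"
        by (simp add: sum.distrib c'[of "\<beta> x"] rep[OF N(2), of "frechet_derivative \<beta> (at x) (\<alpha> x)"])
      finally show ?thesis by (simp add: D2_def)
    qed
    have "x \<in> V" using x S by blast
    then obtain N where N: "open N" "x \<in> N" "smooth_on N h"
      using smooth_at_nhds[OF _ f] unfolding h_def by metis
    have lin: "linear (frechet_derivative h (at x))"
      using smooth_on_differentiable[OF N(3,2)] by (rule linear_frechet_derivative)
    show ?thesis
      using f act[OF \<xi> X \<eta> Y] act[OF \<eta> Y \<xi> X] second_derivative_symmetric[OF N(1,3,2), of "\<xi> x" "\<eta> x"]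
      by (simp add: lie_bracket_def push_def commutator_def h_def[symmetric] linear_diff[OF lin])
  qed (simp add: lie_bracket_def push_def)
qed

text \<open>Local sections correspond in both directions: the components of a field lie in
  \<open>\<Delta>\<close> because \<open>push\<close> is injective, and a coordinate section becomes
  a field on an open image. Linearity then matches the spans.\<close>

lemma bracket_eq:
  assumes S: "S \<subseteq> V" "open S" and x: "x \<in> S"
    and D: "\<And>y. y \<in> S \<Longrightarrow> D (\<phi> y) = push M \<phi> y ` \<Delta> y"
    and D': "\<And>y. y \<in> S \<Longrightarrow> D' (\<phi> y) = push M \<phi> y ` \<Delta>' y"
  shows "bracket M D D' (\<phi> x) = push M \<phi> x ` commutator_span S \<Delta> \<Delta>' x"
proof -
  let ?C = "{commutator \<xi> \<eta> x |N \<xi> \<eta>.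
     open N \<and> x \<in> N \<and> N \<subseteq> S \<and> \<xi> \<in> local_sections N \<Delta> \<and> \<eta> \<in> local_sections N \<Delta>'}"
  let ?B = "{lie_bracket M X Y (\<phi> x) |N X Y.
     openin (manifold_topology M) N \<and> \<phi> x \<in> N \<and> section_on M N D X \<and> section_on M N D' Y}"
  have xV: "x \<in> V" using x S by blast
  have "?B = push M \<phi> x ` ?C"
  proof (intro equalityI subsetI)
    fix Z assume "Z \<in> ?B"
    then obtain N X Y where N: "openin (manifold_topology M) N" "\<phi> x \<in> N"
      and XY: "vector_field_on M N X" "vector_field_on M N Y"
      "\<And>q. q \<in> N \<Longrightarrow> X q \<in> D q" "\<And>q. q \<in> N \<Longrightarrow> Y q \<in> D' q"
      and Z: "Z = lie_bracket M X Y (\<phi> x)"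
      by (auto simp: section_on_def)
    \<comment> \<open>The given neighbourhood may leave the region where \<open>\<Delta>\<close> and
      \<open>\<Delta>'\<close> describe the distributions, so it is cut down to \<open>S\<close> in
      coordinates.\<close>
    define O' where "O' = S \<inter> (V \<inter> \<phi> -` N)"
    have O': "open O'" "x \<in> O'" "O' \<subseteq> S" "O' \<subseteq> V" "\<phi> ` O' \<subseteq> N"
      using open_vimage[OF N(1)] S x N(2) by (auto simp: O'_def)
    obtain \<xi> where \<xi>: "smooth_on O' \<xi>" "\<And>x. x \<in> O' \<Longrightarrow> X (\<phi> x) = push M \<phi> x (\<xi> x)"
      by (rule fieldE[OF XY(1) O'(4,5,1)]) (rule that)
    obtain \<eta> where \<eta>: "smooth_on O' \<eta>" "\<And>x. x \<in> O' \<Longrightarrow> Y (\<phi> x) = push M \<phi> x (\<eta> x)"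
      by (rule fieldE[OF XY(2) O'(4,5,1)]) (rule that)
    have "\<xi> y \<in> \<Delta> y \<and> \<eta> y \<in> \<Delta>' y" if y: "y \<in> O'" for y
    proof -
      have "\<phi> y \<in> N" "y \<in> S" "y \<in> V" using y O' by auto
      then have "push M \<phi> y (\<xi> y) \<in> push M \<phi> y ` \<Delta> y" "push M \<phi> y (\<eta> y) \<in> push M \<phi> y ` \<Delta>' y"
        using XY(3,4)[of "\<phi> y"] \<xi>(2)[OF y] \<eta>(2)[OF y] D D' by auto
      then show ?thesis using inj_push[OF \<open>y \<in> V\<close>] by (simp add: inj_image_mem_iff)
    qed
    then have sec: "\<xi> \<in> local_sections O' \<Delta>" "\<eta> \<in> local_sections O' \<Delta>'"
      using \<xi>(1) \<eta>(1) by (auto simp: local_sections_def)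
    have "commutator \<xi> \<eta> x \<in> ?C"
      using sec O'(1,2,3) by blast
    moreover have "Z = push M \<phi> x (commutator \<xi> \<eta> x)"
      unfolding Z by (rule lie_bracket_eq[OF O'(4,1) \<xi>(1) \<eta>(1) \<xi>(2) \<eta>(2) O'(2)])
    ultimately show "Z \<in> push M \<phi> x ` ?C" by blast
  next
    fix Z assume "Z \<in> push M \<phi> x ` ?C"
    then obtain N \<xi> \<eta> where N: "open N" "x \<in> N" "N \<subseteq> S"
      and \<xi>: "smooth_on N \<xi>" "\<And>y. y \<in> N \<Longrightarrow> \<xi> y \<in> \<Delta> y"
      and \<eta>: "smooth_on N \<eta>" "\<And>y. y \<in> N \<Longrightarrow> \<eta> y \<in> \<Delta>' y"
      and Z: "Z = push M \<phi> x (commutator \<xi> \<eta> x)"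
      by (auto simp: local_sections_def)
    have NV: "N \<subseteq> V" using N S by blast
    \<comment> \<open>A field has to be a function of the manifold point, so the coordinate section
      is read through \<open>inv_into\<close>; only values over \<open>N\<close> enter.\<close>
    define X where "X \<zeta> q = push M \<phi> (inv_into V \<phi> q) (\<zeta> (inv_into V \<phi> q))" for \<zeta> :: "'e \<Rightarrow> 'e" and q
    have X: "X \<zeta> (\<phi> y) = push M \<phi> y (\<zeta> y)" if "y \<in> N" for y \<zeta>
      using that NV by (auto simp: X_def inv_into_f_f[OF inj_on_domain] subset_iff)
    have "section_on M (\<phi> ` N) D (X \<xi>)" "section_on M (\<phi> ` N) D' (X \<eta>)"
      using fieldI[OF NV N(1) \<xi>(1), of "X \<xi>"] fieldI[OF NV N(1) \<eta>(1), of "X \<eta>"] X \<xi>(2) \<eta>(2) D D' N(3)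
      by (auto simp: section_on_def)
    moreover have "Z = lie_bracket M (X \<xi>) (X \<eta>) (\<phi> x)"
      unfolding Z by (rule lie_bracket_eq[OF NV N(1) \<xi>(1) \<eta>(1) X X N(2), symmetric])
    ultimately show "Z \<in> ?B"
      using openin_image[OF N(1) NV] N(2) by blast
  qed
  then show ?thesis
    unfolding bracket_def commutator_span_def by (simp add: linear_span_image linear_push xV)
qed

lemma distribution_onI:
  assumes S: "S \<subseteq> V" "open S"
    and \<xi>: "\<And>i. i < k \<Longrightarrow> smooth_on S (\<xi> i)"
    and D: "\<And>y. y \<in> S \<Longrightarrow> D (\<phi> y) = push M \<phi> y ` span ((\<lambda>i. \<xi> i y) ` {..<k})"
    and dim: "\<And>y. y \<in> S \<Longrightarrow> dim (span ((\<lambda>i. \<xi> i y) ` {..<k})) = k"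
  shows "distribution_on M (\<phi> ` S) k D"
proof -
  define X where "X i q = push M \<phi> (inv_into V \<phi> q) (\<xi> i (inv_into V \<phi> q))" for i q
  have X: "X i (\<phi> y) = push M \<phi> y (\<xi> i y)" if "y \<in> S" for y i
    using that S by (auto simp: X_def inv_into_f_f[OF inj_on_domain] subset_iff)
  have 1: "vector_field_on M (\<phi> ` S) (X i)" if "i < k" for i
    using fieldI[OF S \<xi>[OF that], of "X i"] X by blast
  have 2: "D (\<phi> y) = span ((\<lambda>i. X i (\<phi> y)) ` {..<k}) \<and> dim (D (\<phi> y)) = k" if y: "y \<in> S" for y
  proof -
    have yV: "y \<in> V" using y S by blast
    have "(\<lambda>i. X i (\<phi> y)) ` {..<k} = push M \<phi> y ` ((\<lambda>i. \<xi> i y) ` {..<k})"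
      using X[OF y] by (auto simp: image_image)
    then show ?thesis
      using D[OF y] dim[OF y] linear_push[OF yV] inj_push[OF yV]
      by (simp add: linear_span_image dim_linear_image_inj del: dim_span)
  qed
  show ?thesis
    unfolding distribution_on_def
    by (intro ballI exI[of _ "\<phi> ` S"] exI[of _ X] conjI allI impI openin_image[OF S(2,1)] 1)
      (use 2 in blast)+
qed

end

section \<open>The circle bundle of null lines\<close>

definition null_vector :: "(3 \<Rightarrow> 'v::real_vector) \<Rightarrow> real \<Rightarrow> 'v" where
  "null_vector e t = cos t *\<^sub>R e 1 + sin t *\<^sub>R e 2 + e 3"

section \<open>Linear algebra of an orthonormal frame in a three-dimensional Lorentzian
  space\<close>

lemma span_singleton_scaleR:
  fixes v :: "'v::real_vector"
  assumes "k \<noteq> 0"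
  shows "span {k *\<^sub>R v} = span {v}"
proof -
  have "v = (1 / k) *\<^sub>R (k *\<^sub>R v)" using assms by simp
  then have "v \<in> span {k *\<^sub>R v}" by (metis span_base span_scale singletonI)
  moreover have "k *\<^sub>R v \<in> span {v}" by (simp add: span_base span_scale)
  ultimately show ?thesis by (simp add: span_eq)
qed

text \<open>A tangent space as an abstract Lorentzian vector space. \<open>b\<close> is bilinear
  only on \<open>T\<close>, since the metric is unspecified on other functionals; \<open>P\<close>
  provides that \<open>T\<close> is three-dimensional.\<close>

locale lorentz_frame =
  fixes T :: "'v::real_vector set" and b :: "'v \<Rightarrow> 'v \<Rightarrow> real" and e :: "3 \<Rightarrow> 'v"
    and P :: "real^3 \<Rightarrow> 'v"
  assumes P: "linear P" "inj P" "T = range P"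
    and sym: "v \<in> T \<Longrightarrow> w \<in> T \<Longrightarrow> b v w = b w v"
    and lin: "v \<in> T \<Longrightarrow> v' \<in> T \<Longrightarrow> w \<in> T \<Longrightarrow> b (r *\<^sub>R v + s *\<^sub>R v') w = r * b v w + s * b v' w"
    and frame: "e i \<in> T"
    and orthonormal: "b (e i) (e j) = (if i \<noteq> j then 0 else if i = 3 then -1 else 1)"
begin

lemma subspace_T: "subspace T"
  by (simp add: P linear_subspace_image)

lemma T_closed: "v \<in> T \<Longrightarrow> w \<in> T \<Longrightarrow> v + w \<in> T" "v \<in> T \<Longrightarrow> r *\<^sub>R v \<in> T"
  using subspace_T by (auto simp: subspace_add subspace_scale)

lemma b_add: "v \<in> T \<Longrightarrow> v' \<in> T \<Longrightarrow> w \<in> T \<Longrightarrow> b (v + v') w = b v w + b v' w"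
  using lin[of v v' w 1 1] by simp

lemma b_scale: "v \<in> T \<Longrightarrow> w \<in> T \<Longrightarrow> b (r *\<^sub>R v) w = r * b v w"
  using lin[of v v w r 0] by simp

lemma b_combination:
  "w \<in> T \<Longrightarrow> b (x *\<^sub>R e 1 + y *\<^sub>R e 2 + z *\<^sub>R e 3) w = x * b (e 1) w + y * b (e 2) w + z * b (e 3) w"
  by (simp add: b_add b_scale T_closed frame)

lemma b_frame:
  "b (x *\<^sub>R e 1 + y *\<^sub>R e 2 + z *\<^sub>R e 3) (e 1) = x"
  "b (x *\<^sub>R e 1 + y *\<^sub>R e 2 + z *\<^sub>R e 3) (e 2) = y"
  "b (x *\<^sub>R e 1 + y *\<^sub>R e 2 + z *\<^sub>R e 3) (e 3) = - z"
  by (simp_all add: b_add b_scale T_closed frame orthonormal)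

text \<open>Orthonormality makes the frame independent, and three independent vectors span a
  three-dimensional space. The coefficient along \<open>e 3\<close> carries a minus sign because
  \<open>e 3\<close> has square -1.\<close>

lemma frame_expansion:
  assumes v: "v \<in> T"
  shows "v = b v (e 1) *\<^sub>R e 1 + b v (e 2) *\<^sub>R e 2 + (- b v (e 3)) *\<^sub>R e 3"
proof -
  define \<epsilon> where "\<epsilon> i = inv P (e i)" for i
  have \<epsilon>: "P (\<epsilon> i) = e i" for i
    using frame[of i] P(3) by (simp add: \<epsilon>_def f_inv_into_f)
  \<comment> \<open>Pulled back through \<open>P\<close>, the frame becomes an endomorphism of
    real^3, for which injectivity gives surjectivity.\<close>
  define L where "L x = x $ 1 *\<^sub>R \<epsilon> 1 + x $ 2 *\<^sub>R \<epsilon> 2 + x $ 3 *\<^sub>R \<epsilon> 3" for x :: "real^3"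
  have PL: "P (L x) = x $ 1 *\<^sub>R e 1 + x $ 2 *\<^sub>R e 2 + x $ 3 *\<^sub>R e 3" for x
    by (simp add: L_def linear_add[OF P(1)] linear_scale[OF P(1)] \<epsilon>)
  have "linear L"
    by (rule linearI) (simp_all add: L_def algebra_simps)
  moreover have "inj L"
  proof (rule injI)
    fix x y assume "L x = L y"
    then have "x $ 1 *\<^sub>R e 1 + x $ 2 *\<^sub>R e 2 + x $ 3 *\<^sub>R e 3
        = y $ 1 *\<^sub>R e 1 + y $ 2 *\<^sub>R e 2 + y $ 3 *\<^sub>R e 3" (is "?x = ?y")
      using PL by metis
    then have "b ?x (e i) = b ?y (e i)" for i by simp
    then show "x = y"
      unfolding vec_eq_iff forall_3 using b_frame by (metis minus_equation_iff)
  qed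
  ultimately have "surj L" by (rule linear_inj_imp_surj)
  obtain w where "v = P w" using v P(3) by blast
  moreover obtain x where "w = L x" using surjD[OF \<open>surj L\<close>] by blast
  ultimately have v: "v = x $ 1 *\<^sub>R e 1 + x $ 2 *\<^sub>R e 2 + x $ 3 *\<^sub>R e 3" by (simp add: PL)
  have "b v (e 1) = x $ 1" "b v (e 2) = x $ 2" "- b v (e 3) = x $ 3"
    unfolding v b_frame by simp_all
  then show ?thesis using v by simp
qed

lemma b_self:
  assumes v: "v \<in> T"
  shows "b v v = (b v (e 1))\<^sup>2 + (b v (e 2))\<^sup>2 - (b v (e 3))\<^sup>2"
proof -
  have "b v v = b (b v (e 1) *\<^sub>R e 1 + b v (e 2) *\<^sub>R e 2 + (- b v (e 3)) *\<^sub>R e 3) v"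
    by (rule arg_cong[where f="\<lambda>x. b x v", OF frame_expansion[OF v]])
  also have "\<dots> = b v (e 1) * b (e 1) v + b v (e 2) * b (e 2) v + (- b v (e 3)) * b (e 3) v"
    by (rule b_combination[OF v])
  finally show ?thesis
    by (simp only: sym[OF frame v]) (simp add: power2_eq_square)
qed

lemma null_vector_in: "null_vector e t \<in> T"
  by (simp add: null_vector_def T_closed frame)

lemma b_null_vector:
  "b (null_vector e t) (e 1) = cos t" "b (null_vector e t) (e 2) = sin t"
  "b (null_vector e t) (e 3) = -1"
  using b_frame[of "cos t" "sin t" 1] by (simp_all add: null_vector_def)

lemma null_vector_null: "b (null_vector e t) (null_vector e t) = 0"
  by (simp add: b_self null_vector_in b_null_vector)

lemma null_vector_nonzero: "null_vector e t \<noteq> 0"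
  using b_null_vector(3)[of t] b_scale[OF frame frame, of 0 3 3] by auto

context
  fixes v assumes v: "v \<in> T" "v \<noteq> 0" "b v v = 0"
begin

lemma b_timelike_nonzero: "b v (e 3) \<noteq> 0"
proof
  assume "b v (e 3) = 0"
  then have "b v (e 1) = 0 \<and> b v (e 2) = 0"
    using b_self[OF v(1)] v(3) by (simp add: sum_power2_eq_zero_iff)
  then have "v = 0"
    by (subst frame_expansion[OF v(1)]) (simp add: \<open>b v (e 3) = 0\<close>)
  then show False using v(2) by simp
qed

lemma null_direction: "(b v (e 1) / - b v (e 3))\<^sup>2 + (b v (e 2) / - b v (e 3))\<^sup>2 = 1"
  using b_self[OF v(1)] v(3) b_timelike_nonzero
  by (simp add: power_divide add_divide_distrib[symmetric])

text \<open>Rescaling \<open>v\<close> so that its \<open>e 3\<close>-coefficient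
  \<open>- b v (e 3)\<close> becomes 1 leaves a unit spatial part, whose coordinates are the cosine
  and sine of the angle.\<close>

lemma span_null_vector_eq_iff:
  "span {v} = span {null_vector e t} \<longleftrightarrow>
    cos t = b v (e 1) / - b v (e 3) \<and> sin t = b v (e 2) / - b v (e 3)"
proof
  assume "span {v} = span {null_vector e t}"
  then have "v \<in> span {null_vector e t}" by (metis span_base singletonI)
  then obtain k where k: "v = k *\<^sub>R null_vector e t" by (auto simp: span_singleton)
  then have "k \<noteq> 0" using v(2) by auto
  then show "cos t = b v (e 1) / - b v (e 3) \<and> sin t = b v (e 2) / - b v (e 3)"
    unfolding k by (simp add: b_scale null_vector_in frame b_null_vector)
next
  assume "cos t = b v (e 1) / - b v (e 3) \<and> sin t = b v (e 2) / - b v (e 3)"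
  then have "b v (e 1) = (- b v (e 3)) * cos t" "b v (e 2) = (- b v (e 3)) * sin t"
    using b_timelike_nonzero by (simp_all add: field_simps)
  then have "v = (- b v (e 3)) *\<^sub>R null_vector e t"
    by (subst frame_expansion[OF v(1)]) (simp add: null_vector_def algebra_simps)
  then show "span {v} = span {null_vector e t}"
    using span_singleton_scaleR[of "- b v (e 3)" "null_vector e t"] b_timelike_nonzero by simp
qed

end

end

section \<open>Angles on the unit circle, measured from an arbitrary starting angle\<close>

lemma cos_sin_shift_total:
  fixes c s :: real
  assumes "c\<^sup>2 + s\<^sup>2 = 1"
  obtains t where "a \<le> t" "t < a + 2 * pi" "cos t = c" "sin t = s"
proof -
  \<comment> \<open>Rotation by \<open>- a\<close> preserves the unit circle and moves the window
    starting at \<open>a\<close> to the one starting at 0; the angle found there is rotated back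
    below.\<close>
  have "(c * x + s * y)\<^sup>2 + (s * x - c * y)\<^sup>2 = (c\<^sup>2 + s\<^sup>2) * (x\<^sup>2 + y\<^sup>2)" for x y
    by (simp add: power2_eq_square algebra_simps)
  from this[of "cos a" "sin a"] have "(c * cos a + s * sin a)\<^sup>2 + (s * cos a - c * sin a)\<^sup>2 = 1"
    by (simp add: assms)
  then obtain u where u: "0 \<le> u" "u < 2 * pi" "c * cos a + s * sin a = cos u" "s * cos a - c * sin a = sin u"
    by (rule sincos_total_2pi)
  have rot: "(c * x + s * y) * x - (s * x - c * y) * y = c * (x\<^sup>2 + y\<^sup>2)"
    "(s * x - c * y) * x + (c * x + s * y) * y = s * (x\<^sup>2 + y\<^sup>2)" for x y
    by (simp_all add: power2_eq_square algebra_simps)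
  have "cos (u + a) = c" "sin (u + a) = s"
    unfolding cos_add sin_add u(3,4)[symmetric] rot by simp_all
  then show ?thesis
    using u(1,2) by (intro that[of "u + a"]) simp_all
qed

text \<open>The angle in \<^term>\<open>{a<..<a + 2 * pi}\<close> of a point on the unit circle, by the half-angle
  formula for the tangent; the denominator vanishes only at the excluded angle \<^term>\<open>a\<close>.\<close>

definition angle_from :: "real \<Rightarrow> real \<Rightarrow> real \<Rightarrow> real" where
  "angle_from a c s = a + pi + 2 * arctan ((c * sin a - s * cos a) / (1 - (c * cos a + s * sin a)))"

text \<open>By the double-angle formula 1 - cos (t - a) is twice the squared sine of an angle
  strictly between 0 and pi.\<close>

lemma angle_denominator:
  assumes t: "t \<in> {a<..<a + 2 * pi}"
  shows "1 - (cos t * cos a + sin t * sin a) \<noteq> 0"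
proof -
  have "2 * ((t - a) / 2) = t - a" by simp
  then have "1 - (cos t * cos a + sin t * sin a) = 1 - cos (2 * ((t - a) / 2))"
    by (simp only: cos_diff)
  also have "\<dots> = 2 * (sin ((t - a) / 2))\<^sup>2"
    by (simp only: cos_double_sin)
  finally have eq: "1 - (cos t * cos a + sin t * sin a) = 2 * (sin ((t - a) / 2))\<^sup>2" .
  have "sin ((t - a) / 2) > 0"
    using t by (intro sin_gt_zero) auto
  then show ?thesis unfolding eq by simp
qed

lemma angle_from_eq:
  assumes t: "t \<in> {a<..<a + 2 * pi}"
  shows "angle_from a (cos t) (sin t) = t"
proof -
  \<comment> \<open>The shift by \<open>pi\<close> centres the window: \<open>u\<close> lies
    strictly between -pi / 2 and pi / 2, where \<open>arctan\<close> inverts \<open>tan\<close>, and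
    the quotient becomes sin (2 u) / (cos (2 u) + 1) = tan u.\<close>
  define u where "u = (t - a - pi) / 2"
  have u: "- (pi / 2) < u" "u < pi / 2" "t = a + pi + 2 * u" using t by (auto simp: u_def field_simps)
  have "cos t * sin a - sin t * cos a = - sin (t - a)" by (simp add: sin_diff)
  also have "t - a = 2 * u + pi" using u by simp
  finally have s: "cos t * sin a - sin t * cos a = sin (2 * u)" by simp
  have "cos t * cos a + sin t * sin a = cos (t - a)" by (simp add: cos_diff)
  also have "t - a = 2 * u + pi" using u by simp
  finally have c: "1 - (cos t * cos a + sin t * sin a) = cos (2 * u) + 1" by simp
  show ?thesis
    unfolding angle_from_def s c tan_half[symmetric] using arctan_tan[OF u(1,2)] u(3) by simp
qed


section \<open>Compatibility of the charts of the circle bundle\<close>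

lemma coordinate_patchI:
  "smooth_manifold M \<Longrightarrow> local_coordinates M V \<phi> \<Longrightarrow> coordinate_patch M V \<phi>"
  by unfold_locales (auto simp: smooth_manifold_def)

text \<open>Members of the maximal atlas are compared with atlas charts by definition. They are
  compatible with each other because the coordinate functions of one patch are smooth on the
  manifold, hence smooth in the other patch.\<close>

lemma coordinate_change:
  assumes "coordinate_patch M V \<phi>" "coordinate_patch M V' \<phi>'"
  shows "open (V \<inter> \<phi> -` (\<phi>' ` V'))" "smooth_on (V \<inter> \<phi> -` (\<phi>' ` V')) (inv_into V' \<phi>' \<circ> \<phi>)"
proof -
  interpret A: coordinate_patch M V \<phi> by fact
  interpret B: coordinate_patch M V' \<phi>' by fact
  show op: "open (V \<inter> \<phi> -` (\<phi>' ` V'))"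
    by (rule A.open_vimage[OF B.openin_image[OF B.open_domain subset_refl]])
  have "smooth_on (V \<inter> \<phi> -` (\<phi>' ` V')) (B.coord b \<circ> \<phi>)" for b
  proof (rule smooth_on_local)
    fix x assume x: "x \<in> V \<inter> \<phi> -` (\<phi>' ` V')"
    then obtain x' where "x' \<in> V'" "\<phi> x = \<phi>' x'" by auto
    then have "smooth_at M (B.coord b) (\<phi> x)" using B.smooth_at_coord by simp
    then show "\<exists>N. open N \<and> x \<in> N \<and> smooth_on N (B.coord b \<circ> \<phi>)"
      using A.smooth_at_iff x by auto
  qed
  then have "smooth_on (V \<inter> \<phi> -` (\<phi>' ` V')) (\<lambda>x. \<Sum>b\<in>Basis. (B.coord b \<circ> \<phi>) x *\<^sub>R b)"
    by (intro smooth_on_sum smooth_on_scaleR smooth_on_const op)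
  then show "smooth_on (V \<inter> \<phi> -` (\<phi>' ` V')) (inv_into V' \<phi>' \<circ> \<phi>)"
    by (rule smooth_on_cong[OF op, rotated]) (simp add: B.coord_def euclidean_representation)
qed

definition null_chart ::
  "(real^3 \<Rightarrow> 'a) \<Rightarrow> (3 \<Rightarrow> 'a \<Rightarrow> 'a tvec) \<Rightarrow> (real^3) \<times> real \<Rightarrow> 'a \<times> 'a tvec set" where
  "null_chart \<phi> e = (\<lambda>(x, t). (\<phi> x, span {null_vector (\<lambda>i. e i (\<phi> x)) t}))"

lemma lorentz_prolongation_eq:
  "lorentz_prolongation M g = {(V \<times> {a<..<a + 2 * pi}, null_chart \<phi> e) |V \<phi> a e.
     local_coordinates M V \<phi> \<and> orthonormal_frame_on M g (\<phi> ` V) e}"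
  by (simp add: lorentz_prolongation_def null_chart_def null_vector_def)

locale lorentz_3manifold =
  fixes M :: "(real^3, 'a) atlas" and g :: "'a \<Rightarrow> 'a tvec \<Rightarrow> 'a tvec \<Rightarrow> real"
  assumes manifold: "smooth_manifold M" and metric: "lorentz_metric M g"
begin

text \<open>The domain \<open>U\<close> of the frame is independent of the patch, so that a frame
  given over one patch can be examined in the coordinates of another.\<close>

lemma lorentz_frame_at:
  assumes "local_coordinates M V \<phi>" "orthonormal_frame_on M g U e" "x \<in> V" "\<phi> x \<in> U"
  shows "lorentz_frame (tangent M (\<phi> x)) (g (\<phi> x)) (\<lambda>i. e i (\<phi> x)) (push M \<phi> x)"
proof -
  interpret coordinate_patch M V \<phi> by (rule coordinate_patchI[OF manifold assms(1)])
  have p: "\<phi> x \<in> carrier M" using image_subset_carrier assms(3) by blast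
  show ?thesis
  proof (rule lorentz_frame.intro)
    show "linear (push M \<phi> x)" "inj (push M \<phi> x)" "tangent M (\<phi> x) = range (push M \<phi> x)"
      using assms(3) by (simp_all add: linear_push inj_push tangent_eq)
    show "e i (\<phi> x) \<in> tangent M (\<phi> x)" for i
      using assms(2,4) by (simp add: orthonormal_frame_on_def vector_field_on_def)
    show "g (\<phi> x) (e i (\<phi> x)) (e j (\<phi> x)) = (if i \<noteq> j then 0 else if i = 3 then - 1 else 1)" for i j
      using assms(2,4) by (simp add: orthonormal_frame_on_def)
  qed (use metric p in \<open>simp_all add: lorentz_metric_def\<close>)
qed

lemma inj_on_null_chart:
  assumes "local_coordinates M V \<phi>" "orthonormal_frame_on M g (\<phi> ` V) e"
  shows "inj_on (null_chart \<phi> e) (V \<times> {a<..<a + 2 * pi})"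
proof (rule inj_onI, clarify)
  interpret coordinate_patch M V \<phi> by (rule coordinate_patchI[OF manifold assms(1)])
  fix x t x' t' assume x: "x \<in> V" "x' \<in> V" and t: "t \<in> {a<..<a + 2 * pi}" "t' \<in> {a<..<a + 2 * pi}"
    and eq: "null_chart \<phi> e (x, t) = null_chart \<phi> e (x', t')"
  have "\<phi> x = \<phi> x'" using eq by (simp add: null_chart_def)
  then have xx: "x = x'" using inj_on_domain x by (simp add: inj_on_eq_iff)
  interpret F: lorentz_frame "tangent M (\<phi> x)" "g (\<phi> x)" "\<lambda>i. e i (\<phi> x)" "push M \<phi> x"
    using lorentz_frame_at[OF assms x(1)] x by simp
  let ?w = "null_vector (\<lambda>i. e i (\<phi> x))"
  have "span {?w t} = span {?w t'}" using eq xx by (simp add: null_chart_def)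
  then have "cos t' = cos t \<and> sin t' = sin t"
    using F.span_null_vector_eq_iff[OF F.null_vector_in F.null_vector_nonzero F.null_vector_null]
    by (simp add: F.b_null_vector)
  then show "x = x' \<and> t = t'"
    using angle_from_eq[OF t(1)] angle_from_eq[OF t(2)] xx by metis
qed

text \<open>A null vector of the first frame is expanded in the second. Its pairings
  \<open>\<beta> i\<close> are smooth in point and angle, and by nullity the quotients of
  \<open>\<beta> 1\<close> and \<open>\<beta> 2\<close> by \<open>- \<beta> 3\<close> form a point
  of the unit circle, the cosine and sine of the new angle. The charts overlap where this point
  avoids the excluded angle \<open>a'\<close>.\<close>

lemma smooth_transition_null_chart:
  assumes c: "local_coordinates M V \<phi>" "orthonormal_frame_on M g (\<phi> ` V) e"
    and c': "local_coordinates M V' \<phi>'" "orthonormal_frame_on M g (\<phi>' ` V') e'"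
  shows "smooth_transition (V \<times> {a<..<a + 2 * pi}, null_chart \<phi> e)
    (V' \<times> {a'<..<a' + 2 * pi}, null_chart \<phi>' e')"
proof -
  let ?I = "{a<..<a + 2 * pi}" and ?I' = "{a'<..<a' + 2 * pi}"
  interpret A: coordinate_patch M V \<phi> by (rule coordinate_patchI[OF manifold c(1)])
  interpret B: coordinate_patch M V' \<phi>' by (rule coordinate_patchI[OF manifold c'(1)])
  define U where "U = V \<inter> \<phi> -` (\<phi>' ` V')"
  have U: "open U" "smooth_on U (inv_into V' \<phi>' \<circ> \<phi>)"
    unfolding U_def using coordinate_change[OF A.coordinate_patch_axioms B.coordinate_patch_axioms]
    by auto
  have F: "lorentz_frame (tangent M (\<phi> x)) (g (\<phi> x)) (\<lambda>i. e i (\<phi> x)) (push M \<phi> x)"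
    if "x \<in> U" for x
    using lorentz_frame_at[OF c] that by (simp add: U_def)
  have F': "lorentz_frame (tangent M (\<phi> x)) (g (\<phi> x)) (\<lambda>i. e' i (\<phi> x)) (push M \<phi> x)"
    if "x \<in> U" for x
    using lorentz_frame_at[OF c(1) c'(2)] that by (simp add: U_def)
  define w where "w z = null_vector (\<lambda>i. e i (\<phi> (fst z))) (snd z)" for z
  define w' where "w' z = null_vector (\<lambda>i. e' i (\<phi> (fst z))) (snd z)" for z
  define \<beta> where "\<beta> i z = g (\<phi> (fst z)) (w z) (e' i (\<phi> (fst z)))" for i z
  define C where "C z = \<beta> 1 z / - \<beta> 3 z" for z
  define S where "S z = \<beta> 2 z / - \<beta> 3 z" for z
  have w: "w z \<in> tangent M (\<phi> (fst z))" "w z \<noteq> 0" "g (\<phi> (fst z)) (w z) (w z) = 0"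
    if "fst z \<in> U" for z
    using F[OF that] unfolding w_def
    by (rule lorentz_frame.null_vector_in lorentz_frame.null_vector_nonzero
        lorentz_frame.null_vector_null)+
  have \<beta>3: "\<beta> 3 z \<noteq> 0" and circle: "(C z)\<^sup>2 + (S z)\<^sup>2 = 1"
    and span_iff: "span {w z} = span {null_vector (\<lambda>i. e' i (\<phi> (fst z))) t} \<longleftrightarrow>
      cos t = C z \<and> sin t = S z" if "fst z \<in> U" for z t
    unfolding C_def S_def \<beta>_def
    using lorentz_frame.b_timelike_nonzero[OF F'[OF that], OF w[OF that]]
      lorentz_frame.null_direction[OF F'[OF that], OF w[OF that]]
      lorentz_frame.span_null_vector_eq_iff[OF F'[OF that], OF w[OF that]] by auto
  have "smooth_on U (\<lambda>x. g (\<phi> x) (e j (\<phi> x)) (e' i (\<phi> x)))" for i j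
  proof (rule smooth_on_local)
    fix x assume x: "x \<in> U"
    have "openin (manifold_topology M) (\<phi> ` U)"
      by (rule A.openin_image[OF U(1)]) (auto simp: U_def)
    moreover have "vector_field_on M (\<phi> ` U) (e j)" "vector_field_on M (\<phi> ` U) (e' i)"
      using c(2) c'(2) unfolding orthonormal_frame_on_def vector_field_on_def U_def by blast+
    ultimately have "smooth_at M (\<lambda>q. g q (e j q) (e' i q)) (\<phi> x)"
      using metric x unfolding lorentz_metric_def by blast
    then show "\<exists>N. open N \<and> x \<in> N \<and> smooth_on N (\<lambda>x. g (\<phi> x) (e j (\<phi> x)) (e' i (\<phi> x)))"
      using A.smooth_at_iff[of x "\<lambda>q. g q (e j q) (e' i q)"] x by (auto simp: U_def comp_def)
  qed
  then have G: "smooth_on (U \<times> ?I) (\<lambda>z. g (\<phi> (fst z)) (e j (\<phi> (fst z))) (e' i (\<phi> (fst z))))" for i j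
    using smooth_on_compose[of "U \<times> ?I" U fst "\<lambda>x. g (\<phi> x) (e j (\<phi> x)) (e' i (\<phi> x))"] U(1)
      smooth_on_bounded_linear[OF bounded_linear_fst _ smooth_on_id, of "U \<times> ?I"]
    by (auto simp: open_Times)
  have op: "open (U \<times> ?I)" using U(1) by (simp add: open_Times)
  have snd: "smooth_on (U \<times> ?I) snd"
    using smooth_on_bounded_linear[OF bounded_linear_snd op smooth_on_id[OF op]] by simp
  have \<beta>: "smooth_on (U \<times> ?I) (\<beta> i)" for i
  proof (rule smooth_on_cong[OF op])
    fix z assume "z \<in> U \<times> ?I"
    then have z: "fst z \<in> U" by auto
    show "cos (snd z) * g (\<phi> (fst z)) (e 1 (\<phi> (fst z))) (e' i (\<phi> (fst z)))
        + sin (snd z) * g (\<phi> (fst z)) (e 2 (\<phi> (fst z))) (e' i (\<phi> (fst z)))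
        + 1 * g (\<phi> (fst z)) (e 3 (\<phi> (fst z))) (e' i (\<phi> (fst z))) = \<beta> i z"
      unfolding \<beta>_def w_def null_vector_def
      using lorentz_frame.b_combination[OF F[OF z], OF lorentz_frame.frame[OF F'[OF z]], of "cos (snd z)" "sin (snd z)" 1 i]
      by simp
  qed (intro smooth_on_add smooth_on_mult smooth_on_cos smooth_on_sin smooth_on_const snd op G)
  have CS: "smooth_on (U \<times> ?I) C" "smooth_on (U \<times> ?I) S"
    unfolding C_def S_def using \<beta>3
    by (intro smooth_on_divide smooth_on_minus op \<beta>; force)+
  \<comment> \<open>For a new angle t' this is 1 - cos (t' - a'): it vanishes exactly at the angle
    left out of the target chart, and it is the denominator in \<open>angle_from\<close>.\<close>
  define d where "d z = 1 - (C z * cos a' + S z * sin a')" for z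
  have d: "smooth_on (U \<times> ?I) d"
    unfolding d_def by (intro smooth_on_diff smooth_on_add smooth_on_mult smooth_on_const CS op)
  define W where "W = (U \<times> ?I) \<inter> d -` (- {0})"
  have "open W"
    unfolding W_def by (intro open_smooth_vimage[OF op d] open_Compl closed_singleton)
  have chart: "null_chart \<phi> e z = null_chart \<phi>' e' (x', t') \<longleftrightarrow>
      \<phi> (fst z) = \<phi>' x' \<and> cos t' = C z \<and> sin t' = S z" if "fst z \<in> U" for z x' t'
  proof -
    have "null_chart \<phi> e z = (\<phi> (fst z), span {w z})"
      by (simp add: null_chart_def w_def split_beta)
    moreover have "null_chart \<phi>' e' (x', t') = (\<phi>' x', span {null_vector (\<lambda>i. e' i (\<phi>' x')) t'})"
      by (simp add: null_chart_def)
    ultimately show ?thesis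
      using span_iff[OF that, of t'] by (cases "\<phi> (fst z) = \<phi>' x'") simp_all
  qed
  have W_eq: "(V \<times> ?I) \<inter> null_chart \<phi> e -` (null_chart \<phi>' e' ` (V' \<times> ?I')) = W"
  proof (intro equalityI subsetI)
    fix z assume "z \<in> (V \<times> ?I) \<inter> null_chart \<phi> e -` (null_chart \<phi>' e' ` (V' \<times> ?I'))"
    then obtain x' t' where z: "z \<in> V \<times> ?I" and x': "x' \<in> V'" "t' \<in> ?I'"
      and eq: "null_chart \<phi> e z = null_chart \<phi>' e' (x', t')" by auto
    have "\<phi> (fst z) = \<phi>' x'" using eq by (simp add: null_chart_def split_beta)
    then have zU: "fst z \<in> U" using z x' by (auto simp: U_def)
    then have "cos t' = C z" "sin t' = S z" using chart[OF zU, of x' t'] eq by simp_all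
    then show "z \<in> W"
      using zU angle_denominator[OF x'(2)] z by (simp add: W_def d_def mem_Times_iff)
  next
    fix z assume z: "z \<in> W"
    then have zU: "fst z \<in> U" "snd z \<in> ?I" "d z \<noteq> 0" by (auto simp: W_def)
    obtain x' where x': "x' \<in> V'" "\<phi> (fst z) = \<phi>' x'" using zU by (auto simp: U_def)
    obtain t' where t': "a' \<le> t'" "t' < a' + 2 * pi" "cos t' = C z" "sin t' = S z"
      using cos_sin_shift_total[OF circle[OF zU(1)]] .
    \<comment> \<open>The angle found so far lies in a half-open window;
      \<open>d z \<noteq> 0\<close> excludes the endpoint and leaves the open interval of the
      chart.\<close>
    have "t' \<noteq> a'"
    proof
      assume "t' = a'"
      then have "d z = 1 - ((cos a')\<^sup>2 + (sin a')\<^sup>2)"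
        using t' by (simp add: d_def power2_eq_square)
      then show False using zU(3) by simp
    qed
    then have "(x', t') \<in> V' \<times> ?I'" using x' t' by auto
    moreover have "null_chart \<phi> e z = null_chart \<phi>' e' (x', t')"
      using chart[OF zU(1)] x' t' by simp
    moreover have "z \<in> V \<times> ?I"
      using zU by (auto simp: U_def mem_Times_iff)
    ultimately show "z \<in> (V \<times> ?I) \<inter> null_chart \<phi> e -` (null_chart \<phi>' e' ` (V' \<times> ?I'))"
      by blast
  qed
  have inverse: "(inv_into V' \<phi>' (\<phi> (fst z)), angle_from a' (C z) (S z))
      = (inv_into (V' \<times> ?I') (null_chart \<phi>' e') \<circ> null_chart \<phi> e) z" if z: "z \<in> W" for z
  proof -
    obtain x' t' where x': "x' \<in> V'" "t' \<in> ?I'" "null_chart \<phi> e z = null_chart \<phi>' e' (x', t')"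
      using z unfolding W_eq[symmetric] by auto
    then have "inv_into (V' \<times> ?I') (null_chart \<phi>' e') (null_chart \<phi> e z) = (x', t')"
      using inv_into_f_f[OF inj_on_null_chart[OF c'], of "(x', t')" a'] by simp
    moreover have "fst z \<in> U" using z by (auto simp: W_def)
    then have "\<phi> (fst z) = \<phi>' x'" "cos t' = C z" "sin t' = S z" using chart x'(3) by auto
    moreover have "inv_into V' \<phi>' (\<phi>' x') = x'" by (rule inv_into_f_f[OF B.inj_on_domain x'(1)])
    ultimately show ?thesis using angle_from_eq[OF x'(2)] by simp
  qed
  have WU: "W \<subseteq> U \<times> ?I" by (auto simp: W_def)
  have "smooth_on W (\<lambda>z. (inv_into V' \<phi>' (\<phi> (fst z)), angle_from a' (C z) (S z)))"
  proof (rule smooth_on_Pair[OF \<open>open W\<close>])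
    have "smooth_on W fst"
      using smooth_on_bounded_linear[OF bounded_linear_fst \<open>open W\<close> smooth_on_id[OF \<open>open W\<close>]] by simp
    moreover have "fst ` W \<subseteq> U" using WU by auto
    ultimately show "smooth_on W (\<lambda>z. inv_into V' \<phi>' (\<phi> (fst z)))"
      using smooth_on_compose[OF \<open>open W\<close> U(1) _ _ U(2), of fst] by (simp add: comp_def)
    have "smooth_on W (\<lambda>z. (C z * sin a' - S z * cos a') / d z)"
      by (intro smooth_on_divide smooth_on_diff smooth_on_mult smooth_on_const \<open>open W\<close>
          smooth_on_subset[OF CS(1) WU] smooth_on_subset[OF CS(2) WU] smooth_on_subset[OF d WU])
        (auto simp: W_def)
    then show "smooth_on W (\<lambda>z. angle_from a' (C z) (S z))"
      unfolding angle_from_def d_def[symmetric]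
      by (intro smooth_on_add smooth_on_mult smooth_on_const smooth_on_arctan \<open>open W\<close>)
  qed
  then have "smooth_on W (inv_into (V' \<times> ?I') (null_chart \<phi>' e') \<circ> null_chart \<phi> e)"
    by (rule smooth_on_cong[OF \<open>open W\<close>, rotated]) (rule inverse)
  then show ?thesis
    unfolding smooth_transition_def by (simp add: W_eq \<open>open W\<close>)
qed

lemma coordinate_patch_null_chart:
  assumes c: "local_coordinates M V \<phi>" "orthonormal_frame_on M g (\<phi> ` V) e"
  shows "coordinate_patch (lorentz_prolongation M g) (V \<times> {a<..<a + 2 * pi}) (null_chart \<phi> e)"
proof
  fix W \<psi> assume "(W, \<psi>) \<in> lorentz_prolongation M g"
  then obtain V' \<phi>' a' e' where W: "W = V' \<times> {a'<..<a' + 2 * pi}" "\<psi> = null_chart \<phi>' e'"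
    "local_coordinates M V' \<phi>'" "orthonormal_frame_on M g (\<phi>' ` V') e'"
    unfolding lorentz_prolongation_eq by blast
  then show "inj_on \<psi> W"
    using inj_on_null_chart by simp
next
  have mem: "(V \<times> {a<..<a + 2 * pi}, null_chart \<phi> e) \<in> lorentz_prolongation M g"
    using c unfolding lorentz_prolongation_eq by blast
  show "local_coordinates (lorentz_prolongation M g) (V \<times> {a<..<a + 2 * pi}) (null_chart \<phi> e)"
    unfolding local_coordinates_def
  proof (intro conjI ballI)
    show "open (V \<times> {a<..<a + 2 * pi})"
      using c(1) by (simp add: local_coordinates_def open_Times)
    show "inj_on (null_chart \<phi> e) (V \<times> {a<..<a + 2 * pi})"
      by (rule inj_on_null_chart[OF c])
    show "null_chart \<phi> e ` (V \<times> {a<..<a + 2 * pi}) \<subseteq> carrier (lorentz_prolongation M g)"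
      using mem unfolding carrier_def by blast
    fix d assume "d \<in> lorentz_prolongation M g"
    then obtain V' \<phi>' a' e' where d: "d = (V' \<times> {a'<..<a' + 2 * pi}, null_chart \<phi>' e')"
      "local_coordinates M V' \<phi>'" "orthonormal_frame_on M g (\<phi>' ` V') e'"
      unfolding lorentz_prolongation_eq by blast
    show "smooth_transition d (V \<times> {a<..<a + 2 * pi}, null_chart \<phi> e)"
      "smooth_transition (V \<times> {a<..<a + 2 * pi}, null_chart \<phi> e) d"
      unfolding d(1) by (rule smooth_transition_null_chart c d(2,3))+
  qed
qed

lemma Collect_range_eq:
  assumes "\<And>v. d (P v) = p v"
  shows "{X \<in> range P. d X \<in> T} = P ` {v. p v \<in> T}"
  using assms by auto

text \<open>In bundle coordinates the projection is \<open>fst\<close>, so its differential forgets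
  the angular component and the defining condition concerns the base component alone.\<close>

lemma prolongation_distribution_eq:
  assumes c: "local_coordinates M V \<phi>" "orthonormal_frame_on M g (\<phi> ` V) e"
    and z: "z \<in> V \<times> {a<..<a + 2 * pi}"
  shows "prolongation_distribution M g (null_chart \<phi> e z) =
    push (lorentz_prolongation M g) (null_chart \<phi> e) z `
      {v. push M \<phi> (fst z) (fst v) \<in> span {null_vector (\<lambda>i. e i (\<phi> (fst z))) (snd z)}}"
proof -
  let ?Q = "lorentz_prolongation M g" and ?\<psi> = "null_chart \<phi> e"
  interpret A: coordinate_patch M V \<phi> by (rule coordinate_patchI[OF manifold c(1)])
  interpret B: coordinate_patch ?Q "V \<times> {a<..<a + 2 * pi}" ?\<psi>
    by (rule coordinate_patch_null_chart[OF c])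
  have x: "fst z \<in> V" using z by auto
  have fst_chart: "fst (?\<psi> y) = \<phi> (fst y)" for y
    by (simp add: null_chart_def split_beta)
  have diff: "differential M fst (?\<psi> z) (push ?Q ?\<psi> z v) = push M \<phi> (fst z) (fst v)" for v
  proof
    fix f
    show "differential M fst (?\<psi> z) (push ?Q ?\<psi> z v) f = push M \<phi> (fst z) (fst v) f"
    proof (cases "smooth_at M f (\<phi> (fst z))")
      case f: True
      obtain N where N: "open N" "fst z \<in> N" "N \<subseteq> V" "smooth_on N (f \<circ> \<phi>)"
        using A.smooth_at_nhds[OF x f] by metis
      let ?N = "N \<times> {a<..<a + 2 * pi}"
      have op: "open ?N" using N(1) by (simp add: open_Times)
      have eq: "(f \<circ> fst) \<circ> ?\<psi> = (\<lambda>y. (f \<circ> \<phi>) (fst y))"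
        by (simp add: fun_eq_iff fst_chart)
      have "smooth_on ?N fst"
        using smooth_on_bounded_linear[OF bounded_linear_fst op smooth_on_id[OF op]] by simp
      then have "smooth_on ?N ((f \<circ> fst) \<circ> ?\<psi>)"
        unfolding eq by (intro smooth_on_compose[OF op N(1) _ _ N(4)]) auto
      then have "smooth_at ?Q (f \<circ> fst) (?\<psi> z)"
        unfolding B.smooth_at_iff[OF z] using op N z by (intro exI[of _ ?N]) auto
      moreover have "((\<lambda>y. (f \<circ> \<phi>) (fst y)) has_derivative
          (\<lambda>v. frechet_derivative (f \<circ> \<phi>) (at (fst z)) (fst v))) (at z)"
        by (rule has_derivative_compose[of fst, OF _ smooth_on_has_derivative[OF N(4,2)]])
          (auto intro!: derivative_eq_intros)
      ultimately show ?thesis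
        using f unfolding differential_def push_def eq
        by (simp add: fst_chart frechet_derivative_eqI)
    qed (simp add: differential_def push_def fst_chart)
  qed
  have snd: "snd (?\<psi> z) = span {null_vector (\<lambda>i. e i (\<phi> (fst z))) (snd z)}" (is "_ = ?T")
    by (simp add: null_chart_def split_beta)
  show ?thesis
    unfolding prolongation_distribution_def B.tangent_eq[OF z] snd
    by (rule Collect_range_eq) (rule diff)
qed

end

section \<open>The Engel structure in coordinates\<close>

text \<open>Differentiating the relations \<open>\<Lambda> y \<bullet> \<xi> y = 0\<close> and
  \<open>\<Lambda> y \<bullet> \<eta> y = 0\<close> moves each derivative from the section to the
  covector. This is Cartan's formula for the exterior derivative, whose terms differentiating the
  two pairings vanish here.\<close>

lemma inner_commutator:
  fixes \<xi> \<eta> \<Lambda> :: "'e::euclidean_space \<Rightarrow> 'e"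
  assumes N: "open N" "z \<in> N" and sm: "smooth_on N \<Lambda>" "smooth_on N \<xi>" "smooth_on N \<eta>"
    and ann: "\<And>y. y \<in> N \<Longrightarrow> \<Lambda> y \<bullet> \<xi> y = 0" "\<And>y. y \<in> N \<Longrightarrow> \<Lambda> y \<bullet> \<eta> y = 0"
  shows "\<Lambda> z \<bullet> commutator \<xi> \<eta> z
    = frechet_derivative \<Lambda> (at z) (\<eta> z) \<bullet> \<xi> z - frechet_derivative \<Lambda> (at z) (\<xi> z) \<bullet> \<eta> z"
proof -
  have *: "\<Lambda> z \<bullet> frechet_derivative \<zeta> (at z) v = - (frechet_derivative \<Lambda> (at z) v \<bullet> \<zeta> z)"
    if \<zeta>: "smooth_on N \<zeta>" "\<And>y. y \<in> N \<Longrightarrow> \<Lambda> y \<bullet> \<zeta> y = 0" for \<zeta> v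
  proof -
    have "((\<lambda>y. \<Lambda> y \<bullet> \<zeta> y) has_derivative (\<lambda>v. \<Lambda> z \<bullet> frechet_derivative \<zeta> (at z) v
        + frechet_derivative \<Lambda> (at z) v \<bullet> \<zeta> z)) (at z)"
      by (intro has_derivative_inner smooth_on_has_derivative[OF _ N(2)] sm(1) \<zeta>(1))
    then have "((\<lambda>y. 0) has_derivative (\<lambda>v. \<Lambda> z \<bullet> frechet_derivative \<zeta> (at z) v
        + frechet_derivative \<Lambda> (at z) v \<bullet> \<zeta> z)) (at z)"
      by (rule has_derivative_transform_within_open[OF _ N]) (rule \<zeta>(2))
    from frechet_derivative_eqI[OF this, of v] show ?thesis by simp
  qed
  show ?thesis
    using *[OF sm(2) ann(1), of "\<eta> z"] *[OF sm(3) ann(2), of "\<xi> z"]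
    by (simp add: commutator_def inner_diff_right)
qed

text \<open>Along the fibre only the angle varies, so derivatives in the direction (0, 1) reduce to
  one-variable calculus.\<close>

lemma frechet_derivative_snd_direction:
  fixes f :: "'a::real_normed_vector \<times> real \<Rightarrow> 'b::real_normed_vector"
  assumes "f differentiable at z" "((\<lambda>s. f (fst z, s)) has_vector_derivative w) (at (snd z))"
  shows "frechet_derivative f (at z) (0, 1) = w"
proof -
  have "((\<lambda>s. f (fst z, s)) has_derivative (\<lambda>s. frechet_derivative f (at z) (0, s))) (at (snd z))"
    by (rule has_derivative_compose[of "\<lambda>s. (fst z, s)"])
      (use has_derivative_frechet[OF assms(1)] in \<open>auto intro!: derivative_eq_intros\<close>)
  moreover have "((\<lambda>s. f (fst z, s)) has_derivative (\<lambda>s. s *\<^sub>R w)) (at (snd z))"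
    using assms(2) by (simp add: has_vector_derivative_def)
  ultimately have "(\<lambda>s. frechet_derivative f (at z) (0, s)) = (\<lambda>s. s *\<^sub>R w)"
    by (rule has_derivative_unique)
  from fun_cong[OF this, of 1] show ?thesis by simp
qed

abbreviation (input) \<Theta> :: "(real^3) \<times> real" where "\<Theta> \<equiv> (0, 1)"

abbreviation (input) hor :: "3 \<Rightarrow> (real^3) \<times> real" where "hor i \<equiv> (axis i 1, 0)"

text \<open>\<open>p1\<close>, \<open>p2\<close>, \<open>p3\<close> stand for the square roots of
  |g11|, |g22|, |g33|. Keeping them abstract frees the bracket computations from roots, which are
  differentiated only once \<open>c\<close> is known.\<close>

locale diagonal_frame =
  fixes V :: "(real^3) set" and p1 p2 p3 :: "real^3 \<Rightarrow> real"
  assumes open_V: "open V"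
    and smooth: "smooth_on V p1" "smooth_on V p2" "smooth_on V p3"
    and pos: "\<And>x. x \<in> V \<Longrightarrow> p1 x > 0" "\<And>x. x \<in> V \<Longrightarrow> p2 x > 0" "\<And>x. x \<in> V \<Longrightarrow> p3 x > 0"
begin

text \<open>\<open>A\<close> is the lift of the null direction to the bundle; \<open>B\<close> and \<open>C\<close> are its first and second
  derivatives along the fibre. The covector \<open>\<Lambda>\<close> annihilates \<open>\<Theta>\<close>, \<open>A\<close> and \<open>B\<close>, hence the even contact
  structure, and \<open>\<Lambda>'\<close> is its derivative along the fibre.\<close>

definition A :: "(real^3) \<times> real \<Rightarrow> (real^3) \<times> real" where
  "A z = (cos (snd z) / p1 (fst z)) *\<^sub>R hor 1 + (sin (snd z) / p2 (fst z)) *\<^sub>R hor 2 + (1 / p3 (fst z)) *\<^sub>R hor 3"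

definition B :: "(real^3) \<times> real \<Rightarrow> (real^3) \<times> real" where
  "B z = (- sin (snd z) / p1 (fst z)) *\<^sub>R hor 1 + (cos (snd z) / p2 (fst z)) *\<^sub>R hor 2"

definition C :: "(real^3) \<times> real \<Rightarrow> (real^3) \<times> real" where
  "C z = (- cos (snd z) / p1 (fst z)) *\<^sub>R hor 1 + (- sin (snd z) / p2 (fst z)) *\<^sub>R hor 2"

definition \<Lambda> :: "(real^3) \<times> real \<Rightarrow> (real^3) \<times> real" where
  "\<Lambda> z = (cos (snd z) * p1 (fst z)) *\<^sub>R hor 1 + (sin (snd z) * p2 (fst z)) *\<^sub>R hor 2 - p3 (fst z) *\<^sub>R hor 3"

definition \<Lambda>' :: "(real^3) \<times> real \<Rightarrow> (real^3) \<times> real" where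
  "\<Lambda>' z = (- sin (snd z) * p1 (fst z)) *\<^sub>R hor 1 + (cos (snd z) * p2 (fst z)) *\<^sub>R hor 2"

text \<open>The value of \<open>-d\<Lambda>(A, B)\<close>, that is of \<open>\<Lambda>([A, B])\<close>.\<close>

definition c :: "(real^3) \<times> real \<Rightarrow> real" where
  "c z = frechet_derivative \<Lambda> (at z) (B z) \<bullet> A z - frechet_derivative \<Lambda> (at z) (A z) \<bullet> B z"

definition kernel_field :: "(real^3) \<times> real \<Rightarrow> (real^3) \<times> real" where
  "kernel_field z = A z + c z *\<^sub>R \<Theta>"

text \<open>Given by equations instead of generators, because brackets are tested by pairing them
  with covectors; spanning vectors are recovered from \<open>kernel_expansion\<close>.\<close>

definition engel_plane :: "(real^3) \<times> real \<Rightarrow> ((real^3) \<times> real) set" where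
  "engel_plane z = {v. \<Lambda> z \<bullet> v = 0 \<and> \<Lambda>' z \<bullet> v = 0}"

definition even_contact :: "(real^3) \<times> real \<Rightarrow> ((real^3) \<times> real) set" where
  "even_contact z = {v. \<Lambda> z \<bullet> v = 0}"

abbreviation coord_dom :: "((real^3) \<times> real) set" where "coord_dom \<equiv> V \<times> {0<..<2 * pi}"

section \<open>Smoothness of the frame, its derivatives along the fibre, and the two-form in this
  frame\<close>

lemma open_coord_dom: "open coord_dom"
  by (simp add: open_Times open_V)

lemma smooth_fst: "smooth_on coord_dom fst" and smooth_snd: "smooth_on coord_dom snd"
  using smooth_on_bounded_linear[OF bounded_linear_fst open_coord_dom smooth_on_id[OF open_coord_dom]]
    smooth_on_bounded_linear[OF bounded_linear_snd open_coord_dom smooth_on_id[OF open_coord_dom]] by simp_all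

lemma smooth_p: "smooth_on coord_dom (\<lambda>z. p1 (fst z))" "smooth_on coord_dom (\<lambda>z. p2 (fst z))"
    "smooth_on coord_dom (\<lambda>z. p3 (fst z))"
  by (rule smooth_on_compose[OF open_coord_dom open_V _ smooth_fst]; use smooth in force)+

lemma pos_coord_dom: "z \<in> coord_dom \<Longrightarrow> p1 (fst z) > 0 \<and> p2 (fst z) > 0 \<and> p3 (fst z) > 0"
  using pos by auto

lemmas smooth_intros = smooth_on_add smooth_on_diff smooth_on_scaleR smooth_on_mult smooth_on_divide
  smooth_on_const smooth_on_minus smooth_on_sin smooth_on_cos smooth_snd smooth_p open_coord_dom

lemma smooth_ABC: "smooth_on coord_dom A" "smooth_on coord_dom B" "smooth_on coord_dom C"
  "smooth_on coord_dom \<Lambda>" "smooth_on coord_dom \<Lambda>'"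
  unfolding A_def B_def C_def \<Lambda>_def \<Lambda>'_def
  by (intro smooth_intros; use pos_coord_dom in force)+

lemma smooth_c: "smooth_on coord_dom c"
  unfolding c_def
  by (intro smooth_on_diff smooth_on_inner smooth_on_derivative_along open_coord_dom smooth_ABC)

lemma smooth_kernel_field: "smooth_on coord_dom kernel_field"
  unfolding kernel_field_def by (intro smooth_intros smooth_ABC smooth_c)

context
  fixes z assumes z: "z \<in> coord_dom"
begin

lemma p_nonzero: "p1 (fst z) \<noteq> 0" "p2 (fst z) \<noteq> 0" "p3 (fst z) \<noteq> 0"
  using pos_coord_dom[OF z] by auto

lemma A_\<Theta>: "frechet_derivative A (at z) \<Theta> = B z"
  by (intro frechet_derivative_snd_direction smooth_on_differentiable[OF smooth_ABC(1) z])
    (use p_nonzero in \<open>auto simp: A_def B_def intro!: derivative_eq_intros\<close>)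

lemma B_\<Theta>: "frechet_derivative B (at z) \<Theta> = C z"
  by (intro frechet_derivative_snd_direction smooth_on_differentiable[OF smooth_ABC(2) z])
    (use p_nonzero in \<open>auto simp: B_def C_def intro!: derivative_eq_intros\<close>)

lemma \<Lambda>_\<Theta>: "frechet_derivative \<Lambda> (at z) \<Theta> = \<Lambda>' z"
  by (intro frechet_derivative_snd_direction smooth_on_differentiable[OF smooth_ABC(4) z])
    (auto simp: \<Lambda>_def \<Lambda>'_def intro!: derivative_eq_intros)

lemma linear_\<Lambda>_derivative: "linear (frechet_derivative \<Lambda> (at z))"
  by (rule linear_frechet_derivative[OF smooth_on_differentiable[OF smooth_ABC(4) z]])

text \<open>Two entries carry the Engel condition: \<open>\<Lambda>' z \<bullet> B z = 1\<close>
  says that \<open>B\<close>, the bracket of \<open>\<Theta>\<close> and \<open>A\<close>, leaves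
  the Engel plane, and \<open>\<Lambda> z \<bullet> C z = -1\<close> that \<open>C\<close>, the
  bracket of \<open>\<Theta>\<close> and \<open>B\<close>, leaves its derived distribution.\<close>

lemma inner_ABC:
  "\<Lambda> z \<bullet> A z = 0" "\<Lambda> z \<bullet> B z = 0" "\<Lambda> z \<bullet> C z = -1" "\<Lambda> z \<bullet> \<Theta> = 0"
  "\<Lambda>' z \<bullet> A z = 0" "\<Lambda>' z \<bullet> B z = 1" "\<Lambda>' z \<bullet> \<Theta> = 0"
proof -
  have sq: "sin x * sin x + cos x * cos x = 1" for x :: real
    using sin_cos_squared_add[of x] by (simp add: power2_eq_square)
  have sq': "cos x * cos x + sin x * sin x = 1" "- (cos x * cos x) - sin x * sin x = -1" for x :: real
    using sq[of x] by simp_all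
  show "\<Lambda> z \<bullet> A z = 0" "\<Lambda> z \<bullet> B z = 0" "\<Lambda> z \<bullet> C z = -1" "\<Lambda> z \<bullet> \<Theta> = 0"
    "\<Lambda>' z \<bullet> A z = 0" "\<Lambda>' z \<bullet> B z = 1" "\<Lambda>' z \<bullet> \<Theta> = 0"
    using p_nonzero
    by (simp_all add: A_def B_def C_def \<Lambda>_def \<Lambda>'_def inner_axis_axis inner_add_left inner_diff_left inner_add_right inner_diff_right
        sq sq')
qed

text \<open>Each coefficient is isolated by a functional that kills the other two frame vectors:
  only \<open>A\<close> has a third coordinate, \<open>\<Lambda>'\<close> vanishes on
  \<open>A\<close> and \<open>\<Theta>\<close>, and only \<open>\<Theta>\<close> has an angular
  component.\<close>

lemma kernel_expansion:
  assumes "\<Lambda> z \<bullet> v = 0"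
  shows "v = (p3 (fst z) * (fst v $ 3)) *\<^sub>R A z + (\<Lambda>' z \<bullet> v) *\<^sub>R B z + snd v *\<^sub>R \<Theta>"
proof -
  define s k where "s = sin (snd z)" and "k = cos (snd z)"
  have sk: "s * s + k * k = 1"
    using sin_cos_squared_add[of "snd z"] by (simp add: power2_eq_square s_def k_def)
  obtain x t where v: "v = (x, t)" by (cases v)
  note defs = A_def B_def \<Lambda>_def \<Lambda>'_def s_def[symmetric] k_def[symmetric]
  define q1 q2 q3 where q: "q1 = p1 (fst z)" "q2 = p2 (fst z)" "q3 = p3 (fst z)"
  have nz: "q1 \<noteq> 0" "q2 \<noteq> 0" "q3 \<noteq> 0" using p_nonzero q by auto
  have 0: "k * q1 * x $ 1 + s * q2 * x $ 2 = q3 * x $ 3"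
    using assms by (simp add: v defs q inner_axis' inner_add_left inner_diff_left)
  have 1: "\<Lambda>' z \<bullet> v = - s * q1 * x $ 1 + k * q2 * x $ 2"
    by (simp add: v defs q inner_axis' inner_add_left inner_diff_left)
  \<comment> \<open>The two equations are a rotation through the fibre angle applied to
    \<open>q1 * x $ 1\<close> and \<open>q2 * x $ 2\<close>; the inverse rotation solves for
    both.\<close>
  have "k * (q3 * x $ 3) - s * (\<Lambda>' z \<bullet> v) = (s * s + k * k) * (q1 * x $ 1)"
    unfolding 0[symmetric] 1 by (simp add: algebra_simps)
  then have x1: "x $ 1 = (k * (q3 * x $ 3) - s * (\<Lambda>' z \<bullet> v)) / q1" using nz sk by simp
  have "s * (q3 * x $ 3) + k * (\<Lambda>' z \<bullet> v) = (s * s + k * k) * (q2 * x $ 2)"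
    unfolding 0[symmetric] 1 by (simp add: algebra_simps)
  then have x2: "x $ 2 = (s * (q3 * x $ 3) + k * (\<Lambda>' z \<bullet> v)) / q2" using nz sk by simp
  have "x = (q3 * x $ 3) *\<^sub>R fst (A z) + (\<Lambda>' z \<bullet> v) *\<^sub>R fst (B z)"
    unfolding vec_eq_iff forall_3
  proof (intro conjI)
    show "x $ 1 = ((q3 * x $ 3) *\<^sub>R fst (A z) + (\<Lambda>' z \<bullet> v) *\<^sub>R fst (B z)) $ 1"
      by (subst x1) (simp add: A_def B_def s_def[symmetric] k_def[symmetric] q[symmetric] axis_def
          diff_divide_distrib mult.commute mult.left_commute)
    show "x $ 2 = ((q3 * x $ 3) *\<^sub>R fst (A z) + (\<Lambda>' z \<bullet> v) *\<^sub>R fst (B z)) $ 2"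
      by (subst x2) (simp add: A_def B_def s_def[symmetric] k_def[symmetric] q[symmetric] axis_def
          add_divide_distrib mult.commute mult.left_commute)
    show "x $ 3 = ((q3 * x $ 3) *\<^sub>R fst (A z) + (\<Lambda>' z \<bullet> v) *\<^sub>R fst (B z)) $ 3"
      using nz by (simp add: A_def B_def q[symmetric] axis_def)
  qed
  then show ?thesis
    by (simp add: v q prod_eq_iff) (simp add: A_def B_def)
qed

text \<open>\<open>\<Lambda>'\<close> is the fibre derivative of \<open>\<Lambda>\<close>, so its
  values 0 on \<open>A\<close> and 1 on \<open>B\<close> give the entries involving
  \<open>\<Theta>\<close>; the pairing of \<open>A\<close> with \<open>B\<close> is \<open>c\<close>
  by definition.\<close>

lemma two_form:
  fixes r r' s s' t t' :: real
  defines "v \<equiv> r *\<^sub>R A z + s *\<^sub>R B z + t *\<^sub>R \<Theta>" and "w \<equiv> r' *\<^sub>R A z + s' *\<^sub>R B z + t' *\<^sub>R \<Theta>"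
  shows "frechet_derivative \<Lambda> (at z) w \<bullet> v - frechet_derivative \<Lambda> (at z) v \<bullet> w
    = (r * s' - s * r') * c z + (s * t' - t * s')"
proof -
  let ?L = "frechet_derivative \<Lambda> (at z)"
  have L: "?L (r *\<^sub>R A z + s *\<^sub>R B z + t *\<^sub>R \<Theta>) = r *\<^sub>R ?L (A z) + s *\<^sub>R ?L (B z) + t *\<^sub>R \<Lambda>' z" for r s t
    by (simp only: linear_add[OF linear_\<Lambda>_derivative] linear_scale[OF linear_\<Lambda>_derivative] \<Lambda>_\<Theta>)
  \<comment> \<open>\<open>\<Lambda>\<close> has no angular component anywhere, hence neither do its
    derivatives.\<close>
  have "?L u \<bullet> \<Theta> = 0" for u
  proof -
    have "((\<lambda>y. \<Lambda> y \<bullet> \<Theta>) has_derivative (\<lambda>u. ?L u \<bullet> \<Theta>)) (at z)"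
      by (rule has_derivative_inner_left[OF smooth_on_has_derivative[OF smooth_ABC(4) z]])
    moreover have "(\<lambda>y. \<Lambda> y \<bullet> \<Theta>) = (\<lambda>y. 0)" by (simp add: \<Lambda>_def inner_add_left inner_diff_left)
    ultimately show ?thesis
      using frechet_derivative_eqI[of "\<lambda>y. \<Lambda> y \<bullet> \<Theta>" "\<lambda>u. ?L u \<bullet> \<Theta>" z u] by simp
  qed
  then show ?thesis
    unfolding v_def w_def L c_def
    by (simp only: inner_add_left inner_add_right inner_scaleR_left inner_scaleR_right inner_ABC)
      (simp add: algebra_simps)
qed

end

section \<open>Brackets of sections of the Engel plane and of its derived distribution\<close>

lemma local_sections_mono: "N' \<subseteq> N \<Longrightarrow> \<xi> \<in> local_sections N \<Delta> \<Longrightarrow> \<xi> \<in> local_sections N' \<Delta>"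
  using smooth_on_subset by (auto simp: local_sections_def)

lemma inner_commutator_sections:
  assumes N: "open N" "z \<in> N" "N \<subseteq> coord_dom" and sec: "\<xi> \<in> local_sections N even_contact" "\<eta> \<in> local_sections N even_contact"
  shows "\<Lambda> z \<bullet> commutator \<xi> \<eta> z =
    (p3 (fst z) * (fst (\<xi> z) $ 3) * (\<Lambda>' z \<bullet> \<eta> z) - (\<Lambda>' z \<bullet> \<xi> z) * (p3 (fst z) * (fst (\<eta> z) $ 3))) * c z
    + ((\<Lambda>' z \<bullet> \<xi> z) * snd (\<eta> z) - snd (\<xi> z) * (\<Lambda>' z \<bullet> \<eta> z))"
proof -
  have z: "z \<in> coord_dom" using N by blast
  have ann: "\<And>y. y \<in> N \<Longrightarrow> \<Lambda> y \<bullet> \<xi> y = 0" "\<And>y. y \<in> N \<Longrightarrow> \<Lambda> y \<bullet> \<eta> y = 0"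
    using sec by (auto simp: local_sections_def even_contact_def)
  have sm: "smooth_on N \<Lambda>" "smooth_on N \<xi>" "smooth_on N \<eta>"
    using sec smooth_on_subset[OF smooth_ABC(4) N(3)] by (auto simp: local_sections_def)
  show ?thesis
    unfolding two_form[OF z, symmetric]
      kernel_expansion[OF z ann(1)[OF N(2)], symmetric] kernel_expansion[OF z ann(2)[OF N(2)], symmetric]
    by (rule inner_commutator[OF N(1,2) sm ann])
qed

text \<open>Sections of the Engel plane have no \<open>B\<close>-component, and every nonzero entry
  of the two-form involves \<open>B\<close>.\<close>

lemma commutator_in_even_contact:
  assumes N: "open N" "z \<in> N" "N \<subseteq> coord_dom" and sec: "\<xi> \<in> local_sections N engel_plane" "\<eta> \<in> local_sections N engel_plane"
  shows "commutator \<xi> \<eta> z \<in> even_contact z"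
proof -
  have "\<xi> \<in> local_sections N even_contact" "\<eta> \<in> local_sections N even_contact"
    "\<Lambda>' z \<bullet> \<xi> z = 0" "\<Lambda>' z \<bullet> \<eta> z = 0"
    using sec N(2) by (auto simp: local_sections_def even_contact_def engel_plane_def)
  then show ?thesis
    using inner_commutator_sections[OF N] by (simp add: even_contact_def)
qed

lemma subspace_planes: "subspace (even_contact z)" "subspace (engel_plane z)"
  by (auto simp: even_contact_def engel_plane_def subspace_def inner_add_right)

text \<open>Test sections for the bracket span. The multiples by the angle are there because
  [\<Theta>, \<theta> \<Theta>] = \<Theta> and [\<Theta>, \<theta> A] = A + \<theta> B recover the
  Engel plane inside its derived distribution, while [\<Theta>, A] = B adds the third
  direction.\<close>

lemma engel_plane_sections:
  "(\<lambda>z. \<Theta>) \<in> local_sections coord_dom engel_plane" "(\<lambda>z. snd z *\<^sub>R \<Theta>) \<in> local_sections coord_dom engel_plane"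
  "A \<in> local_sections coord_dom engel_plane" "(\<lambda>z. snd z *\<^sub>R A z) \<in> local_sections coord_dom engel_plane"
  unfolding local_sections_def engel_plane_def
  by (auto simp: inner_ABC mem_Times_iff simp del: scaleR_Pair
      intro!: smooth_intros smooth_ABC)

lemma engel_section_even_contact: "\<xi> \<in> local_sections N engel_plane \<Longrightarrow> \<xi> \<in> local_sections N even_contact"
  by (auto simp: local_sections_def engel_plane_def even_contact_def)

lemma section_B: "B \<in> local_sections coord_dom even_contact"
  by (auto simp: local_sections_def even_contact_def inner_ABC mem_Times_iff smooth_ABC)

lemma commutator_\<Theta>: "commutator (\<lambda>z. \<Theta>) \<eta> z = frechet_derivative \<eta> (at z) \<Theta>"
  by (simp add: commutator_def)

lemma commutator_spanI:
  assumes "z \<in> S" "open S" "\<xi> \<in> local_sections S \<Delta>" "\<eta> \<in> local_sections S \<Delta>'"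
  shows "commutator \<xi> \<eta> z \<in> commutator_span S \<Delta> \<Delta>' z"
  unfolding commutator_span_def using assms by (intro span_base) blast

lemma commutator_span_engel_plane:
  assumes z: "z \<in> coord_dom"
  shows "commutator_span coord_dom engel_plane engel_plane z = even_contact z"
proof
  show "commutator_span coord_dom engel_plane engel_plane z \<subseteq> even_contact z"
    unfolding commutator_span_def
    by (rule span_minimal[OF _ subspace_planes(1)]) (use commutator_in_even_contact in blast)
next
  let ?S = "commutator_span coord_dom engel_plane engel_plane z"
  have sub: "subspace ?S" by (simp add: commutator_span_def)
  note I = commutator_spanI[OF z open_coord_dom engel_plane_sections(1)]
  have B: "B z \<in> ?S"
    using I[OF engel_plane_sections(3)] by (simp add: commutator_\<Theta> A_\<Theta>[OF z])
  have "frechet_derivative (\<lambda>z. snd z *\<^sub>R \<Theta>) (at z) \<Theta> = \<Theta>"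
    by (rule frechet_derivative_snd_direction)
      (auto intro!: derivative_eq_intros smooth_on_differentiable[OF _ z] smooth_intros
        simp del: scaleR_Pair)
  then have T: "\<Theta> \<in> ?S"
    using I[OF engel_plane_sections(2)] by (simp add: commutator_\<Theta>)
  have "((\<lambda>z. snd z *\<^sub>R A z) has_derivative
      (\<lambda>v. snd z *\<^sub>R frechet_derivative A (at z) v + snd v *\<^sub>R A z)) (at z)"
    by (auto intro!: derivative_eq_intros smooth_on_has_derivative[OF smooth_ABC(1) z])
  from frechet_derivative_eqI[OF this, of \<Theta>] have "snd z *\<^sub>R B z + A z \<in> ?S"
    using I[OF engel_plane_sections(4)] by (simp add: commutator_\<Theta> A_\<Theta>[OF z])
  then have "(snd z *\<^sub>R B z + A z) - snd z *\<^sub>R B z \<in> ?S"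
    using B sub by (intro subspace_diff subspace_scale)
  then have A: "A z \<in> ?S" by simp
  show "even_contact z \<subseteq> ?S"
  proof
    fix v assume "v \<in> even_contact z"
    then have "\<Lambda> z \<bullet> v = 0" by (simp add: even_contact_def)
    from kernel_expansion[OF z this] show "v \<in> ?S"
      by (rule ssubst) (intro subspace_add subspace_scale A B T sub)
  qed
qed

text \<open>Sections of the Engel plane already produce \<open>even_contact\<close>; the missing
  direction is \<open>C\<close>, the bracket of \<open>\<Theta>\<close> and \<open>B\<close>, which
  is transverse to it.\<close>

lemma commutator_span_even_contact:
  assumes z: "z \<in> coord_dom"
  shows "commutator_span coord_dom even_contact even_contact z = UNIV"
proof -
  let ?S = "commutator_span coord_dom even_contact even_contact z"
  have sub: "subspace ?S" by (simp add: commutator_span_def)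
  have "commutator_span coord_dom engel_plane engel_plane z \<subseteq> ?S"
    unfolding commutator_span_def by (rule span_mono) (use engel_section_even_contact in blast)
  then have E: "even_contact z \<subseteq> ?S" by (simp add: commutator_span_engel_plane[OF z])
  have C: "C z \<in> ?S"
    using commutator_spanI[OF z open_coord_dom engel_section_even_contact[OF engel_plane_sections(1)] section_B]
    by (simp add: commutator_\<Theta> B_\<Theta>[OF z])
  have "v \<in> ?S" for v
  proof -
    \<comment> \<open>As \<open>\<Lambda> z \<bullet> C z = -1\<close>, adding this multiple of
      \<open>C z\<close> projects \<open>v\<close> into the kernel of
      \<open>\<Lambda>\<close>.\<close>
    have "v + (\<Lambda> z \<bullet> v) *\<^sub>R C z \<in> even_contact z"
      by (simp add: even_contact_def inner_add_right inner_ABC[OF z])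
    then have "v + (\<Lambda> z \<bullet> v) *\<^sub>R C z - (\<Lambda> z \<bullet> v) *\<^sub>R C z \<in> ?S"
      using E by (intro subspace_diff subspace_scale sub C) blast
    then show ?thesis by simp
  qed
  then show ?thesis by blast
qed

lemma kernel_field_props:
  assumes z: "z \<in> coord_dom"
  shows "\<Lambda> z \<bullet> kernel_field z = 0" "\<Lambda>' z \<bullet> kernel_field z = 0" "snd (kernel_field z) = c z" "p3 (fst z) * (fst (kernel_field z) $ 3) = 1"
proof -
  show "\<Lambda> z \<bullet> kernel_field z = 0" "\<Lambda>' z \<bullet> kernel_field z = 0"
    by (simp_all add: kernel_field_def inner_add_right inner_ABC[OF z] del: scaleR_Pair)
  show "snd (kernel_field z) = c z" by (simp add: kernel_field_def A_def)
  show "p3 (fst z) * (fst (kernel_field z) $ 3) = 1"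
    using p_nonzero[OF z] by (simp add: kernel_field_def A_def axis_def)
qed

text \<open>A multiple k of the kernel field has coefficients k, 0, k c along \<open>A\<close>,
  \<open>B\<close>, \<open>\<Theta>\<close>. Against a vector with \<open>B\<close>-coefficient s
  the two-form gives k s c - k c s = 0.\<close>

lemma commutator_span_kernel_field:
  assumes z: "z \<in> coord_dom"
  shows "commutator_span coord_dom (\<lambda>z. span {kernel_field z}) even_contact z \<subseteq> even_contact z"
  unfolding commutator_span_def
proof (rule span_minimal[OF subsetI subspace_planes(1)])
  fix v assume "v \<in> {commutator \<xi> \<eta> z |N \<xi> \<eta>. open N \<and> z \<in> N \<and> N \<subseteq> coord_dom \<and>
    \<xi> \<in> local_sections N (\<lambda>z. span {kernel_field z}) \<and> \<eta> \<in> local_sections N even_contact}"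
  then obtain N \<xi> \<eta> where v: "v = commutator \<xi> \<eta> z" and N: "open N" "z \<in> N" "N \<subseteq> coord_dom"
    and \<xi>: "\<xi> \<in> local_sections N (\<lambda>z. span {kernel_field z})" and \<eta>: "\<eta> \<in> local_sections N even_contact"
    by blast
  have "\<xi> y \<in> even_contact y" if "y \<in> N" for y
  proof -
    have "\<xi> y \<in> span {kernel_field y}" using \<xi> that by (simp add: local_sections_def)
    then obtain k where "\<xi> y = k *\<^sub>R kernel_field y" by (auto simp: span_singleton)
    then show ?thesis
      using kernel_field_props(1)[of y] that N(3) by (auto simp: even_contact_def)
  qed
  then have "\<xi> \<in> local_sections N even_contact" using \<xi> by (simp add: local_sections_def)
  have "\<xi> z \<in> span {kernel_field z}" using \<xi> N(2) by (simp add: local_sections_def)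
  then obtain k where "\<xi> z = k *\<^sub>R kernel_field z" by (auto simp: span_singleton)
  with \<open>\<xi> \<in> local_sections N even_contact\<close> show "v \<in> even_contact z"
    using inner_commutator_sections[OF N _ \<eta>, of \<xi>] kernel_field_props[OF z]
    by (simp add: v even_contact_def mult.left_commute[of "p3 _"] mult.assoc)
qed

text \<open>Against \<open>\<Theta>\<close> the two-form returns the \<open>B\<close>-coefficient of
  \<open>\<xi> z\<close>, which must vanish; against \<open>B\<close> it then returns c times the
  \<open>A\<close>-coefficient minus the \<open>\<Theta>\<close>-coefficient, which forces a
  multiple of \<open>kernel_field z\<close>.\<close>

lemma Cauchy_characteristic:
  assumes N: "open N" "z \<in> N" "N \<subseteq> coord_dom" and \<xi>: "\<xi> \<in> local_sections N even_contact"
    and char: "\<And>\<eta>. \<eta> \<in> local_sections N even_contact \<Longrightarrow> commutator \<xi> \<eta> z \<in> even_contact z"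
  shows "\<xi> z \<in> span {kernel_field z}"
proof -
  have z: "z \<in> coord_dom" using N by blast
  have T: "(\<lambda>z. \<Theta>) \<in> local_sections N even_contact" and B: "B \<in> local_sections N even_contact"
    using local_sections_mono[OF N(3)] engel_section_even_contact engel_plane_sections(1) section_B by blast+
  have "\<Lambda>' z \<bullet> \<xi> z = 0"
    using inner_commutator_sections[OF N \<xi> T] char[OF T] inner_ABC[OF z] by (simp add: even_contact_def)
  moreover from this have "snd (\<xi> z) = p3 (fst z) * (fst (\<xi> z) $ 3) * c z"
    using inner_commutator_sections[OF N \<xi> B] char[OF B] inner_ABC[OF z] by (simp add: even_contact_def)
  moreover have "\<Lambda> z \<bullet> \<xi> z = 0" using \<xi> N(2) by (auto simp: local_sections_def even_contact_def)
  note kernel_expansion[OF z this]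
  ultimately have "\<xi> z = (p3 (fst z) * (fst (\<xi> z) $ 3)) *\<^sub>R kernel_field z"
    by (simp add: kernel_field_def scaleR_add_right del: scaleR_Pair)
  then show ?thesis unfolding span_singleton by blast
qed

lemma engel_plane_span:
  assumes z: "z \<in> coord_dom"
  shows "engel_plane z = span {\<Theta>, A z}"
proof
  show "span {\<Theta>, A z} \<subseteq> engel_plane z"
    by (rule span_minimal[OF _ subspace_planes(2)]) (auto simp: engel_plane_def inner_ABC[OF z])
  show "engel_plane z \<subseteq> span {\<Theta>, A z}"
  proof
    fix v assume "v \<in> engel_plane z"
    then have v: "\<Lambda> z \<bullet> v = 0" "\<Lambda>' z \<bullet> v = 0" by (auto simp: engel_plane_def)
    from kernel_expansion[OF z v(1)] have "v = (p3 (fst z) * (fst v $ 3)) *\<^sub>R A z + snd v *\<^sub>R \<Theta>"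
      by (simp add: v(2) del: scaleR_Pair)
    then show "v \<in> span {\<Theta>, A z}"
      by (rule ssubst) (intro span_add span_scale; simp add: span_base)
  qed
qed

lemma even_contact_span:
  assumes z: "z \<in> coord_dom"
  shows "even_contact z = span {\<Theta>, A z, B z}"
proof
  show "span {\<Theta>, A z, B z} \<subseteq> even_contact z"
    by (rule span_minimal[OF _ subspace_planes(1)]) (auto simp: even_contact_def inner_ABC[OF z])
  show "even_contact z \<subseteq> span {\<Theta>, A z, B z}"
  proof
    fix v assume "v \<in> even_contact z"
    then have "\<Lambda> z \<bullet> v = 0" by (auto simp: even_contact_def)
    from kernel_expansion[OF z this] show "v \<in> span {\<Theta>, A z, B z}"
      by (rule ssubst) (intro span_add span_scale; simp add: span_base)
  qed
qed

lemma A_nonzero: "z \<in> coord_dom \<Longrightarrow> fst (A z) \<noteq> 0"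
  using p_nonzero[of z] by (auto simp: A_def vec_eq_iff forall_3 axis_def)

lemma dim_engel_plane:
  assumes z: "z \<in> coord_dom"
  shows "dim (engel_plane z) = 2"
proof -
  have "\<Theta> \<notin> span {A z}"
  proof
    assume "\<Theta> \<in> span {A z}"
    then obtain k where "\<Theta> = k *\<^sub>R A z" by (auto simp: span_singleton)
    then have "snd \<Theta> = k * snd (A z)" by (metis snd_scaleR real_scaleR_def)
    then show False by (simp add: A_def)
  qed
  moreover have "A z \<noteq> 0" using A_nonzero[OF z] by auto
  ultimately show ?thesis
    unfolding engel_plane_span[OF z] by (simp add: dim_insert)
qed

lemma dim_even_contact:
  assumes z: "z \<in> coord_dom"
  shows "dim (even_contact z) = 3"
proof -
  have "\<Lambda> z \<noteq> 0" using inner_ABC(3)[OF z] by auto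
  then show ?thesis unfolding even_contact_def by (simp add: dim_hyperplane)
qed

end

section \<open>The fibre coefficient of the kernel field in terms of partial derivatives\<close>

lemma frechet_derivative_sqrt:
  fixes f :: "'e::euclidean_space \<Rightarrow> real"
  assumes "f differentiable at x" "f x > 0"
  shows "frechet_derivative (\<lambda>x. sqrt (f x)) (at x) v = frechet_derivative f (at x) v / (2 * sqrt (f x))"
proof -
  have "((\<lambda>x. sqrt (f x)) has_derivative (\<lambda>v. frechet_derivative f (at x) v * (inverse (sqrt (f x)) / 2))) (at x)"
    by (rule has_derivative_real_sqrt[OF assms(2) has_derivative_frechet[OF assms(1)]])
  from frechet_derivative_eqI[OF this, of v] show ?thesis by (simp add: field_simps)
qed

lemma frechet_derivative_partial:
  fixes f :: "real^3 \<Rightarrow> real"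
  assumes "f differentiable at x"
  shows "frechet_derivative f (at x) v
    = v $ 1 * partial_deriv 1 f x + v $ 2 * partial_deriv 2 f x + v $ 3 * partial_deriv 3 f x"
proof -
  have l: "linear (frechet_derivative f (at x))" by (rule linear_frechet_derivative[OF assms])
  have "v = v $ 1 *\<^sub>R axis 1 1 + v $ 2 *\<^sub>R axis 2 1 + v $ 3 *\<^sub>R axis 3 1"
    by (simp add: vec_eq_iff forall_3 axis_def)
  then have "frechet_derivative f (at x) v = frechet_derivative f (at x)
      (v $ 1 *\<^sub>R axis 1 1 + v $ 2 *\<^sub>R axis 2 1 + v $ 3 *\<^sub>R axis 3 1)" by (rule arg_cong)
  then show ?thesis
    by (simp only: linear_add[OF l] linear_scale[OF l] partial_deriv_def real_scaleR_def)
qed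

context diagonal_frame
begin

lemma \<Lambda>_derivative:
  assumes z: "z \<in> coord_dom"
  shows "frechet_derivative \<Lambda> (at z) (v, 0) =
    (cos (snd z) * frechet_derivative p1 (at (fst z)) v) *\<^sub>R hor 1
    + (sin (snd z) * frechet_derivative p2 (at (fst z)) v) *\<^sub>R hor 2
    - frechet_derivative p3 (at (fst z)) v *\<^sub>R hor 3"
proof -
  have x: "fst z \<in> V" using z by auto
  have q: "((\<lambda>y. f (fst y)) has_derivative (\<lambda>v. frechet_derivative f (at (fst z)) (fst v))) (at z)"
    if "smooth_on V f" for f :: "real^3 \<Rightarrow> real"
    by (rule has_derivative_compose[of fst, OF _ smooth_on_has_derivative[OF that x]])
      (auto intro!: derivative_eq_intros)
  have "(\<Lambda> has_derivative (\<lambda>v.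
      (cos (snd z) * frechet_derivative p1 (at (fst z)) (fst v) + (- sin (snd z) * snd v) * p1 (fst z)) *\<^sub>R hor 1
      + (sin (snd z) * frechet_derivative p2 (at (fst z)) (fst v) + (cos (snd z) * snd v) * p2 (fst z)) *\<^sub>R hor 2
      - frechet_derivative p3 (at (fst z)) (fst v) *\<^sub>R hor 3)) (at z)"
    unfolding \<Lambda>_def
    by (rule derivative_eq_intros q smooth refl | simp add: algebra_simps)+
  from frechet_derivative_eqI[OF this, of "(v, 0)"] show ?thesis by simp
qed

text \<open>\<open>A\<close> and \<open>B\<close> are horizontal, so only base derivatives occur. By
  antisymmetry the derivatives of \<open>p1\<close> along x1 and of \<open>p2\<close> along x2
  cancel; that of \<open>p3\<close> along x3 is absent because \<open>B\<close> has no third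
  component.\<close>

lemma c_eq:
  assumes x: "x \<in> V" and t: "t \<in> {0<..<2 * pi}"
  shows "c (x, t) = cos t * (partial_deriv 2 p1 x / p2 x + sin t * partial_deriv 3 p1 x / p3 x) / p1 x
    - sin t * (partial_deriv 1 p2 x / p1 x + cos t * partial_deriv 3 p2 x / p3 x) / p2 x
    + (sin t * partial_deriv 1 p3 x / p1 x - cos t * partial_deriv 2 p3 x / p2 x) / p3 x"
proof -
  define s k where "s = sin t" and "k = cos t"
  have sk: "s * s + k * k = 1"
    using sin_cos_squared_add[of t] by (simp add: power2_eq_square s_def k_def)
  have z: "(x, t) \<in> coord_dom" using x t by simp
  have d: "p1 differentiable at x" "p2 differentiable at x" "p3 differentiable at x"
    using smooth smooth_on_differentiable x by blast+
  define a b where "a = fst (A (x, t))" and "b = fst (B (x, t))"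
  have AB: "A (x, t) = (a, 0)" "B (x, t) = (b, 0)"
    by (simp_all add: a_def b_def A_def B_def)
  have comp: "a $ 1 = k / p1 x" "a $ 2 = s / p2 x" "a $ 3 = 1 / p3 x"
    "b $ 1 = - s / p1 x" "b $ 2 = k / p2 x" "b $ 3 = 0"
    by (simp_all add: a_def b_def A_def B_def axis_def s_def k_def)
  define q1 q2 q3 where q: "q1 = frechet_derivative p1 (at x)" "q2 = frechet_derivative p2 (at x)"
    "q3 = frechet_derivative p3 (at x)"
  have hor_inner: "hor i \<bullet> (v, 0) = v $ i" for i v by (simp add: inner_axis')
  have "c (x, t) = k * q1 b * (k / p1 x) + s * q2 b * (s / p2 x) - q3 b * (1 / p3 x)
      - (k * q1 a * (- s / p1 x) + s * q2 a * (k / p2 x) - q3 a * 0)"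
    unfolding c_def AB \<Lambda>_derivative[OF z] inner_add_left inner_diff_left inner_scaleR_left hor_inner comp
    by (simp add: q s_def k_def)
  \<comment> \<open>Grouped by which of \<open>p1\<close>, \<open>p2\<close>, \<open>p3\<close> is
    differentiated, so that sin^2 + cos^2 = 1 applies inside the first two groups.\<close>
  also have "\<dots> = k / p1 x * (k * q1 b + s * q1 a) + s / p2 x * (s * q2 b - k * q2 a) - q3 b / p3 x"
    by (simp add: algebra_simps)
  also have "k * q1 b + s * q1 a = (s * s + k * k) * (partial_deriv 2 p1 x / p2 x) + s * partial_deriv 3 p1 x / p3 x"
    unfolding q frechet_derivative_partial[OF d(1)] comp by (simp add: algebra_simps add_divide_distrib)
  also have "s * q2 b - k * q2 a = - ((s * s + k * k) * (partial_deriv 1 p2 x / p1 x) + k * partial_deriv 3 p2 x / p3 x)"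
    unfolding q frechet_derivative_partial[OF d(2)] comp by (simp add: algebra_simps add_divide_distrib)
  also have "q3 b = - (s * partial_deriv 1 p3 x / p1 x - k * partial_deriv 2 p3 x / p2 x)"
    unfolding q frechet_derivative_partial[OF d(3)] comp by simp
  finally show ?thesis
    unfolding sk s_def[symmetric] k_def[symmetric]
    by (simp add: algebra_simps add_divide_distrib diff_divide_distrib)
qed

end

section \<open>Transfer of the coordinate computation to the circle bundle\<close>

locale diagonal_chart = lorentz_3manifold M g for M :: "(real^3, 'a) atlas" and g +
  fixes V :: "(real^3) set" and \<phi> :: "real^3 \<Rightarrow> 'a" and g11 g22 g33 :: "real^3 \<Rightarrow> real"
  assumes coords: "local_coordinates M V \<phi>"
    and smooth_g: "smooth_on V g11" "smooth_on V g22" "smooth_on V g33"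
    and sign: "x \<in> V \<Longrightarrow> g11 x > 0" "x \<in> V \<Longrightarrow> g22 x > 0" "x \<in> V \<Longrightarrow> g33 x < 0"
    and diagonal: "x \<in> V \<Longrightarrow> g (\<phi> x) (push M \<phi> x (axis i 1)) (push M \<phi> x (axis j 1)) =
      (if i \<noteq> j then 0 else if i = 1 then g11 x else if i = 2 then g22 x else g33 x)"
begin

sublocale base: coordinate_patch M V \<phi>
  by (rule coordinate_patchI[OF manifold coords])

sublocale diagonal_frame V "\<lambda>x. sqrt (g11 x)" "\<lambda>x. sqrt (g22 x)" "\<lambda>x. sqrt (- g33 x)"
  using smooth_g sign
  by unfold_locales (auto intro!: smooth_on_sqrt smooth_on_minus base.open_domain)

definition p :: "3 \<Rightarrow> real^3 \<Rightarrow> real" where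
  "p i x = (if i = 1 then sqrt (g11 x) else if i = 2 then sqrt (g22 x) else sqrt (- g33 x))"

definition e :: "3 \<Rightarrow> 'a \<Rightarrow> 'a tvec" where
  "e i q = (1 / p i (inv_into V \<phi> q)) *\<^sub>R push M \<phi> (inv_into V \<phi> q) (axis i 1)"

lemma e_eq: "x \<in> V \<Longrightarrow> e i (\<phi> x) = (1 / p i x) *\<^sub>R push M \<phi> x (axis i 1)"
  by (simp add: e_def base.inj_on_domain)

lemma p_pos: "x \<in> V \<Longrightarrow> p i x > 0"
  using sign by (simp add: p_def)

lemma smooth_p_i: "smooth_on V (p i)"
  using smooth unfolding p_def by (cases "i = 1"; cases "i = 2"; simp)

lemma metric_scaleR:
  assumes x: "x \<in> V"
  shows "g (\<phi> x) (r *\<^sub>R push M \<phi> x v) (s *\<^sub>R push M \<phi> x w) = r * s * g (\<phi> x) (push M \<phi> x v) (push M \<phi> x w)"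
proof -
  have q: "\<phi> x \<in> carrier M" using base.image_subset_carrier x by blast
  note T = base.push_in_tangent[OF x] subspace_scale[OF base.subspace_tangent[OF x]]
  have lin: "g (\<phi> x) (r *\<^sub>R v) w = r * g (\<phi> x) v w"
    if "v \<in> tangent M (\<phi> x)" "w \<in> tangent M (\<phi> x)" for r v w
  proof -
    have "g (\<phi> x) (r *\<^sub>R v + 0 *\<^sub>R v) w = r * g (\<phi> x) v w + 0 * g (\<phi> x) v w"
      using metric q that unfolding lorentz_metric_def by blast
    then show ?thesis by simp
  qed
  have sym: "g (\<phi> x) v w = g (\<phi> x) w v"
    if "v \<in> tangent M (\<phi> x)" "w \<in> tangent M (\<phi> x)" for v w
    using metric q that unfolding lorentz_metric_def by blast
  have "g (\<phi> x) (r *\<^sub>R push M \<phi> x v) (s *\<^sub>R push M \<phi> x w)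
      = r * g (\<phi> x) (s *\<^sub>R push M \<phi> x w) (push M \<phi> x v)"
    using lin[of "push M \<phi> x v" "s *\<^sub>R push M \<phi> x w" r] sym[of "push M \<phi> x v" "s *\<^sub>R push M \<phi> x w"]
    by (simp add: T)
  also have "\<dots> = r * (s * g (\<phi> x) (push M \<phi> x v) (push M \<phi> x w))"
    using lin[of "push M \<phi> x w" "push M \<phi> x v" s] sym[of "push M \<phi> x v" "push M \<phi> x w"]
    by (simp add: T)
  finally show ?thesis by simp
qed

lemma frame_e: "orthonormal_frame_on M g (\<phi> ` V) e"
  unfolding orthonormal_frame_on_def
proof (intro conjI ballI allI)
  fix i
  show "vector_field_on M (\<phi> ` V) (e i)"
  proof (rule base.fieldI[OF subset_refl base.open_domain])
    show "smooth_on V (\<lambda>x. (1 / p i x) *\<^sub>R axis i 1)"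
      using p_pos by (intro smooth_on_scaleR smooth_on_divide smooth_on_const smooth_p_i base.open_domain)
        (metis less_irrefl)
    show "e i (\<phi> x) = push M \<phi> x ((1 / p i x) *\<^sub>R axis i 1)" if "x \<in> V" for x
      using that by (simp add: e_eq linear_scale[OF base.linear_push])
  qed
next
  fix q and i j :: 3 assume "q \<in> \<phi> ` V"
  then obtain x where x: "x \<in> V" "q = \<phi> x" by blast
  have "i = 1 \<or> i = 2 \<or> i = 3" by (rule exhaust_3)
  then show "g q (e i q) (e j q) = (if i \<noteq> j then 0 else if i = 3 then - 1 else 1)"
    using sign[OF x(1)] by (auto simp: x e_eq metric_scaleR diagonal p_def)
qed

text \<open>The parametrization of the statement, written with the coordinate fields normalised to
  an orthonormal frame; in this form it is a chart of the bundle atlas with angles in (0, 2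
  pi).\<close>

definition \<psi> :: "(real^3) \<times> real \<Rightarrow> 'a \<times> 'a tvec set" where
  "\<psi> = null_chart \<phi> e"

abbreviation Q :: "((real^3) \<times> real, 'a \<times> 'a tvec set) atlas" where
  "Q \<equiv> lorentz_prolongation M g"

sublocale total: coordinate_patch Q coord_dom \<psi>
  using coordinate_patch_null_chart[OF coords frame_e, of 0] by (simp add: \<psi>_def)

lemma null_vector_e:
  assumes "x \<in> V"
  shows "null_vector (\<lambda>i. e i (\<phi> x)) t = push M \<phi> x (fst (A (x, t)))"
proof -
  have "fst (A (x, t)) = (cos t / p 1 x) *\<^sub>R axis 1 1 + (sin t / p 2 x) *\<^sub>R axis 2 1 + (1 / p 3 x) *\<^sub>R axis 3 1"
    by (simp add: A_def p_def)
  then show ?thesis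
    by (simp add: null_vector_def e_eq[OF assms] linear_add[OF base.linear_push[OF assms]]
        linear_scale[OF base.linear_push[OF assms]])
qed

abbreviation D where "D \<equiv> prolongation_distribution M g"

text \<open>\<open>A\<close> projects to the null direction and \<open>\<Theta>\<close> to 0.
  Conversely, injectivity of \<open>push\<close> on the base forces the horizontal part of any
  vector over the null line to be a multiple of that of \<open>A\<close>.\<close>

lemma D_eq:
  assumes z: "z \<in> coord_dom"
  shows "D (\<psi> z) = push Q \<psi> z ` engel_plane z"
proof -
  have x: "fst z \<in> V" using z by auto
  let ?P = "push M \<phi> (fst z)"
  have "{v. ?P (fst v) \<in> span {?P (fst (A z))}} = engel_plane z"
  proof (intro equalityI subsetI)
    fix v :: "(real^3) \<times> real"
    note lin = linear_0[OF base.linear_push[OF x]] linear_add[OF base.linear_push[OF x]]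
      linear_scale[OF base.linear_push[OF x]]
    have "subspace {v. ?P (fst v) \<in> span {?P (fst (A z))}}"
      unfolding subspace_def by (simp add: lin span_zero span_add span_scale)
    then have "span {\<Theta>, A z} \<subseteq> {v. ?P (fst v) \<in> span {?P (fst (A z))}}"
      by (intro span_minimal) (simp_all add: lin span_base span_zero)
    then show "v \<in> {v. ?P (fst v) \<in> span {?P (fst (A z))}}" if "v \<in> engel_plane z"
      using that engel_plane_span[OF z] by blast
  next
    fix v :: "(real^3) \<times> real" assume "v \<in> {v. ?P (fst v) \<in> span {?P (fst (A z))}}"
    then obtain k where "?P (fst v) = k *\<^sub>R ?P (fst (A z))" by (auto simp: span_singleton)
    then have "?P (fst v) = ?P (k *\<^sub>R fst (A z))"
      by (simp add: linear_scale[OF base.linear_push[OF x]])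
    then have "fst v = k *\<^sub>R fst (A z)" by (rule injD[OF base.inj_push[OF x]])
    then have "v = k *\<^sub>R A z + snd v *\<^sub>R \<Theta>" by (simp add: prod_eq_iff A_def)
    then show "v \<in> engel_plane z"
      unfolding engel_plane_span[OF z] by (rule ssubst) (intro span_add span_scale; simp add: span_base)
  qed
  then show ?thesis
    using prolongation_distribution_eq[OF coords frame_e, of z 0] z null_vector_e[OF x, of "snd z"]
    by (simp add: \<psi>_def)
qed

abbreviation E where "E \<equiv> bracket Q D D"

lemma E_eq:
  assumes z: "z \<in> coord_dom"
  shows "E (\<psi> z) = push Q \<psi> z ` even_contact z"
  using total.bracket_eq[OF subset_refl open_coord_dom z D_eq D_eq] commutator_span_engel_plane[OF z] by simp

lemma EE_eq:
  assumes z: "z \<in> coord_dom"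
  shows "bracket Q E E (\<psi> z) = tangent Q (\<psi> z)"
  using total.bracket_eq[OF subset_refl open_coord_dom z E_eq E_eq] commutator_span_even_contact[OF z]
    total.tangent_eq[OF z] by simp

lemma engel_structure: "engel_structure_on Q (\<psi> ` coord_dom) D"
  unfolding engel_structure_on_def
proof (intro conjI)
  have 2: "(\<lambda>i::nat. f i) ` {..<2} = {f 0, f 1}" for f :: "nat \<Rightarrow> (real^3) \<times> real"
    by (auto simp: numeral_2_eq_2 lessThan_Suc)
  have 3: "(\<lambda>i::nat. f i) ` {..<3} = {f 0, f 1, f 2}" for f :: "nat \<Rightarrow> (real^3) \<times> real"
    by (auto simp: numeral_3_eq_3 numeral_2_eq_2 lessThan_Suc)
  show "distribution_on Q (\<psi> ` coord_dom) 2 D"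
    by (rule total.distribution_onI[OF subset_refl open_coord_dom,
          where \<xi>="\<lambda>i::nat. if i = 0 then (\<lambda>z. \<Theta>) else A"])
      (use engel_plane_span dim_engel_plane smooth_ABC in \<open>auto simp: 2 D_eq smooth_on_const\<close>)
  show "distribution_on Q (\<psi> ` coord_dom) 3 E"
    by (rule total.distribution_onI[OF subset_refl open_coord_dom,
          where \<xi>="\<lambda>i::nat. if i = 0 then (\<lambda>z. \<Theta>) else if i = 1 then A else B"])
      (use even_contact_span dim_even_contact smooth_ABC in \<open>auto simp: 3 E_eq smooth_on_const\<close>)
  show "\<forall>q\<in>\<psi> ` coord_dom. bracket Q E E q = tangent Q q"
    using EE_eq by blast
qed simp

lemma kernel_field_nonzero: "z \<in> coord_dom \<Longrightarrow> kernel_field z \<noteq> 0"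
  using kernel_field_props(4)[of z] by auto

text \<open>Sections near a point may extend beyond the patch, but a bracket sees only their germs,
  so the values of \<open>W\<close> elsewhere do not interfere.\<close>

lemma kernel_local:
  assumes W: "\<And>z. z \<in> coord_dom \<Longrightarrow> W (\<psi> z) = push Q \<psi> z ` span {kernel_field z}"
  shows "engel_kernel_on Q (\<psi> ` coord_dom) D W"
  unfolding engel_kernel_on_def
proof (intro conjI ballI)
  show "engel_structure_on Q (\<psi> ` coord_dom) D" by (rule engel_structure)
  have 1: "(\<lambda>i::nat. v) ` {..<1} = {v}" for v :: "(real^3) \<times> real"
    by auto
  show "distribution_on Q (\<psi> ` coord_dom) 1 W"
  proof (rule total.distribution_onI[OF subset_refl open_coord_dom, where \<xi>="\<lambda>i::nat. kernel_field"])
    fix z assume z: "z \<in> coord_dom"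
    show "W (\<psi> z) = push Q \<psi> z ` span ((\<lambda>i::nat. kernel_field z) ` {..<1})"
      by (simp only: 1 W[OF z])
    show "dim (span ((\<lambda>i::nat. kernel_field z) ` {..<1})) = 1"
      unfolding 1 by (simp add: dim_insert kernel_field_nonzero[OF z])
  qed (rule smooth_kernel_field)
  fix q assume "q \<in> \<psi> ` coord_dom"
  then obtain z where z: "z \<in> coord_dom" "q = \<psi> z" by blast
  have "span {kernel_field z} \<subseteq> even_contact z"
    by (rule span_minimal[OF _ subspace_planes(1)]) (simp add: even_contact_def kernel_field_props[OF z(1)])
  then show "W q \<subseteq> E q"
    unfolding z(2) W[OF z(1)] E_eq[OF z(1)] by (rule image_mono)
  have "bracket Q W E (\<psi> z) = push Q \<psi> z ` commutator_span coord_dom (\<lambda>z. span {kernel_field z}) even_contact z"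
    by (rule total.bracket_eq[OF subset_refl open_coord_dom z(1) W E_eq])
  then show "bracket Q W E q \<subseteq> E q"
    unfolding z(2) E_eq[OF z(1)]
    by (rule ssubst) (rule image_mono[OF commutator_span_kernel_field[OF z(1)]])
qed

lemma \<psi>_in_bundle:
  assumes z: "z \<in> coord_dom"
  shows "\<psi> z \<in> null_line_bundle M g"
proof -
  have x: "fst z \<in> V" using z by auto
  interpret F: lorentz_frame "tangent M (\<phi> (fst z))" "g (\<phi> (fst z))" "\<lambda>i. e i (\<phi> (fst z))" "push M \<phi> (fst z)"
    using lorentz_frame_at[OF coords frame_e x] x by simp
  have "\<phi> (fst z) \<in> carrier M" using base.image_subset_carrier x by blast
  then show ?thesis
    using F.null_vector_in F.null_vector_null F.null_vector_nonzero
    by (auto simp: \<psi>_def null_chart_def null_line_bundle_def null_lines_def split_beta)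
qed

text \<open>Near \<open>\<psi> z\<close> the line field has a generator with coordinate expression
  \<open>\<xi>\<close>. Containment in \<open>E\<close> puts \<open>\<xi>\<close> into
  \<open>even_contact\<close>, the bracket condition makes it characteristic at \<open>z\<close>,
  and rank one keeps the proportionality factor from vanishing.\<close>

lemma kernel_unique:
  assumes ker: "engel_kernel_on Q (null_line_bundle M g) D W" and z: "z \<in> coord_dom"
  shows "W (\<psi> z) = push Q \<psi> z ` span {kernel_field z}"
proof -
  have W: "distribution_on Q (null_line_bundle M g) 1 W"
    "\<And>q. q \<in> null_line_bundle M g \<Longrightarrow> W q \<subseteq> E q"
    "\<And>q. q \<in> null_line_bundle M g \<Longrightarrow> bracket Q W E q \<subseteq> E q"
    using ker by (auto simp: engel_kernel_on_def)
  from bspec[OF W(1)[unfolded distribution_on_def] \<psi>_in_bundle[OF z]] obtain N X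
    where NX: "openin (manifold_topology Q) N \<and> \<psi> z \<in> N \<and> N \<subseteq> null_line_bundle M g \<and>
      (\<forall>i<1. vector_field_on Q N (X i)) \<and>
      (\<forall>q\<in>N. W q = span ((\<lambda>i. X i q) ` {..<1::nat}) \<and> dim (W q) = 1)"
    by (elim exE)
  then have N: "openin (manifold_topology Q) N" "\<psi> z \<in> N" and X: "vector_field_on Q N (X 0)"
    by simp_all
  have WX: "W q = span ((\<lambda>i. X i q) ` {..<1::nat}) \<and> dim (W q) = 1" if "q \<in> N" for q
    using NX that by (elim conjE) (rule bspec)
  have W_span: "W q = span {X 0 q}" if "q \<in> N" for q
    using conjunct1[OF WX[OF that]] by (simp add: lessThan_Suc)
  define S where "S = coord_dom \<inter> \<psi> -` N"
  have S: "S \<subseteq> coord_dom" "\<psi> ` S \<subseteq> N" "open S" "z \<in> S"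
    using total.open_vimage[OF N(1)] N(2) z by (auto simp: S_def)
  obtain \<xi> where \<xi>: "smooth_on S \<xi>" "\<And>y. y \<in> S \<Longrightarrow> X 0 (\<psi> y) = push Q \<psi> y (\<xi> y)"
    by (rule total.fieldE[OF X S(1,2,3)]) (rule that)
  have W_push: "W (\<psi> y) = push Q \<psi> y ` span {\<xi> y}" if "y \<in> S" for y
  proof -
    have "y \<in> coord_dom" "\<psi> y \<in> N" using that S by auto
    then show ?thesis
      using W_span[of "\<psi> y"] \<xi>(2)[OF that] linear_span_image[OF total.linear_push, of y "{\<xi> y}"]
      by simp
  qed
  have "\<xi> y \<in> even_contact y" if "y \<in> S" for y
  proof -
    have y: "y \<in> coord_dom" using that S by auto
    have "push Q \<psi> y (\<xi> y) \<in> W (\<psi> y)"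
      unfolding W_push[OF that] by (simp add: span_base)
    then have "push Q \<psi> y (\<xi> y) \<in> push Q \<psi> y ` even_contact y"
      using W(2)[OF \<psi>_in_bundle[OF y]] E_eq[OF y] by blast
    then show ?thesis by (simp add: inj_image_mem_iff[OF total.inj_push[OF y]])
  qed
  then have sec: "\<xi> \<in> local_sections S even_contact" using \<xi>(1) by (simp add: local_sections_def)
  \<comment> \<open>The generator is itself a section of the line field, so the bracket hypothesis
    on \<open>W\<close> applies to it.\<close>
  have sec': "\<xi> \<in> local_sections S (\<lambda>y. span {\<xi> y})"
    using \<xi>(1) by (simp add: local_sections_def span_base)
  have "\<xi> z \<in> span {kernel_field z}"
  proof (rule Cauchy_characteristic[OF S(3,4,1) sec])
    fix \<eta> assume \<eta>: "\<eta> \<in> local_sections S even_contact"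
    have "push Q \<psi> z (commutator \<xi> \<eta> z) \<in> push Q \<psi> z ` commutator_span S (\<lambda>y. span {\<xi> y}) even_contact z"
      by (intro imageI commutator_spanI S sec' \<eta>)
    also have "\<dots> = bracket Q W E (\<psi> z)"
      by (rule total.bracket_eq[symmetric, OF S(1,3,4) W_push E_eq]) (use S in auto)
    also have "\<dots> \<subseteq> push Q \<psi> z ` even_contact z"
      using W(3)[OF \<psi>_in_bundle[OF z]] E_eq[OF z] by simp
    finally show "commutator \<xi> \<eta> z \<in> even_contact z"
      by (simp add: inj_image_mem_iff[OF total.inj_push[OF z]])
  qed
  then obtain k where k: "\<xi> z = k *\<^sub>R kernel_field z" by (auto simp: span_singleton)
  have "k \<noteq> 0"
  proof
    assume "k = 0"
    then have "X 0 (\<psi> z) = 0"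
      using \<xi>(2)[OF S(4)] k linear_0[OF total.linear_push[OF z]] by simp
    then have "W (\<psi> z) = span {}" using W_span[OF N(2)] by simp
    then have "dim (W (\<psi> z)) = 0"
      by (simp only: dim_span dim_eq_card_independent[OF independent_empty] card.empty)
    then show False using conjunct2[OF WX[OF N(2)]] by simp
  qed
  then show ?thesis
    unfolding W_push[OF S(4)] k by (simp add: span_singleton_scaleR)
qed

end

theorem proposition4p7:
  fixes M :: "(real^3, 'm) atlas"
    and g :: "'m \<Rightarrow> 'm tvec \<Rightarrow> 'm tvec \<Rightarrow> real"
    and \<tau> :: "'m \<Rightarrow> 'm tvec set"
    and V :: "(real^3) set"
    and \<phi> :: "real^3 \<Rightarrow> 'm"
    and g11 g22 g33 :: "real^3 \<Rightarrow> real"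
    and u :: "3 \<Rightarrow> real^3 \<Rightarrow> 'm tvec"
    and \<Psi> :: "(real^3) \<times> real \<Rightarrow> 'm \<times> 'm tvec set"
    and Q :: "((real^3) \<times> real, 'm \<times> 'm tvec set) atlas"
    and D :: "'m \<times> 'm tvec set \<Rightarrow> ('m \<times> 'm tvec set) tvec set"
    and dx :: "3 \<Rightarrow> (real^3) \<times> real \<Rightarrow> ('m \<times> 'm tvec set) tvec"
    and d\<theta> Z :: "(real^3) \<times> real \<Rightarrow> ('m \<times> 'm tvec set) tvec"
    and F G H :: "real^3 \<Rightarrow> real \<Rightarrow> real"
  assumes "spacetime M g \<tau>"
    and "local_coordinates M V \<phi>"
    and u: "\<And>i x. u i x = push M \<phi> x (axis i 1)"
    and "smooth_on V g11" "smooth_on V g22" "smooth_on V g33"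
    and "\<And>x. x \<in> V \<Longrightarrow> g11 x > 0 \<and> g22 x > 0 \<and> g33 x < 0"
    and "\<And>x. x \<in> V \<Longrightarrow> g (\<phi> x) (u 1 x) (u 1 x) = g11 x"
    and "\<And>x. x \<in> V \<Longrightarrow> g (\<phi> x) (u 2 x) (u 2 x) = g22 x"
    and "\<And>x. x \<in> V \<Longrightarrow> g (\<phi> x) (u 3 x) (u 3 x) = g33 x"
    and "\<And>x i j. x \<in> V \<Longrightarrow> i \<noteq> j \<Longrightarrow> g (\<phi> x) (u i x) (u j x) = 0"
    and Q: "Q = lorentz_prolongation M g"
    and D: "D = prolongation_distribution M g"
    and \<Psi>: "\<And>x \<theta>. \<Psi> (x, \<theta>) =
      (\<phi> x, span {(cos \<theta> / sqrt (g11 x)) *\<^sub>R u 1 x + (sin \<theta> / sqrt (g22 x)) *\<^sub>R u 2 x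
                  + (1 / sqrt (- g33 x)) *\<^sub>R u 3 x})"
    and dx: "\<And>i x \<theta>. dx i (x, \<theta>) = push Q \<Psi> (x, \<theta>) (axis i 1, 0)"
    and d\<theta>: "\<And>x \<theta>. d\<theta> (x, \<theta>) = push Q \<Psi> (x, \<theta>) (0, 1)"
    and F: "\<And>x \<theta>. F x \<theta> = 1 / (2 * g11 x) *
      (1 / sqrt (g22 x) * partial_deriv 2 g11 x
       + sin \<theta> / sqrt (- g33 x) * partial_deriv 3 g11 x)"
    and G: "\<And>x \<theta>. G x \<theta> = - (1 / (2 * g22 x)) *
      (1 / sqrt (g11 x) * partial_deriv 1 g22 x
       + cos \<theta> / sqrt (- g33 x) * partial_deriv 3 g22 x)"
    and H: "\<And>x \<theta>. H x \<theta> = 1 / (2 * g33 x) *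
      (sin \<theta> / sqrt (g11 x) * partial_deriv 1 g33 x
       - cos \<theta> / sqrt (g22 x) * partial_deriv 2 g33 x)"
    and Z: "\<And>x \<theta>. Z (x, \<theta>) =
      (cos \<theta> / sqrt (g11 x)) *\<^sub>R dx 1 (x, \<theta>) + (sin \<theta> / sqrt (g22 x)) *\<^sub>R dx 2 (x, \<theta>)
      + (1 / sqrt (- g33 x)) *\<^sub>R dx 3 (x, \<theta>)
      + (F x \<theta> * cos \<theta> + G x \<theta> * sin \<theta> + H x \<theta>) *\<^sub>R d\<theta> (x, \<theta>)"
  shows "(\<forall>W. engel_kernel_on Q (null_line_bundle M g) D W \<longrightarrow>
            (\<forall>x\<in>V. \<forall>\<theta>\<in>{0<..<2 * pi}. W (\<Psi> (x, \<theta>)) = span {Z (x, \<theta>)}))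
       \<and> (\<forall>W. (\<forall>x\<in>V. \<forall>\<theta>\<in>{0<..<2 * pi}. W (\<Psi> (x, \<theta>)) = span {Z (x, \<theta>)}) \<longrightarrow>
            engel_kernel_on Q (\<Psi> ` (V \<times> {0<..<2 * pi})) D W)"
proof -
  note sp = assms(1) and lc = assms(2) and smooth_g = assms(4-6) and sign = assms(7)
    and g11 = assms(8) and g22 = assms(9) and g33 = assms(10) and off = assms(11)
  interpret diagonal_chart M g V \<phi> g11 g22 g33
  proof unfold_locales
    show "smooth_manifold M" "lorentz_metric M g" using sp by (simp_all add: spacetime_def)
    fix x and i j :: 3 assume x: "x \<in> V"
    have "i = 1 \<or> i = 2 \<or> i = 3" by (rule exhaust_3)
    then show "g (\<phi> x) (push M \<phi> x (axis i 1)) (push M \<phi> x (axis j 1)) =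
      (if i \<noteq> j then 0 else if i = 1 then g11 x else if i = 2 then g22 x else g33 x)"
      using g11[OF x] g22[OF x] g33[OF x] off[OF x] unfolding u by auto
  qed (use lc smooth_g sign in auto)
  have \<Psi>_eq: "\<Psi> z = \<psi> z" if "z \<in> coord_dom" for z
  proof (cases z)
    case (Pair x t)
    then have x: "x \<in> V" using that by simp
    show ?thesis
      by (simp add: Pair \<Psi> \<psi>_def null_chart_def null_vector_def e_eq[OF x] p_def u)
  qed
  \<comment> \<open>\<open>\<Psi>\<close> and \<open>\<psi>\<close> are known to agree on
    \<open>coord_dom\<close> only; openness of this set makes their derivatives agree there
    too.\<close>
  have push_eq: "push Q \<Psi> z = push Q \<psi> z" if z: "z \<in> coord_dom" for z
  proof -
    have "frechet_derivative (f \<circ> \<Psi>) (at z) = frechet_derivative (f \<circ> \<psi>) (at z)" for f :: "_ \<Rightarrow> real"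
      by (rule frechet_derivative_cong[OF open_coord_dom z]) (simp add: \<Psi>_eq)
    then show ?thesis by (intro ext) (simp only: push_def \<Psi>_eq[OF z])
  qed
  have c: "c (x, t) = F x t * cos t + G x t * sin t + H x t" if x: "x \<in> V" and t: "t \<in> {0<..<2 * pi}" for x t
  proof -
    have pd: "partial_deriv i (\<lambda>x. sqrt (f x)) x = partial_deriv i f x / (2 * sqrt (f x))"
      if "smooth_on V f" "f x > 0" for f i
      unfolding partial_deriv_def
      by (rule frechet_derivative_sqrt[OF smooth_on_differentiable[OF that(1) x] that(2)])
    have pd_minus: "partial_deriv i (\<lambda>x. - g33 x) x = - partial_deriv i g33 x" for i
      unfolding partial_deriv_def
      by (rule frechet_derivative_eqI[OF has_derivative_minus[OF smooth_on_has_derivative[OF smooth_g(3) x]]])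
    \<comment> \<open>The minus sign is absorbed below by g33 = - d^2, so the last coefficient has
      the factor 1 / (2 g33) with the sign of g33 kept.\<close>
    have pd3: "partial_deriv i (\<lambda>x. sqrt (- g33 x)) x = - partial_deriv i g33 x / (2 * sqrt (- g33 x))" for i
      using pd[OF smooth_on_minus[OF base.open_domain smooth_g(3)], of i] sign[OF x] pd_minus by simp
    have sq: "g11 x = sqrt (g11 x) * sqrt (g11 x)" "g22 x = sqrt (g22 x) * sqrt (g22 x)"
      "g33 x = - (sqrt (- g33 x) * sqrt (- g33 x))"
      using sign[OF x] by simp_all
    \<comment> \<open>With the roots as basic quantities both sides are rational in
      \<open>a\<close>, \<open>b\<close>, \<open>d\<close>, the trigonometric values and the partial
      derivatives, so clearing denominators proves the identity.\<close>
    define a b d where "a = sqrt (g11 x)" and "b = sqrt (g22 x)" and "d = sqrt (- g33 x)"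
    have nz: "a \<noteq> 0" "b \<noteq> 0" "d \<noteq> 0" using sign[OF x] by (simp_all add: a_def b_def d_def)
    have g: "g11 x = a * a" "g22 x = b * b" "g33 x = - (d * d)"
      using sq by (simp_all add: a_def b_def d_def)
    have lhs: "c (x, t) =
        cos t * (partial_deriv 2 g11 x / (2 * a) / b + sin t * (partial_deriv 3 g11 x / (2 * a)) / d) / a
        - sin t * (partial_deriv 1 g22 x / (2 * b) / a + cos t * (partial_deriv 3 g22 x / (2 * b)) / d) / b
        + (sin t * (- partial_deriv 1 g33 x / (2 * d)) / a - cos t * (- partial_deriv 2 g33 x / (2 * d)) / b) / d"
      unfolding c_eq[OF x t] pd3 pd[OF smooth_g(1) sign(1)[OF x]]
        pd[OF smooth_g(2) sign(2)[OF x]] a_def b_def d_def ..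
    have rhs: "F x t * cos t + G x t * sin t + H x t =
        1 / (2 * (a * a)) * (1 / b * partial_deriv 2 g11 x + sin t / d * partial_deriv 3 g11 x) * cos t
        + - (1 / (2 * (b * b))) * (1 / a * partial_deriv 1 g22 x + cos t / d * partial_deriv 3 g22 x) * sin t
        + 1 / (2 * (- (d * d))) * (sin t / a * partial_deriv 1 g33 x - cos t / b * partial_deriv 2 g33 x)"
      unfolding F G H a_def[symmetric] b_def[symmetric] d_def[symmetric] unfolding g ..
    show ?thesis
      unfolding lhs rhs using nz by (simp add: field_simps)
  qed
  have Z_eq: "Z (x, t) = push Q \<psi> (x, t) (kernel_field (x, t))" if x: "x \<in> V" and t: "t \<in> {0<..<2 * pi}" for x t
  proof -
    have z: "(x, t) \<in> coord_dom" using x t by simp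
    note lin = linear_add[OF total.linear_push[OF z]] linear_scale[OF total.linear_push[OF z]]
    show ?thesis
      unfolding Z dx d\<theta> push_eq[OF z]
      unfolding Q kernel_field_def A_def c[OF x t] lin fst_conv snd_conv ..
  qed
  have W_span: "push Q \<psi> (x, t) ` span {kernel_field (x, t)} = span {Z (x, t)}"
    if "x \<in> V" "t \<in> {0<..<2 * pi}" for x t
    using linear_span_image[OF total.linear_push, of "(x, t)" "{kernel_field (x, t)}"] that
    by (simp add: Z_eq[OF that] Q)
  show ?thesis
  proof (intro conjI allI impI ballI)
    fix W x \<theta> assume "engel_kernel_on Q (null_line_bundle M g) D W" "x \<in> V" "\<theta> \<in> {0<..<2 * pi}"
    then show "W (\<Psi> (x, \<theta>)) = span {Z (x, \<theta>)}"
      using kernel_unique[of W "(x, \<theta>)"] W_span[of x \<theta>] \<Psi>_eq[of "(x, \<theta>)"] unfolding Q D by simp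
  next
    fix W assume W: "\<forall>x\<in>V. \<forall>\<theta>\<in>{0<..<2 * pi}. W (\<Psi> (x, \<theta>)) = span {Z (x, \<theta>)}"
    have "\<Psi> ` coord_dom = \<psi> ` coord_dom" using \<Psi>_eq by (rule image_cong[OF refl])
    moreover have "W (\<psi> z) = push Q \<psi> z ` span {kernel_field z}" if "z \<in> coord_dom" for z
      using that W W_span \<Psi>_eq by (cases z) auto
    ultimately show "engel_kernel_on Q (\<Psi> ` (V \<times> {0<..<2 * pi})) D W"
      using kernel_local[of W] unfolding Q D by simp
  qed
qed

end
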